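(* Let $\varphi$ be an Orlicz function with complementary function $\psi$, and let $\omega:[0,\infty)\to[0,\infty)$ be a weight function that is not identically zero. Then the Orlicz-Lorentz space $\Lambda^\circ_{\varphi,\omega}[0,\infty)$ (endowed with the Orlicz norm) is locally uniformly non-square if and only if both of the following hold: (a) $\psi\in\Delta_2(\mathbb{R})$; (b) $\int_0^\infty\omega(t)\,dt=\infty$.
   Context: Orlicz function: $\varphi:\mathbb{R}\to[0,\infty)$ is convex, even, $\varphi(0)=0$, $\varphi(u)>0$ for all $u>0$, $\lim_{u\to0}\varphi(u)/u=0$ and $\lim_{u\to\infty}\varphi(u)/u=\infty$. Its complementary function is $\psi(v)=\sup_{u>0}\{|uv|-\varphi(u)\}$, $v\in\mathbb{R}$ (again an Orlicz function). $\psi\in\Delta_2(\mathbb{R})$ means that there is a constant $K>0$ with $\psi(2u)\le K\psi(u)$ for all $u\in\mathbb{R}$. Rearrangements: let $\gamma=\infty$ and let $\mu$ be Lebesgue measure. For measurable $x:[0,\gamma)\to\mathbb{R}$, put $d_x(\theta)=\mu\{s\in[0,\gamma):|x(s)|>\theta\}$ and $x^\ast(t)=\inf\{\theta>0:d_x(\theta)\le t\}$, $t\ge0$. Weight function: $\omega:[0,\gamma)\to[0,\infty)$ that is non-increasing and locally integrable (so integrable near $0$). Put $\rho_{\varphi,\omega}(x)=\int_0^\gamma\varphi(x^\ast(t))\omega(t)\,dt$, and similarly $\rho_{\psi,\omega}$. The Orlicz-Lorentz space $\Lambda_{\varphi,\omega}[0,\gamma)$ is the set of (classes of a.e. equal)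 measurable functions $x$ on $[0,\gamma)$ with $\rho_{\varphi,\omega}(\lambda x)<\infty$ for some $\lambda>0$. The Orlicz norm is $$\|x\|^\circ_{\varphi,\omega}=\sup_{\rho_{\psi,\omega}(y)\le1}\int_0^\gamma x^\ast(t)y^\ast(t)\omega(t)\,dt=\inf_{k>0}\frac1k\bigl(1+\rho_{\varphi,\omega}(kx)\bigr),$$ the supremum being over measurable $y$ on $[0,\gamma)$ (the second equality is known). $\Lambda^\circ_{\varphi,\omega}[0,\gamma)$ denotes $\Lambda_{\varphi,\omega}[0,\gamma)$ with this norm; it is a Banach space. A Banach space $X$ with unit sphere $S(X)$ and closed unit ball $B(X)$ is locally uniformly non-square if for every $x\in S(X)$ there exists $\delta=\delta(x)\in(0,1)$ such that $\min\{\|\frac{x-y}{2}\|,\|\frac{x+y}{2}\|\}\le1-\delta$ for all $y\in B(X)$. *)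

theory Defs
  imports "HOL-Analysis.Analysis"
begin

definition orlicz_function :: "(real \<Rightarrow> real) \<Rightarrow> bool" where
  "orlicz_function \<phi> \<longleftrightarrow>
     (\<forall>u. 0 \<le> \<phi> u) \<and> convex_on UNIV \<phi> \<and> (\<forall>u. \<phi> (- u) = \<phi> u) \<and>
     \<phi> 0 = 0 \<and> (\<forall>u>0. 0 < \<phi> u) \<and>
     ((\<lambda>u. \<phi> u / u) \<longlongrightarrow> 0) (at 0) \<and>
     filterlim (\<lambda>u. \<phi> u / u) at_top at_top"

text \<open>The supremum is taken in the reals. It is finite when \<open>\<phi>\<close> is an Orlicz function,
  because \<open>\<phi> u / u\<close> tends to infinity.\<close>

definition complementary :: "(real \<Rightarrow> real) \<Rightarrow> real \<Rightarrow> real" where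
  "complementary \<phi> v = (SUP u\<in>{0<..}. \<bar>u * v\<bar> - \<phi> u)"

definition Delta2 :: "(real \<Rightarrow> real) \<Rightarrow> bool" where
  "Delta2 \<psi> \<longleftrightarrow> (\<exists>K>0. \<forall>u. \<psi> (2 * u) \<le> K * \<psi> u)"

text \<open>A measurable function on the half-line is a function on all reals that is measurable
  with respect to \<open>lebesgue_on {0..}\<close>; its values at negative arguments are never used.\<close>

definition distribution_function :: "(real \<Rightarrow> real) \<Rightarrow> real \<Rightarrow> ennreal" where
  "distribution_function x \<theta> = emeasure lebesgue {s\<in>{0..}. \<theta> < \<bar>x s\<bar>}"

text \<open>The rearrangement is extended-valued: the infimum of the empty set is \<open>\<infinity>\<close>.\<close>

definition rearrangement :: "(real \<Rightarrow> real) \<Rightarrow> real \<Rightarrow> ennreal" where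
  "rearrangement x t =
     (INF \<theta>\<in>{\<theta>. 0 < \<theta> \<and> distribution_function x \<theta> \<le> ennreal t}. ennreal \<theta>)"

text \<open>Monotonicity is required on the open half-line only, so that weights that are unbounded
  near \<open>0\<close> (such as \<open>t powr (-1/2)\<close>) are included; the value at the null set \<open>{0}\<close> is
  immaterial. Integrability near \<open>0\<close> would otherwise be automatic.\<close>

definition weight_function :: "(real \<Rightarrow> real) \<Rightarrow> bool" where
  "weight_function \<omega> \<longleftrightarrow>
     (\<forall>t\<ge>0. 0 \<le> \<omega> t) \<and> antimono_on {0<..} \<omega> \<and>
     (\<forall>a>0. set_integrable lebesgue {0..a} \<omega>)"

text \<open>Extension of an Orlicz function to arguments in \<open>[0, \<infinity>]\<close> with value \<open>\<infinity>\<close> at \<open>\<infinity>\<close>.\<close>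

definition extend_top :: "(real \<Rightarrow> real) \<Rightarrow> ennreal \<Rightarrow> ennreal" where
  "extend_top \<phi> a = (if a = top then top else ennreal (\<phi> (enn2real a)))"

definition modular :: "(real \<Rightarrow> real) \<Rightarrow> (real \<Rightarrow> real) \<Rightarrow> (real \<Rightarrow> real) \<Rightarrow> ennreal" where
  "modular \<phi> \<omega> x =
     (\<integral>\<^sup>+t\<in>{0..}. (extend_top \<phi> (rearrangement x t) * ennreal (\<omega> t)) \<partial>lebesgue)"

text \<open>The elements of the space are represented by functions rather than by classes of almost
  everywhere equal functions. Rearrangement, modular and norm depend only on the class, so
  nothing below depends on the choice of representatives.\<close>

definition orlicz_lorentz_space :: "(real \<Rightarrow> real) \<Rightarrow> (real \<Rightarrow> real) \<Rightarrow> (real \<Rightarrow> real) set" where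
  "orlicz_lorentz_space \<phi> \<omega> =
     {x \<in> borel_measurable (lebesgue_on {0..}). \<exists>l>0. modular \<phi> \<omega> (\<lambda>s. l * x s) < top}"

text \<open>On the Orlicz-Lorentz space the supremum is finite by Young's inequality, so that
  \<open>enn2real\<close> loses no information there; outside the space the value is not meaningful.\<close>

definition orlicz_norm :: "(real \<Rightarrow> real) \<Rightarrow> (real \<Rightarrow> real) \<Rightarrow> (real \<Rightarrow> real) \<Rightarrow> real" where
  "orlicz_norm \<phi> \<omega> x =
     enn2real (SUP y\<in>{y \<in> borel_measurable (lebesgue_on {0..}).
                        modular (complementary \<phi>) \<omega> y \<le> 1}.
       \<integral>\<^sup>+t\<in>{0..}. (rearrangement x t * rearrangement y t * ennreal (\<omega> t)) \<partial>lebesgue)"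

text \<open>Here \<open>X\<close> is the carrier of a space of real-valued functions (with pointwise operations)
  and \<open>N\<close> its norm.\<close>

definition locally_uniformly_non_square ::
    "('a \<Rightarrow> real) set \<Rightarrow> (('a \<Rightarrow> real) \<Rightarrow> real) \<Rightarrow> bool" where
  "locally_uniformly_non_square X N \<longleftrightarrow>
     (\<forall>x\<in>X. N x = 1 \<longrightarrow>
       (\<exists>\<delta>\<in>{0<..<1}. \<forall>y\<in>X. N y \<le> 1 \<longrightarrow>
          min (N (\<lambda>s. (x s - y s) / 2)) (N (\<lambda>s. (x s + y s) / 2)) \<le> 1 - \<delta>))"

end

theory Submission
  imports Defs
begin

text \<open>Sufficiency. For \<open>\<parallel>x\<parallel> = 1\<close> and \<open>\<parallel>y\<parallel> \<le> 1\<close> choose \<open>k\<close>, \<open>l\<close> that are nearly optimal in the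
  Amemiya formula \<open>\<parallel>x\<parallel> = inf (1 + \<rho>(k x)) / k\<close>. With \<open>a = l/(k+l)\<close> and \<open>b = k/(k+l)\<close> convexity gives
  \<open>\<parallel>(x \<plusminus> y)/2\<parallel> \<le> (k+l)/(2kl) (1 + \<rho>(a k x \<plusminus> b l y))\<close>. Where \<open>x\<close> and \<open>y\<close> have the same sign, the
  \<open>\<nabla>\<^sub>2\<close>-condition on \<open>\<phi>\<close>, dual to \<open>\<psi> \<in> \<Delta>\<^sub>2\<close>, improves the convexity estimate of \<open>\<phi>(a k x - b l y)\<close>
  by a multiple of \<open>\<phi>(k x)\<close>; elsewhere that of \<open>\<phi>(a k x + b l y)\<close>. As \<open>u \<mapsto> \<integral> u* \<omega>\<close> is sublinear, the
  two gains add up to a multiple of \<open>2 \<rho>(k x) - \<rho>(k x 1\<^sub>E) - \<rho>(k x 1\<^sub>D)\<close> with \<open>D\<close>, \<open>E\<close> complementary,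
  and this is bounded below because one of the two parts of every level set has at most half of its
  (finite) measure while \<open>\<omega> > 0\<close>.

  Necessity. If \<open>\<integral> \<omega> < \<infinity>\<close>, a constant \<open>x\<close> and a function \<open>y\<close> with \<open>\<bar>y\<bar> = x\<close> that has both signs on
  sets of infinite measure satisfy \<open>\<parallel>(x \<plusminus> y)/2\<parallel> = 1\<close>. If \<open>\<psi> \<notin> \<Delta>\<^sub>2\<close>, pairs of disjoint normalised
  indicators, the first of them fixed, span almost isometric copies of \<open>\<ell>\<^sup>1\<close>.\<close>

subsection \<open>Orlicz functions and their complementary functions\<close>

text \<open>The Amemiya formula is not presupposed. What is proved is that for every
  \<open>e > 0\<close> some \<open>k\<close> keeps the Amemiya value below \<open>1 + e\<close> when
  the norm is at most \<open>1\<close>. Hence the convexity gain must beat \<open>e\<close> and must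
  not depend on \<open>k\<close>, \<open>l\<close> or \<open>y\<close>. The gain on the level sets
  depends on \<open>x\<close> alone once \<open>k \<ge> 1/2\<close>. It comes with a factor
  \<open>1 / (k + l)\<close>, so \<open>k\<close> and \<open>l\<close> have to be bounded: the
  condition dual to \<open>Delta2\<close> bounds \<open>k\<close> because the norm of
  \<open>x\<close> equals \<open>1\<close>, whereas a large \<open>l\<close> shows that the norm of
  \<open>y\<close> is well below \<open>1\<close>, which settles that case directly. Since
  rearrangement is not additive, pointwise gains cannot simply be integrated; modulars are therefore
  rewritten as a Lorentz functional of \<open>\<phi> \<circ> x\<close>, and the gains are arranged
  as sums of nonnegative functions to which subadditivity applies. For necessity the same
  \<open>x\<close> has to defeat every \<open>\<delta>\<close>, so only the second indicator may
  vary; \<open>Delta2\<close> may fail near \<open>0\<close> or near infinity, and in both cases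
  \<open>\<psi> r / \<psi> 1\<close> becomes extreme, which is what keeps the two indicators from
  interfering in the rearrangement.\<close>

locale orlicz =
  fixes \<phi> :: "real \<Rightarrow> real"
  assumes orlicz: "orlicz_function \<phi>"
begin

abbreviation "\<psi> \<equiv> complementary \<phi>"

lemma nonneg [simp]: "0 \<le> \<phi> u"
  and convex: "convex_on UNIV \<phi>"
  and even [simp]: "\<phi> (- u) = \<phi> u"
  and zero [simp]: "\<phi> 0 = 0"
  and pos: "0 < u \<Longrightarrow> 0 < \<phi> u"
  and quotient_at_0: "((\<lambda>u. \<phi> u / u) \<longlongrightarrow> 0) (at 0)"
  and quotient_at_top: "filterlim (\<lambda>u. \<phi> u / u) at_top at_top"
  using orlicz by (auto simp: orlicz_function_def)

lemma abs_arg [simp]: "\<phi> \<bar>u\<bar> = \<phi> u"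
  by (auto simp: abs_if)

lemma scale_le: "0 \<le> a \<Longrightarrow> a \<le> 1 \<Longrightarrow> \<phi> (a * u) \<le> a * \<phi> u"
  using convex_onD[OF convex, of a 0 u] by simp

lemma scale_ge: "1 \<le> a \<Longrightarrow> a * \<phi> u \<le> \<phi> (a * u)"
  using scale_le[of "1/a" "a * u"] by (simp add: field_simps)

lemma strict_mono_nonneg: "0 \<le> u \<Longrightarrow> u < v \<Longrightarrow> \<phi> u < \<phi> v"
proof -
  assume uv: "0 \<le> u" "u < v"
  have "\<phi> ((u/v) * v) \<le> (u/v) * \<phi> v" using uv by (intro scale_le) auto
  also have "\<dots> < 1 * \<phi> v" using uv pos[of v] by (intro mult_strict_right_mono) auto
  finally show ?thesis using uv by simp
qed

lemma mono_nonneg: "0 \<le> u \<Longrightarrow> u \<le> v \<Longrightarrow> \<phi> u \<le> \<phi> v"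
  using strict_mono_nonneg[of u v] by (cases "u = v") auto

lemma less_iff: "0 \<le> u \<Longrightarrow> 0 \<le> v \<Longrightarrow> \<phi> u < \<phi> v \<longleftrightarrow> u < v"
  using strict_mono_nonneg mono_nonneg by (meson not_le)

lemma mono_abs: "\<bar>u\<bar> \<le> \<bar>v\<bar> \<Longrightarrow> \<phi> u \<le> \<phi> v"
  using mono_nonneg[of "\<bar>u\<bar>" "\<bar>v\<bar>"] by simp

lemma continuous: "continuous_on A \<phi>"
  using convex_on_continuous[OF open_UNIV convex] continuous_on_subset by blast

lemma measurable [measurable]: "\<phi> \<in> borel_measurable borel"
  by (rule borel_measurable_continuous_onI) (rule continuous)

lemma superlinear: "\<exists>U>0. \<forall>u\<ge>U. c * u \<le> \<phi> u"
proof -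
  have "eventually (\<lambda>u. c \<le> \<phi> u / u) at_top"
    using quotient_at_top by (auto simp: filterlim_at_top)
  then obtain U where U: "\<And>u. u \<ge> U \<Longrightarrow> c \<le> \<phi> u / u"
    by (auto simp: eventually_at_top_linorder)
  have "c * u \<le> \<phi> u" if "u \<ge> max 1 U" for u
    using U[of u] that by (simp add: pos_le_divide_eq)
  then show ?thesis by (intro exI[of _ "max 1 U"]) auto
qed

lemma surj_nonneg: "0 \<le> y \<Longrightarrow> \<exists>u\<ge>0. \<phi> u = y"
proof -
  assume y: "0 \<le> y"
  obtain U where U: "U > 0" "\<And>u. u \<ge> U \<Longrightarrow> 1 * u \<le> \<phi> u" using superlinear by blast
  have "\<phi> 0 \<le> y" "y \<le> \<phi> (max U y)" using y U(2)[of "max U y"] by auto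
  then show ?thesis
    using IVT'[of \<phi> 0 y "max U y"] y continuous by force
qed

section \<open>The complementary function\<close>

lemma complementary_bdd: "bdd_above ((\<lambda>u. \<bar>u * v\<bar> - \<phi> u) ` {0<..})"
proof -
  obtain U where U: "U > 0" "\<And>u. u \<ge> U \<Longrightarrow> \<bar>v\<bar> * u \<le> \<phi> u" using superlinear by blast
  have "\<bar>u * v\<bar> - \<phi> u \<le> U * \<bar>v\<bar>" if "u > 0" for u
  proof (cases "u \<ge> U")
    case True
    then have "\<bar>u * v\<bar> \<le> \<phi> u" using U(2)[of u] that by (simp add: abs_mult mult.commute)
    moreover have "0 \<le> U * \<bar>v\<bar>" using U(1) by simp
    ultimately show ?thesis by linarith
  next
    case False
    then have "\<bar>u * v\<bar> \<le> U * \<bar>v\<bar>" using that by (auto simp: abs_mult intro!: mult_right_mono)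
    moreover have "0 \<le> \<phi> u" by simp
    ultimately show ?thesis by linarith
  qed
  then show ?thesis by (intro bdd_aboveI2[where M="U * \<bar>v\<bar>"]) auto
qed

lemma young_pos: "0 < u \<Longrightarrow> \<bar>u * v\<bar> - \<phi> u \<le> \<psi> v"
  unfolding complementary_def by (rule cSUP_upper[OF _ complementary_bdd]) auto

lemma complementary_leI: "(\<And>u. 0 < u \<Longrightarrow> \<bar>u * v\<bar> - \<phi> u \<le> c) \<Longrightarrow> \<psi> v \<le> c"
  unfolding complementary_def by (rule cSUP_least) auto

text \<open>The supremum runs over \<open>u > 0\<close> only, so the value \<open>0\<close> is not
  attained but approached, by \<open>- \<phi> a\<close> with
  \<open>\<phi> a \<le> a * \<phi> 1\<close> and \<open>a\<close> small.\<close>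

lemma complementary_zero [simp]: "\<psi> 0 = 0"
proof (rule antisym)
  show "\<psi> 0 \<le> 0" by (rule complementary_leI) auto
  show "0 \<le> \<psi> 0"
  proof (rule ccontr)
    assume "\<not> 0 \<le> \<psi> 0"
    then have neg: "\<psi> 0 < 0" by simp
    define a where "a = min 1 (- \<psi> 0 / (2 * \<phi> 1))"
    have p1: "\<phi> 1 > 0" by (rule pos) simp
    have a: "0 < a" "a \<le> 1" "a * \<phi> 1 \<le> - \<psi> 0 / 2"
      using neg p1 by (auto simp: a_def min_def field_simps)
    have "\<phi> a \<le> a * \<phi> 1" using scale_le[of a 1] a by simp
    then have "\<phi> a \<le> - \<psi> 0 / 2" using a by linarith
    moreover have "- \<phi> a \<le> \<psi> 0" using young_pos[of a 0] a by simp
    ultimately show False using neg by linarith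
  qed
qed

text \<open>This is where \<open>\<phi> u / u\<close> tending to \<open>0\<close> at
  \<open>0\<close> enters: for small \<open>u\<close> the line of slope \<open>\<bar>v\<bar>\<close>
  lies strictly above \<open>\<phi>\<close>.\<close>

lemma complementary_pos: "v \<noteq> 0 \<Longrightarrow> 0 < \<psi> v"
proof -
  assume v: "v \<noteq> 0"
  have "eventually (\<lambda>u. \<bar>\<phi> u / u\<bar> < \<bar>v\<bar>) (at 0)"
    using quotient_at_0 v by (auto simp: tendsto_iff dist_real_def)
  then obtain d where d: "d > 0" "\<And>u. u \<noteq> 0 \<Longrightarrow> \<bar>u\<bar> < d \<Longrightarrow> \<bar>\<phi> u / u\<bar> < \<bar>v\<bar>"
    by (auto simp: eventually_at dist_real_def)
  have "\<bar>\<phi> (d/2) / (d/2)\<bar> < \<bar>v\<bar>" using d(1) by (intro d(2)) auto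
  then have "\<phi> (d/2) < \<bar>(d/2) * v\<bar>" using d(1) by (simp add: abs_mult field_simps)
  then show ?thesis using young_pos[of "d/2" v] d(1) by linarith
qed

lemma complementary_nonneg [simp]: "0 \<le> \<psi> v"
  using complementary_pos[of v] by (cases "v = 0") auto

lemma complementary_abs [simp]: "\<psi> \<bar>v\<bar> = \<psi> v"
  by (simp add: complementary_def abs_mult)

lemma young: "0 \<le> u \<Longrightarrow> 0 \<le> v \<Longrightarrow> u * v \<le> \<phi> u + \<psi> v"
  using young_pos[of u v] by (cases "u = 0") (auto simp: abs_mult)

lemma complementary_convex: "convex_on UNIV \<psi>"
proof (rule convex_onI)
  fix t x y :: real assume t: "0 < t" "t < 1"
  show "\<psi> ((1 - t) *\<^sub>R x + t *\<^sub>R y) \<le> (1 - t) * \<psi> x + t * \<psi> y"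
  proof (rule complementary_leI)
    fix u :: real assume u: "0 < u"
    have "\<bar>u * ((1 - t) *\<^sub>R x + t *\<^sub>R y)\<bar> = \<bar>(1 - t) * (u * x) + t * (u * y)\<bar>"
      by (simp add: algebra_simps)
    also have "\<dots> \<le> (1 - t) * \<bar>u * x\<bar> + t * \<bar>u * y\<bar>"
      using t by (intro order_trans[OF abs_triangle_ineq]) (simp add: abs_mult)
    finally have "\<bar>u * ((1 - t) *\<^sub>R x + t *\<^sub>R y)\<bar> - \<phi> u
        \<le> (1 - t) * (\<bar>u * x\<bar> - \<phi> u) + t * (\<bar>u * y\<bar> - \<phi> u)"
      by (simp add: algebra_simps)
    also have "\<dots> \<le> (1 - t) * \<psi> x + t * \<psi> y"
      using t u by (intro add_mono mult_left_mono young_pos) auto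
    finally show "\<bar>u * ((1 - t) *\<^sub>R x + t *\<^sub>R y)\<bar> - \<phi> u \<le> (1 - t) * \<psi> x + t * \<psi> y" .
  qed
qed simp

lemma complementary_scale_le: "0 \<le> a \<Longrightarrow> a \<le> 1 \<Longrightarrow> \<psi> (a * u) \<le> a * \<psi> u"
  using convex_onD[OF complementary_convex, of a 0 u] by simp

lemma complementary_continuous: "continuous_on A \<psi>"
  using convex_on_continuous[OF open_UNIV complementary_convex] continuous_on_subset by blast

lemma complementary_measurable [measurable]: "\<psi> \<in> borel_measurable borel"
  by (rule borel_measurable_continuous_onI) (rule complementary_continuous)

lemma complementary_strict_mono: "0 \<le> u \<Longrightarrow> u < v \<Longrightarrow> \<psi> u < \<psi> v"
proof -
  assume uv: "0 \<le> u" "u < v"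
  have "\<psi> ((u/v) * v) \<le> (u/v) * \<psi> v" using uv by (intro complementary_scale_le) auto
  also have "\<dots> < 1 * \<psi> v" using uv complementary_pos[of v] by (intro mult_strict_right_mono) auto
  finally show ?thesis using uv by simp
qed

lemma complementary_mono: "0 \<le> u \<Longrightarrow> u \<le> v \<Longrightarrow> \<psi> u \<le> \<psi> v"
  using complementary_strict_mono[of u v] by (cases "u = v") auto

lemma complementary_ge_linear: "0 \<le> v \<Longrightarrow> v - \<phi> 1 \<le> \<psi> v"
  using young_pos[of 1 v] by simp

lemma complementary_surj: "0 \<le> y \<Longrightarrow> \<exists>v\<ge>0. \<psi> v = y"
proof -
  assume y: "0 \<le> y"
  have "\<psi> 0 \<le> y" "y \<le> \<psi> (y + \<phi> 1)" using y complementary_ge_linear[of "y + \<phi> 1"] by auto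
  then show ?thesis
    using IVT'[of \<psi> 0 y "y + \<phi> 1"] y complementary_continuous by auto
qed

section \<open>Subgradients and equality in Young's inequality\<close>

lemma subgradient_exists: "\<exists>v. \<forall>w. \<phi> u + v * (w - u) \<le> \<phi> w"
  using convex_le_Inf_differential[OF convex, of u] by auto

text \<open>A fixed selection from the subdifferential, playing the part of the derivative of
  \<open>\<phi>\<close>. The value \<open>0\<close> for \<open>u \<le> 0\<close> (a subgradient at
  \<open>0\<close>, as \<open>\<phi>\<close> is nonnegative) makes it nonnegative and monotone on
  the whole line, hence Borel.\<close>

definition slope :: "real \<Rightarrow> real" where
  "slope u = (if u \<le> 0 then 0 else (SOME v. \<forall>w. \<phi> u + v * (w - u) \<le> \<phi> w))"

lemma slope: "0 \<le> u \<Longrightarrow> \<phi> u + slope u * (w - u) \<le> \<phi> w"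
  using someI_ex[OF subgradient_exists[of u]] by (auto simp: slope_def)

lemma slope_ge: "\<phi> u \<le> u * slope u" if "0 \<le> u"
  using slope[OF that, of 0] by (simp add: algebra_simps)

lemma slope_pos: "0 < u \<Longrightarrow> 0 < slope u"
  using slope_ge[of u] pos[of u] zero_less_mult_pos[of u "slope u"] by linarith

lemma slope_nonneg [simp]: "0 \<le> slope u"
  using slope_pos[of u] by (cases "u > 0") (auto simp: slope_def)

text \<open>Adding the subgradient inequalities at \<open>u\<close> and at \<open>v\<close> cancels
  the values of \<open>\<phi>\<close>.\<close>

lemma slope_mono: "u \<le> v \<Longrightarrow> slope u \<le> slope v"
proof -
  assume uv: "u \<le> v"
  show ?thesis
  proof (cases "0 < u \<and> u < v")
    case True
    then have "\<phi> u + slope u * (v - u) \<le> \<phi> v" "\<phi> v + slope v * (u - v) \<le> \<phi> u"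
      by (auto intro!: slope)
    then have "slope u * (v - u) \<le> slope v * (v - u)" by (simp add: algebra_simps)
    then show ?thesis using True by simp
  next
    case False
    then show ?thesis using uv by (cases "u = v") (auto simp: slope_def[of u])
  qed
qed

lemma slope_measurable [measurable]: "slope \<in> borel_measurable borel"
  by (rule borel_measurable_mono) (simp add: mono_def slope_mono)

lemma mult_slope_le: "0 \<le> u \<Longrightarrow> u * slope u \<le> \<phi> (2 * u)"
  using slope[of u "2 * u"] nonneg[of u] by (simp add: mult.commute) (smt (verit) nonneg)

lemma complementary_slope: "0 \<le> u \<Longrightarrow> \<psi> (slope u) \<le> u * slope u"
proof (rule complementary_leI)
  fix w assume "0 \<le> u" "0 < (w::real)"
  then show "\<bar>w * slope u\<bar> - \<phi> w \<le> u * slope u"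
    using slope[of u w] nonneg[of u] by (simp add: algebra_simps) (smt (verit) nonneg)
qed

text \<open>Bounds \<open>\<psi> z\<close> although \<open>z\<close> need not be a subgradient of \<open>\<phi>\<close>: it only lies
  between the subgradients at \<open>k f\<close> and at \<open>l f\<close>.\<close>

lemma young_reverse:
  assumes f: "0 \<le> f" and kl: "0 < k" "k < l"
    and z: "slope (k * f) \<le> z" "z \<le> slope (l * f)"
  shows "\<phi> (k * f) / k + \<psi> z / l \<le> f * z"
proof -
  have z0: "0 \<le> z" using z(1) slope_nonneg[of "k * f"] by linarith
  have kf: "\<phi> (k * f) / k \<le> f * z"
  proof -
    have "\<phi> (k * f) \<le> k * f * slope (k * f)" using f kl by (intro slope_ge) auto
    also have "\<dots> \<le> k * f * z" using f kl z by (intro mult_left_mono) auto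
    finally show ?thesis using kl by (simp add: field_simps)
  qed
  define q where "q = \<phi> (k * f) / k"
  have q: "\<phi> (k * f) = k * q" using kl by (simp add: q_def)
  have "\<psi> z \<le> l * (f * z - q)"
  proof (rule complementary_leI)
    fix w :: real assume w: "0 < w"
    have scale: "\<mu> * q \<le> \<phi> (\<mu> * f)" if "k \<le> \<mu>" for \<mu>
      using scale_ge[of "\<mu>/k" "k * f"] that kl by (simp add: q_def field_simps)
    \<comment> \<open>Outside the interval from \<open>k * f\<close> to \<open>l * f\<close> the
      tangent at the nearer end bounds \<open>\<phi> w\<close> from below, and \<open>z\<close> lies
      on the favourable side of its slope. Inside, \<open>w = \<mu> * f\<close> and the bound is
      \<open>\<mu> * (f * z - q) \<le> l * (f * z - q)\<close>, valid because \<open>kf\<close>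
      makes the bracket nonnegative.\<close>
    consider "l * f \<le> w" | "w \<le> k * f" | "k * f < w" "w < l * f" by linarith
    then have "w * z - \<phi> w \<le> l * (f * z - q)"
    proof cases
      case 1
      have "l * q \<le> \<phi> (l * f)" using scale[of l] kl by simp
      moreover have "\<phi> (l * f) + slope (l * f) * (w - l * f) \<le> \<phi> w" using f kl by (intro slope) auto
      moreover have "z * (w - l * f) \<le> slope (l * f) * (w - l * f)"
        using 1 z by (intro mult_right_mono) auto
      ultimately show ?thesis by (simp add: algebra_simps)
    next
      case 2
      have "\<phi> (k * f) + slope (k * f) * (w - k * f) \<le> \<phi> w" using f kl by (intro slope) auto
      moreover have "z * (w - k * f) \<le> slope (k * f) * (w - k * f)"
        using 2 z by (intro mult_right_mono_neg) auto
      moreover have "(l - k) * q \<le> (l - k) * (f * z)" using kl kf by (intro mult_left_mono) (auto simp: q_def)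
      ultimately show ?thesis using q by (simp add: algebra_simps)
    next
      case 3
      then have f0: "f > 0" using f kl by (cases "f = 0") auto
      define \<mu> where "\<mu> = w / f"
      have \<mu>: "k \<le> \<mu>" "\<mu> \<le> l" "w = \<mu> * f" using 3 f0 by (auto simp: \<mu>_def field_simps)
      have "(l - \<mu>) * q \<le> (l - \<mu>) * (f * z)" using \<mu> kf by (intro mult_left_mono) (auto simp: q_def)
      moreover have "\<mu> * q \<le> \<phi> w" using scale \<mu> by simp
      ultimately show ?thesis using \<mu> by (simp add: algebra_simps)
    qed
    then show "\<bar>w * z\<bar> - \<phi> w \<le> l * (f * z - q)" using w z0 by simp
  qed
  then show ?thesis using kl by (simp add: q_def field_simps)
qed

lemma young_equality: "0 \<le> u \<Longrightarrow> \<exists>v\<ge>0. \<phi> u + \<psi> v = u * v"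
proof -
  assume u: "0 \<le> u"
  have "\<psi> (slope u) \<le> u * slope u - \<phi> u"
  proof (rule complementary_leI)
    fix w :: real assume "0 < w"
    then show "\<bar>w * slope u\<bar> - \<phi> w \<le> u * slope u - \<phi> u"
      using slope[OF u, of w] by (simp add: algebra_simps)
  qed
  moreover have "u * slope u \<le> \<phi> u + \<psi> (slope u)" using u by (intro young) auto
  ultimately show ?thesis by (intro exI[of _ "slope u"]) auto
qed

section \<open>Dual form of the \<open>Delta2\<close> condition, and its failure\<close>

text \<open>Take \<open>v\<close> with equality in Young's inequality at \<open>2 * u / K\<close>,
  multiply by \<open>K\<close>, replace \<open>K * \<psi> v\<close> by the smaller
  \<open>\<psi> (2 * v)\<close>, and apply Young's inequality to \<open>u\<close> and
  \<open>2 * v\<close>.\<close>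

lemma nabla2:
  assumes "Delta2 \<psi>"
  obtains c where "1 < c" "\<And>u. 2 * c * \<phi> (u / c) \<le> \<phi> u"
proof -
  obtain K0 where K0: "\<And>u. \<psi> (2 * u) \<le> K0 * \<psi> u" using assms by (auto simp: Delta2_def)
  \<comment> \<open>The constant \<open>c\<close> will be \<open>K / 2\<close>; enlarging
    \<open>K\<close> to at least \<open>3\<close> guarantees \<open>1 < c\<close>.\<close>
  define K where "K = max K0 3"
  have K: "\<psi> (2 * u) \<le> K * \<psi> u" for u
    using K0[of u] mult_right_mono[of K0 K "\<psi> u"] by (simp add: K_def)
  have K3: "K \<ge> 3" by (simp add: K_def)
  have *: "K * \<phi> (2 * u / K) \<le> \<phi> u" if u: "0 \<le> u" for u
  proof -
    obtain v where v: "v \<ge> 0" "\<phi> (2 * u / K) + \<psi> v = (2 * u / K) * v"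
      using young_equality[of "2 * u / K"] u K3 by auto
    have "K * (\<phi> (2 * u / K) + \<psi> v) = u * (2 * v)" unfolding v(2) using K3 by simp
    then have "K * \<phi> (2 * u / K) = u * (2 * v) - K * \<psi> v" by (simp add: algebra_simps)
    also have "\<dots> \<le> u * (2 * v) - \<psi> (2 * v)" using K by simp
    also have "\<dots> \<le> \<phi> u" using young[of u "2 * v"] u v by simp
    finally show ?thesis .
  qed
  have **: "K * \<phi> (2 * u / K) \<le> \<phi> u" for u
    using *[of "\<bar>u\<bar>"] abs_arg[of "2 * u / K"] K3 by (simp add: abs_mult)
  show ?thesis
    by (rule that[of "K / 2"]) (use K3 ** in \<open>auto simp: field_simps\<close>)
qed

text \<open>The dual condition says that at \<open>u / c\<close> the function is at most half of its
  chord from \<open>0\<close> to \<open>u\<close>. Convexity spreads this gain over the whole chord;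
  it must vanish at both ends, whence the factor \<open>a * (1 - a)\<close>. The two entries of
  \<open>\<kappa>\<close> are the constants obtained on either side of \<open>1 / c\<close>.\<close>

lemma convexity_gap:
  assumes c: "1 < c" "\<And>u. 2 * c * \<phi> (u / c) \<le> \<phi> u"
  defines "\<kappa> \<equiv> min (1/2) (1 / (2 * (c - 1)))"
  assumes a: "0 \<le> a" "a \<le> 1"
  shows "\<phi> (a * u) + \<kappa> * (a * (1 - a)) * \<phi> u \<le> a * \<phi> u"
proof (cases "a \<le> 1 / c")
  case True
  have "\<phi> (a * u) = \<phi> ((a * c) * (u / c))" using c by simp
  also have "\<dots> \<le> (a * c) * \<phi> (u / c)" using a c True by (intro scale_le) (auto simp: field_simps)
  also have "\<dots> \<le> a / 2 * \<phi> u" using mult_left_mono[OF c(2)[of u], of "a/2"] a by simp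
  finally have 1: "\<phi> (a * u) \<le> a / 2 * \<phi> u" .
  have "\<kappa> * (a * (1 - a)) \<le> 1/2 * (a * (1 - a))"
    using a by (intro mult_right_mono) (auto simp: \<kappa>_def)
  also have "\<dots> \<le> 1/2 * a" using a by (simp add: mult_left_le)
  finally have "\<kappa> * (a * (1 - a)) * \<phi> u \<le> a / 2 * \<phi> u" by (intro mult_right_mono) auto
  then show ?thesis using 1 by linarith
next
  case False
  \<comment> \<open>Chosen so that \<open>a = s + (1 - s) / c\<close>: the point
    \<open>a * u\<close> divides the segment from \<open>u / c\<close> to \<open>u\<close>, and the
    gain at \<open>u / c\<close> enters with weight \<open>1 - s\<close>.\<close>
  define s where "s = 1 - (1 - a) * c / (c - 1)"
  have ac: "1 < a * c" using False c by (simp add: field_simps)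
  have s1: "1 - s = (1 - a) * c / (c - 1)" by (simp add: s_def)
  have s: "0 \<le> s" "s \<le> 1"
    using a c ac by (auto simp: s_def field_simps)
  have "(1 - s) * (c - 1) = (1 - a) * c" using c by (simp add: s1)
  then have as: "a = s + (1 - s) / c" using c by (simp add: divide_simps) (simp add: algebra_simps)
  have "\<phi> (a * u) = \<phi> ((1 - (1 - s)) *\<^sub>R u + (1 - s) *\<^sub>R (u / c))" by (subst as) (simp add: algebra_simps)
  also have "\<dots> \<le> (1 - (1 - s)) * \<phi> u + (1 - s) * \<phi> (u / c)"
    using s by (intro convex_onD[OF convex]) auto
  also have "\<phi> (u / c) \<le> \<phi> u / (2 * c)" using c by (simp add: field_simps)
  finally have "\<phi> (a * u) \<le> s * \<phi> u + (1 - s) * (\<phi> u / (2 * c))"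
    using s by (simp add: mult_left_mono)
  also have "\<dots> = (a - (1 - s) / (2 * c)) * \<phi> u" by (subst as) (use c in \<open>simp add: field_simps\<close>)
  also have "(1 - s) / (2 * c) = (1 - a) / (2 * (c - 1))" unfolding s1 using c by (simp add: field_simps)
  finally have 1: "\<phi> (a * u) \<le> a * \<phi> u - (1 - a) / (2 * (c - 1)) * \<phi> u" by (simp add: algebra_simps)
  have "\<kappa> * (a * (1 - a)) \<le> 1 / (2 * (c - 1)) * (a * (1 - a))"
    using a by (intro mult_right_mono) (auto simp: \<kappa>_def)
  also have "\<dots> \<le> 1 / (2 * (c - 1)) * (1 - a)"
    using a c by (intro mult_left_mono) (auto simp: mult_left_le_one_le)
  finally have "\<kappa> * (a * (1 - a)) * \<phi> u \<le> (1 - a) / (2 * (c - 1)) * \<phi> u"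
    by (intro mult_right_mono) auto
  then show ?thesis using 1 by linarith
qed

text \<open>A growth bound for one dilation \<open>l > 1\<close>, iterated until
  \<open>l ^ n > 2\<close>, would give \<open>Delta2\<close>. Hence failure is visible for dilations
  arbitrarily close to \<open>1\<close>, as almost isometric estimates require.\<close>

lemma not_Delta2:
  assumes "\<not> Delta2 \<psi>" and l: "1 < l"
  shows "\<exists>v>0. K * \<psi> v < \<psi> (l * v)"
proof (rule ccontr)
  assume "\<not> ?thesis"
  then have *: "\<psi> (l * v) \<le> K * \<psi> v" if "v > 0" for v using that by force
  define K' where "K' = max K 1"
  have K': "\<psi> (l * v) \<le> K' * \<psi> v" if "v \<ge> 0" for v
    using *[of v] that mult_right_mono[of K K' "\<psi> v"]
    by (cases "v = 0") (auto simp: K'_def)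
  have pow: "\<psi> (l ^ n * v) \<le> K' ^ n * \<psi> v" if "v \<ge> 0" for v n
  proof (induction n)
    case (Suc n)
    have "\<psi> (l ^ Suc n * v) \<le> K' * \<psi> (l ^ n * v)"
      using K'[of "l ^ n * v"] that l by (simp add: mult.assoc)
    also have "\<dots> \<le> K' * (K' ^ n * \<psi> v)" using Suc by (intro mult_left_mono) (auto simp: K'_def)
    finally show ?case by (simp add: mult.assoc)
  qed simp
  obtain n where n: "2 < l ^ n" using real_arch_pow[OF l] by blast
  have "\<psi> (2 * v) \<le> K' ^ n * \<psi> v" for v
  proof -
    have "\<psi> (2 * v) = \<psi> (2 * \<bar>v\<bar>)" using complementary_abs[of "2 * v"] by (simp add: abs_mult)
    also have "\<dots> \<le> \<psi> (l ^ n * \<bar>v\<bar>)" using n by (intro complementary_mono mult_right_mono) auto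
    also have "\<dots> \<le> K' ^ n * \<psi> v" using pow[of "\<bar>v\<bar>" n] by simp
    finally show ?thesis .
  qed
  moreover have "0 < K' ^ n" by (simp add: K'_def)
  ultimately show False using assms(1) unfolding Delta2_def by blast
qed

end

subsection \<open>Distribution functions and rearrangements\<close>

abbreviation half_line :: "real measure" where "half_line \<equiv> lebesgue_on {0..}"

lemma distribution_function_eq:
  "distribution_function x \<theta> = emeasure half_line {s \<in> space half_line. \<theta> < \<bar>x s\<bar>}"
  unfolding distribution_function_def by (subst emeasure_restrict_space) auto

lemma superlevel_measurable:
  fixes x :: "real \<Rightarrow> real"
  shows "x \<in> borel_measurable half_line \<Longrightarrow> {s \<in> {0..}. \<theta> < \<bar>x s\<bar>} \<in> sets lebesgue"
proof -
  assume x [measurable]: "x \<in> borel_measurable half_line"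
  have "{s \<in> space half_line. \<theta> < \<bar>x s\<bar>} \<in> sets half_line" by measurable
  then show ?thesis by (auto simp: sets_restrict_space_iff)
qed

lemma distribution_function_antimono:
  assumes "x \<in> borel_measurable half_line" "\<theta> \<le> \<eta>"
  shows "distribution_function x \<eta> \<le> distribution_function x \<theta>"
  unfolding distribution_function_def
  using superlevel_measurable[OF assms(1)] assms(2) by (intro emeasure_mono) auto

lemma distribution_function_mono:
  assumes "x \<in> borel_measurable half_line" "\<And>s. s \<ge> 0 \<Longrightarrow> \<bar>y s\<bar> \<le> \<bar>x s\<bar>"
  shows "distribution_function y \<theta> \<le> distribution_function x \<theta>"
  unfolding distribution_function_def
  using superlevel_measurable[OF assms(1)] assms(2)
  by (intro emeasure_mono) (auto intro: less_le_trans)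

lemma distribution_function_cong:
  "(\<And>s. s \<ge> 0 \<Longrightarrow> \<theta> < \<bar>x s\<bar> \<longleftrightarrow> \<eta> < \<bar>y s\<bar>) \<Longrightarrow>
    distribution_function x \<theta> = distribution_function y \<eta>"
  unfolding distribution_function_def by (intro arg_cong[where f="emeasure lebesgue"]) auto

text \<open>The sets \<open>\<bar>x s\<bar> > \<alpha> + 1 / Suc n\<close> increase to
  \<open>\<bar>x s\<bar> > \<alpha>\<close>, so continuity of measure from below applies even when
  the measures are infinite.\<close>

lemma distribution_function_right_continuous:
  assumes x: "x \<in> borel_measurable half_line" and t: "t < distribution_function x \<alpha>"
  shows "\<exists>\<beta>>\<alpha>. t < distribution_function x \<beta>"
proof -
  let ?A = "\<lambda>n::nat. {s \<in> {0..}. \<alpha> + 1 / Suc n < \<bar>x s\<bar>}"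
  have "(\<Union>n. ?A n) = {s \<in> {0..}. \<alpha> < \<bar>x s\<bar>}"
  proof safe
    fix s :: real and n assume "\<alpha> + 1 / Suc n < \<bar>x s\<bar>"
    moreover have "0 < 1 / real (Suc n)" by simp
    ultimately show "\<alpha> < \<bar>x s\<bar>" by linarith
  next
    fix s :: real assume s: "s \<ge> 0" "\<alpha> < \<bar>x s\<bar>"
    obtain n where "1 / Suc n < \<bar>x s\<bar> - \<alpha>"
      using reals_Archimedean[of "\<bar>x s\<bar> - \<alpha>"] s by (auto simp: inverse_eq_divide)
    then show "s \<in> (\<Union>n. ?A n)" using s by (intro UN_I[of n]) auto
  qed
  moreover have "(SUP n. emeasure lebesgue (?A n)) = emeasure lebesgue (\<Union>n. ?A n)"
  proof (rule SUP_emeasure_incseq)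
    show "range ?A \<subseteq> sets lebesgue" using superlevel_measurable[OF x] by auto
    show "incseq ?A"
    proof (rule incseq_SucI)
      fix n have "1 / real (Suc (Suc n)) \<le> 1 / real (Suc n)" by (simp add: field_simps)
      then show "?A n \<subseteq> ?A (Suc n)" by (auto intro: order.strict_trans1)
    qed
  qed
  ultimately have "t < (SUP n. emeasure lebesgue (?A n))"
    using t unfolding distribution_function_def by metis
  then obtain n where "t < distribution_function x (\<alpha> + 1 / Suc n)"
    unfolding less_SUP_iff distribution_function_def by blast
  moreover have "\<alpha> < \<alpha> + 1 / Suc n" by simp
  ultimately show ?thesis by blast
qed

text \<open>Rearrangement and distribution function are generalised inverses. The strict form is
  exact thanks to right continuity, and it is the route by which rearrangements are computed and
  shown measurable below.\<close>

lemma less_rearrangement_iff: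
  assumes x: "x \<in> borel_measurable half_line" and \<alpha>: "0 \<le> \<alpha>"
  shows "ennreal \<alpha> < rearrangement x t \<longleftrightarrow> ennreal t < distribution_function x \<alpha>"
proof
  assume "ennreal t < distribution_function x \<alpha>"
  then obtain \<beta> where \<beta>: "\<beta> > \<alpha>" "ennreal t < distribution_function x \<beta>"
    using distribution_function_right_continuous[OF x] by blast
  have "ennreal \<beta> \<le> rearrangement x t"
    unfolding rearrangement_def
  proof (rule INF_greatest, clarify)
    fix \<theta> assume \<theta>: "0 < \<theta>" "distribution_function x \<theta> \<le> ennreal t"
    then have "\<not> \<theta> \<le> \<beta>"
      using distribution_function_antimono[OF x, of \<theta> \<beta>] \<beta> by (meson leD order_trans)
    then show "ennreal \<beta> \<le> ennreal \<theta>" by (simp add: ennreal_leI)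
  qed
  moreover have "ennreal \<alpha> < ennreal \<beta>" using \<alpha> \<beta> by (simp add: ennreal_lessI)
  ultimately show "ennreal \<alpha> < rearrangement x t" by order
next
  assume less: "ennreal \<alpha> < rearrangement x t"
  show "ennreal t < distribution_function x \<alpha>"
  proof (rule ccontr)
    assume "\<not> ?thesis"
    then have d: "distribution_function x \<alpha> \<le> ennreal t" by simp
    \<comment> \<open>The infimum admits positive levels only, so \<open>\<alpha>\<close> itself may
      be inadmissible when it is \<open>0\<close>; \<open>\<alpha> + e\<close> always is
      admissible.\<close>
    have "rearrangement x t \<le> ennreal \<alpha> + ennreal e" if "0 < e" for e
    proof -
      have "rearrangement x t \<le> ennreal (\<alpha> + e)"
        unfolding rearrangement_def
        using d distribution_function_antimono[OF x, of \<alpha> "\<alpha> + e"] \<alpha> that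
        by (intro INF_lower) auto
      then show ?thesis using \<alpha> that by simp
    qed
    then have "rearrangement x t \<le> ennreal \<alpha>"
      by (rule ennreal_le_epsilon)
    then show False using less by simp
  qed
qed

lemma ennreal_eqI_less:
  assumes "\<And>\<alpha>. 0 \<le> \<alpha> \<Longrightarrow> ennreal \<alpha> < a \<longleftrightarrow> ennreal \<alpha> < b"
  shows "a = b"
proof (rule ccontr)
  assume "a \<noteq> b"
  then obtain c where "c < a \<and> \<not> c < b \<or> c < b \<and> \<not> c < a" using less_linear by blast
  then show False using assms[of "enn2real c"] by (cases c) auto
qed

lemma rearrangement_measurable:
  assumes x: "x \<in> borel_measurable half_line"
  shows "rearrangement x \<in> borel_measurable borel"
proof (rule borel_measurableI_greater)
  fix y show "{t \<in> space borel. y < rearrangement x t} \<in> sets borel"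
  proof (cases y)
    case (real r)
    have "{t \<in> space borel. ennreal t < distribution_function x r} \<in> sets borel" by measurable
    then show ?thesis using real less_rearrangement_iff[OF x, of r] by simp
  qed simp
qed

lemma rearrangement_antimono:
  "s \<le> t \<Longrightarrow> rearrangement x t \<le> rearrangement x s"
  unfolding rearrangement_def
  by (rule INF_superset_mono) (auto intro: order_trans ennreal_leI)

lemma rearrangement_cmult:
  assumes x: "x \<in> borel_measurable half_line" and k: "0 < k"
  shows "rearrangement (\<lambda>s. k * x s) t = ennreal k * rearrangement x t"
proof (rule ennreal_eqI_less)
  fix \<alpha> :: real assume \<alpha>: "0 \<le> \<alpha>"
  have kx: "(\<lambda>s. k * x s) \<in> borel_measurable half_line" using x by measurable
  have "ennreal \<alpha> < rearrangement (\<lambda>s. k * x s) t \<longleftrightarrow> ennreal t < distribution_function (\<lambda>s. k * x s) \<alpha>"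
    using less_rearrangement_iff[OF kx \<alpha>] .
  also have "distribution_function (\<lambda>s. k * x s) \<alpha> = distribution_function x (\<alpha> / k)"
    using k by (intro distribution_function_cong) (auto simp: field_simps abs_mult)
  also have "ennreal t < distribution_function x (\<alpha> / k) \<longleftrightarrow> ennreal (\<alpha> / k) < rearrangement x t"
    using less_rearrangement_iff[OF x, of "\<alpha> / k"] \<alpha> k by simp
  also have "\<dots> \<longleftrightarrow> ennreal \<alpha> < ennreal k * rearrangement x t"
  proof (cases "rearrangement x t")
    case (real r)
    then show ?thesis using k \<alpha> by (simp add: ennreal_mult[symmetric] ennreal_less_iff field_simps)
  next
    case top
    then show ?thesis using k by (simp add: ennreal_mult_top)
  qed
  finally show "ennreal \<alpha> < rearrangement (\<lambda>s. k * x s) t \<longleftrightarrow> ennreal \<alpha> < ennreal k * rearrangement x t" .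
qed

section \<open>Rearrangements of explicit functions\<close>

text \<open>Only the modulus of \<open>x\<close> matters, so one computation covers all choices of
  sign. An empty \<open>B\<close> gives single indicators, and \<open>d1 = top\<close> gives
  functions whose rearrangement is constant.\<close>

lemma rearrangement_two_levels:
  assumes x: "x \<in> borel_measurable half_line"
    and A: "A \<in> sets lebesgue" "A \<subseteq> {0..}" "emeasure lebesgue A = d1"
    and B: "B \<in> sets lebesgue" "B \<subseteq> {0..}" "emeasure lebesgue B = d2"
    and disj: "A \<inter> B = {}"
    and b: "0 \<le> b2" "b2 \<le> b1"
    and xs: "\<And>s. 0 \<le> s \<Longrightarrow> \<bar>x s\<bar> = (if s \<in> A then b1 else if s \<in> B then b2 else 0)"
  shows "rearrangement x t =
    ennreal (if ennreal t < d1 then b1 else if ennreal t < d1 + d2 then b2 else 0)"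
proof (rule ennreal_eqI_less)
  fix \<alpha> :: real assume \<alpha>: "0 \<le> \<alpha>"
  have "{s \<in> {0..}. \<alpha> < \<bar>x s\<bar>} = (if \<alpha> < b2 then A \<union> B else if \<alpha> < b1 then A else {})"
    using xs A B b \<alpha> by (auto split: if_splits)
  then have "distribution_function x \<alpha> = (if \<alpha> < b2 then d1 + d2 else if \<alpha> < b1 then d1 else 0)"
    using plus_emeasure[OF A(1) B(1) disj] A B by (simp add: distribution_function_def)
  moreover have "d1 \<le> d1 + d2" by simp
  ultimately show "ennreal \<alpha> < rearrangement x t \<longleftrightarrow>
      ennreal \<alpha> < ennreal (if ennreal t < d1 then b1 else if ennreal t < d1 + d2 then b2 else 0)"
    using less_rearrangement_iff[OF x \<alpha>, of t] \<alpha> b order.strict_trans2[of "ennreal t" d1 "d1 + d2"]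
    by (auto simp: ennreal_less_iff)
qed

lemma rearrangement_le_antimono:
  assumes g: "antimono_on {0<..} g" "\<And>s. 0 < s \<Longrightarrow> 0 \<le> g s" and t: "0 < t"
  shows "rearrangement g t \<le> ennreal (g t)"
proof -
  have "rearrangement g t \<le> ennreal (g t) + ennreal e" if e: "0 < e" for e
  proof -
    have "{s \<in> {0..}. g t + e < \<bar>g s\<bar>} \<subseteq> {0..t}"
    proof
      fix s assume "s \<in> {s \<in> {0..}. g t + e < \<bar>g s\<bar>}"
      then have s: "s \<in> {0..}" "g t + e < \<bar>g s\<bar>" by auto
      show "s \<in> {0..t}"
      proof (rule ccontr)
        assume "s \<notin> {0..t}"
        then have "t \<le> s" using s by auto
        then have "g s \<le> g t" using g(1) t by (auto simp: monotone_on_def)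
        then show False using s g(2)[of s] t e \<open>t \<le> s\<close> by simp
      qed
    qed
    then have "distribution_function g (g t + e) \<le> emeasure lebesgue {0..t}"
      unfolding distribution_function_def by (intro emeasure_mono) auto
    then have "rearrangement g t \<le> ennreal (g t + e)"
      unfolding rearrangement_def using e g(2)[OF t] t by (intro INF_lower) auto
    then show ?thesis using e g(2)[OF t] by simp
  qed
  then show ?thesis by (rule ennreal_le_epsilon)
qed

text \<open>The upper bound holds at every \<open>t > 0\<close>. The lower bound needs continuity at
  \<open>t\<close>, and a monotone function has only countably many discontinuities.\<close>

lemma AE_rearrangement_antimono:
  assumes g: "antimono_on {0<..} g" "\<And>s. 0 < s \<Longrightarrow> 0 \<le> g s" "g \<in> borel_measurable half_line"
  shows "AE t in lborel. 0 < t \<longrightarrow> rearrangement g t = ennreal (g t)"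
proof -
  let ?D = "{t \<in> {0<..}. \<not> continuous (at t within {0<..}) (\<lambda>t. - g t)}"
  have "countable ?D"
    using g(1) by (intro mono_on_ctble_discont) (auto simp: monotone_on_def)
  then have "AE t in lborel. t \<notin> ?D"
    by (intro AE_not_in) (simp add: countable_imp_null_set_lborel)
  then show ?thesis
  proof eventually_elim
    fix t assume D: "t \<notin> ?D"
    show "0 < t \<longrightarrow> rearrangement g t = ennreal (g t)"
    proof (intro impI antisym)
      assume t: "0 < t"
      show "rearrangement g t \<le> ennreal (g t)" by (rule rearrangement_le_antimono[OF g(1,2) t])
      have "continuous (at t within {0<..}) (\<lambda>t. - g t)" using D t by blast
      moreover have "at t within {0<..} = at t" using t by (intro at_within_open) auto
      ultimately have "isCont (\<lambda>t. - g t) t" by metis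
      then have cont: "isCont g t" using isCont_minus[of t "\<lambda>t. - g t"] by simp
      show "ennreal (g t) \<le> rearrangement g t"
      proof (rule dense_le)
        fix a assume a: "a < ennreal (g t)"
        then obtain \<alpha> where \<alpha>: "0 \<le> \<alpha>" "a = ennreal \<alpha>" "\<alpha> < g t"
          by (cases a) (auto simp: ennreal_less_iff)
        have "eventually (\<lambda>s. \<alpha> < g s) (at t)"
          using cont \<alpha> order_tendstoD(1)[of g "g t" "at t"] by (auto simp: isCont_def)
        then obtain d where d: "d > 0" "\<And>s. s \<noteq> t \<Longrightarrow> dist s t < d \<Longrightarrow> \<alpha> < g s"
          by (auto simp: eventually_at)
        \<comment> \<open>Monotonicity gives the level to the left of \<open>t\<close>, continuity a
          little to the right of it; so the superlevel set has measure strictly larger than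
          \<open>t\<close>.\<close>
        have "{0<..<t + d} \<subseteq> {s \<in> {0..}. \<alpha> < \<bar>g s\<bar>}"
        proof
          fix s assume s: "s \<in> {0<..<t + d}"
          have "\<alpha> < g s"
          proof (cases "s \<le> t")
            case True
            then have "g t \<le> g s" using g(1) s by (auto simp: monotone_on_def)
            then show ?thesis using \<alpha> by simp
          next
            case False
            then show ?thesis using s by (intro d(2)) (auto simp: dist_real_def)
          qed
          then show "s \<in> {s \<in> {0..}. \<alpha> < \<bar>g s\<bar>}" using s by auto
        qed
        then have "emeasure lebesgue {0<..<t + d} \<le> distribution_function g \<alpha>"
          unfolding distribution_function_def
          by (intro emeasure_mono superlevel_measurable g)
        moreover have "emeasure lebesgue {0<..<t + d} = ennreal (t + d)" using t d by simp
        moreover have "ennreal t < ennreal (t + d)" using t d by (intro ennreal_lessI) auto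
        ultimately have "ennreal t < distribution_function g \<alpha>" by order
        then show "a \<le> rearrangement g t"
          using less_rearrangement_iff[OF g(3) \<alpha>(1), of t] \<alpha> by simp
      qed
    qed
  qed
qed

section \<open>Measurability and measure tools for layer-cake arguments\<close>

lemma emeasure_initial_interval:
  "emeasure lborel {t. 0 < t \<and> ennreal t < e} = e" "emeasure lborel {t. 0 \<le> t \<and> ennreal t < e} = e"
proof -
  have *: "emeasure lborel {t::real. 0 < t \<and> ennreal t < e} = e"
  proof (cases e)
    case (real r)
    then have "{t. 0 < t \<and> ennreal t < e} = {0<..<r}" by (auto simp: ennreal_less_iff)
    then show ?thesis using real by simp
  next
    case top
    then have "{t. 0 < t \<and> ennreal t < e} = {0::real<..}" by auto
    moreover have "emeasure lborel {0::real<..} = top"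
    proof (rule ccontr)
      assume "emeasure lborel {0::real<..} \<noteq> top"
      then obtain r where r: "0 \<le> r" "emeasure lborel {0::real<..} = ennreal r"
        by (cases "emeasure lborel {0::real<..}") auto
      have "emeasure lborel {0<..<r + 1} \<le> emeasure lborel {0::real<..}" by (intro emeasure_mono) auto
      then show False using r by simp
    qed
    ultimately show ?thesis using top by simp
  qed
  then show "emeasure lborel {t::real. 0 < t \<and> ennreal t < e} = e" .
  have "emeasure lborel {t. 0 \<le> t \<and> ennreal t < e} = emeasure lborel {t. 0 < t \<and> ennreal t < e}"
    using AE_lborel_singleton[of "0::real"] by (intro emeasure_eq_AE) auto
  then show "emeasure lborel {t. 0 \<le> t \<and> ennreal t < e} = e" using * by simp
qed

lemma antimono_borel_measurable:
  fixes f :: "real \<Rightarrow> 'b::{linorder_topology, second_countable_topology}"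
  assumes "antimono f" shows "f \<in> borel_measurable borel"
proof (rule borel_measurableI_greater)
  fix y
  have "is_interval {t. y < f t}"
    using assms unfolding is_interval_1 antimono_def by (auto intro: less_le_trans)
  then show "{t \<in> space borel. y < f t} \<in> sets borel"
    using real_interval_borel_measurable by simp
qed

lemma distribution_function_measurable:
  "x \<in> borel_measurable half_line \<Longrightarrow> distribution_function x \<in> borel_measurable borel"
  by (intro antimono_borel_measurable antimonoI distribution_function_antimono)

lemma sigma_finite_half_line: "sigma_finite_measure half_line"
proof (rule sigma_finite_measure_restrict_space)
  show "sigma_finite_measure (lebesgue :: real measure)"
  proof
    obtain A :: "real set set" where "countable A" "A \<subseteq> sets lborel" "\<Union>A = space lborel"
        "\<forall>a\<in>A. emeasure lborel a \<noteq> \<infinity>"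
      using lborel.sigma_finite_countable by blast
    then show "\<exists>A. countable A \<and> A \<subseteq> sets lebesgue \<and> \<Union>A = space (lebesgue :: real measure) \<and>
        (\<forall>a\<in>A. emeasure lebesgue a \<noteq> \<infinity>)"
      by (intro exI[of _ A]) auto
  qed
qed simp

lemma emeasure_Int_nested:
  assumes "A \<subseteq> B \<or> B \<subseteq> A" "A \<in> sets M" "B \<in> sets M"
  shows "emeasure M (A \<inter> B) = min (emeasure M A) (emeasure M B)"
  using assms emeasure_mono[of A B M] emeasure_mono[of B A M]
  by (auto simp: Int_absorb1 Int_absorb2 min_def intro: antisym)

subsection \<open>The Lorentz functional\<close>

lemma sum_excess_le:
  fixes a b c d :: real
  shows "ennreal (\<bar>a + b\<bar> - (c + d)) \<le> ennreal (\<bar>a\<bar> - c) + ennreal (\<bar>b\<bar> - d)"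
proof -
  have "ennreal (\<bar>a + b\<bar> - (c + d)) \<le> ennreal (max 0 (\<bar>a\<bar> - c) + max 0 (\<bar>b\<bar> - d))"
    by (intro ennreal_leI) auto
  also have "\<dots> = ennreal (max 0 (\<bar>a\<bar> - c)) + ennreal (max 0 (\<bar>b\<bar> - d))"
    by (intro ennreal_plus) auto
  finally show ?thesis by (simp add: ennreal_max_0)
qed

text \<open>This is the integral of the rearrangement of \<open>u\<close> over the interval from
  \<open>0\<close> to \<open>\<tau>\<close>, written by layers so that \<open>\<tau>\<close> and the
  distribution function may be infinite.\<close>

definition truncated_integral :: "ennreal \<Rightarrow> (real \<Rightarrow> real) \<Rightarrow> ennreal" where
  "truncated_integral \<tau> u = (\<integral>\<^sup>+\<theta>\<in>{0..}. min (distribution_function u \<theta>) \<tau> \<partial>lborel)"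

text \<open>Tonelli for the region between height \<open>c\<close> and the graph of
  \<open>\<bar>u\<bar>\<close>. On the right \<open>ennreal\<close> cuts off negative values, so the
  integrand is the positive part.\<close>

lemma integral_distribution_function:
  assumes u: "u \<in> borel_measurable half_line"
  shows "(\<integral>\<^sup>+\<theta>\<in>{c..}. distribution_function u \<theta> \<partial>lborel) = (\<integral>\<^sup>+s. ennreal (\<bar>u s\<bar> - c) \<partial>half_line)"
proof -
  interpret sigma_finite_measure half_line by (rule sigma_finite_half_line)
  interpret pair_sigma_finite half_line lborel ..
  note u [measurable]
  let ?f = "\<lambda>s \<theta>. indicator {p. c \<le> snd p \<and> snd p < \<bar>u (fst p)\<bar>} (s, \<theta>) :: ennreal"
  have f: "case_prod ?f \<in> borel_measurable (half_line \<Otimes>\<^sub>M lborel)" by measurable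
  have "(\<integral>\<^sup>+\<theta>\<in>{c..}. distribution_function u \<theta> \<partial>lborel) = (\<integral>\<^sup>+\<theta>. (\<integral>\<^sup>+s. ?f s \<theta> \<partial>half_line) \<partial>lborel)"
  proof (intro nn_integral_cong)
    fix \<theta> :: real
    have "distribution_function u \<theta> * indicator {c..} \<theta>
        = (\<integral>\<^sup>+s. indicator {s \<in> space half_line. \<theta> < \<bar>u s\<bar>} s \<partial>half_line) * indicator {c..} \<theta>"
      unfolding distribution_function_eq by (subst nn_integral_indicator) measurable
    also have "\<dots> = (\<integral>\<^sup>+s. indicator {s \<in> space half_line. \<theta> < \<bar>u s\<bar>} s * indicator {c..} \<theta> \<partial>half_line)"
      by (intro nn_integral_multc[symmetric]) measurable
    also have "\<dots> = (\<integral>\<^sup>+s. ?f s \<theta> \<partial>half_line)"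
      by (intro nn_integral_cong) (auto split: split_indicator)
    finally show "distribution_function u \<theta> * indicator {c..} \<theta> = (\<integral>\<^sup>+s. ?f s \<theta> \<partial>half_line)" .
  qed
  also have "\<dots> = (\<integral>\<^sup>+s. (\<integral>\<^sup>+\<theta>. ?f s \<theta> \<partial>lborel) \<partial>half_line)" by (rule Fubini'[OF f])
  also have "\<dots> = (\<integral>\<^sup>+s. ennreal (\<bar>u s\<bar> - c) \<partial>half_line)"
  proof (intro nn_integral_cong)
    fix s
    have "(\<integral>\<^sup>+\<theta>. ?f s \<theta> \<partial>lborel) = (\<integral>\<^sup>+\<theta>. indicator {c..<\<bar>u s\<bar>} \<theta> \<partial>lborel)"
      by (intro nn_integral_cong) (auto split: split_indicator)
    also have "\<dots> = ennreal (\<bar>u s\<bar> - c)"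
      by (cases "c \<le> \<bar>u s\<bar>") (auto simp: ennreal_neg)
    finally show "(\<integral>\<^sup>+\<theta>. ?f s \<theta> \<partial>lborel) = ennreal (\<bar>u s\<bar> - c)" .
  qed
  finally show ?thesis .
qed

text \<open>\<open>truncated_integral \<tau> u\<close> is the \<open>K\<close>-functional of the couple \<open>(L\<^sup>1, L\<^sup>\<infinity>)\<close>,
  which explains its subadditivity.\<close>

lemma truncated_integral_le:
  assumes u: "u \<in> borel_measurable half_line" and c: "0 \<le> c"
  shows "truncated_integral \<tau> u \<le> ennreal c * \<tau> + (\<integral>\<^sup>+s. ennreal (\<bar>u s\<bar> - c) \<partial>half_line)"
proof -
  note [measurable] = distribution_function_measurable[OF u]
  have "truncated_integral \<tau> u \<le>
      (\<integral>\<^sup>+\<theta>. \<tau> * indicator {0..<c} \<theta> + distribution_function u \<theta> * indicator {c..} \<theta> \<partial>lborel)"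
    unfolding truncated_integral_def
    by (intro nn_integral_mono) (use c in \<open>auto split: split_indicator\<close>)
  also have "\<dots> = (\<integral>\<^sup>+\<theta>. \<tau> * indicator {0..<c} \<theta> \<partial>lborel) + (\<integral>\<^sup>+\<theta>\<in>{c..}. distribution_function u \<theta> \<partial>lborel)"
    by (intro nn_integral_add) auto
  also have "(\<integral>\<^sup>+\<theta>. \<tau> * indicator {0..<c} \<theta> \<partial>lborel) = ennreal c * \<tau>"
    using c by (simp add: nn_integral_cmult mult.commute)
  finally show ?thesis unfolding integral_distribution_function[OF u] .
qed

text \<open>The optimal \<open>c\<close> is the infimum of the levels at which the distribution
  function is at most \<open>\<tau>\<close>: below it the minimum is \<open>\<tau>\<close>, above it
  the distribution function. Such levels exist, since otherwise the integrand would be the positive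
  constant \<open>\<tau>\<close> on a half-line.\<close>

lemma truncated_integral_attained:
  assumes u: "u \<in> borel_measurable half_line" and fin: "truncated_integral \<tau> u < top" and \<tau>: "0 < \<tau>"
  shows "\<exists>c\<ge>0. truncated_integral \<tau> u = ennreal c * \<tau> + (\<integral>\<^sup>+s. ennreal (\<bar>u s\<bar> - c) \<partial>half_line)"
proof -
  note [measurable] = distribution_function_measurable[OF u]
  define S where "S = {\<theta>. 0 \<le> \<theta> \<and> distribution_function u \<theta> \<le> \<tau>}"
  have "S \<noteq> {}"
  proof
    assume "S = {}"
    then have "min (distribution_function u \<theta>) \<tau> = \<tau>" if "0 \<le> \<theta>" for \<theta>
      using that by (force simp: S_def min_def)
    then have "truncated_integral \<tau> u = (\<integral>\<^sup>+\<theta>. \<tau> * indicator {0::real..} \<theta> \<partial>lborel)"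
      unfolding truncated_integral_def
      by (intro nn_integral_cong) (auto split: split_indicator)
    also have "\<dots> = \<tau> * emeasure lborel {0::real..}" by (simp add: nn_integral_cmult)
    also have "emeasure lborel {0::real..} = top"
      using emeasure_initial_interval(2)[of top] by (simp add: atLeast_def)
    finally show False using fin \<tau> by (auto simp: ennreal_mult_eq_top_iff ennreal_mult_top split: if_splits)
  qed
  moreover have bdd: "bdd_below S" unfolding S_def by (rule bdd_belowI[of _ 0]) auto
  ultimately have c0: "0 \<le> Inf S" by (intro cInf_greatest) (auto simp: S_def)
  define c where "c = Inf S"
  have below: "min (distribution_function u \<theta>) \<tau> = \<tau>" if "0 \<le> \<theta>" "\<theta> < c" for \<theta>
  proof -
    have "\<theta> \<notin> S" using cInf_lower[OF _ bdd, of \<theta>] that by (auto simp: c_def)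
    then show ?thesis using that by (auto simp: S_def min_def)
  qed
  have above: "min (distribution_function u \<theta>) \<tau> = distribution_function u \<theta>" if "c < \<theta>" for \<theta>
  proof -
    obtain \<eta> where "\<eta> \<in> S" "\<eta> < \<theta>"
      using cInf_lessD[OF \<open>S \<noteq> {}\<close>, of \<theta>] \<open>c < \<theta>\<close> unfolding c_def by blast
    then have "distribution_function u \<theta> \<le> \<tau>"
      using distribution_function_antimono[OF u, of \<eta> \<theta>] by (auto simp: S_def)
    then show ?thesis by (simp add: min_def)
  qed
  have "truncated_integral \<tau> u =
      (\<integral>\<^sup>+\<theta>. \<tau> * indicator {0..<c} \<theta> + distribution_function u \<theta> * indicator {c..} \<theta> \<partial>lborel)"
    unfolding truncated_integral_def
  proof (intro nn_integral_cong_AE)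
    show "AE \<theta> in lborel. min (distribution_function u \<theta>) \<tau> * indicator {0..} \<theta> =
        \<tau> * indicator {0..<c} \<theta> + distribution_function u \<theta> * indicator {c..} \<theta>"
      using AE_lborel_singleton[of c]
    proof eventually_elim
      case (elim \<theta>)
      show ?case
      proof (cases "\<theta> < c")
        case True
        then show ?thesis using below[of \<theta>] by (auto split: split_indicator)
      next
        case False
        then show ?thesis using above[of \<theta>] elim c0 by (auto split: split_indicator simp: c_def)
      qed
    qed
  qed
  also have "\<dots> = (\<integral>\<^sup>+\<theta>. \<tau> * indicator {0..<c} \<theta> \<partial>lborel) + (\<integral>\<^sup>+\<theta>\<in>{c..}. distribution_function u \<theta> \<partial>lborel)"
    by (intro nn_integral_add) auto
  also have "(\<integral>\<^sup>+\<theta>. \<tau> * indicator {0..<c} \<theta> \<partial>lborel) = ennreal c * \<tau>"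
    using c0 by (simp add: nn_integral_cmult mult.commute c_def)
  finally show ?thesis unfolding integral_distribution_function[OF u]
    using c0 by (intro exI[of _ c]) (auto simp: c_def)
qed

text \<open>If \<open>c\<close> is optimal for \<open>u\<close> and \<open>d\<close> for
  \<open>v\<close>, then \<open>c + d\<close> is an admissible cut for the sum, and the excess over
  the cuts is subadditive pointwise.\<close>

lemma truncated_integral_add_le:
  assumes u: "u \<in> borel_measurable half_line" and v: "v \<in> borel_measurable half_line"
  shows "truncated_integral \<tau> (\<lambda>s. u s + v s) \<le> truncated_integral \<tau> u + truncated_integral \<tau> v"
proof -
  note [measurable] = u v
  consider "\<tau> = 0" | "truncated_integral \<tau> u = top \<or> truncated_integral \<tau> v = top"
    | "0 < \<tau>" "truncated_integral \<tau> u < top" "truncated_integral \<tau> v < top"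
    unfolding less_top[symmetric] zero_less_iff_neq_zero by blast
  then show ?thesis
  proof cases
    case 1
    then have "min a \<tau> = 0" for a :: ennreal by (simp add: min_def)
    then show ?thesis by (simp add: truncated_integral_def)
  next
    case 2
    then show ?thesis by auto
  next
    case 3
    obtain c where c: "c \<ge> 0" "truncated_integral \<tau> u = ennreal c * \<tau> + (\<integral>\<^sup>+s. ennreal (\<bar>u s\<bar> - c) \<partial>half_line)"
      using truncated_integral_attained[OF u 3(2,1)] by blast
    obtain d where d: "d \<ge> 0" "truncated_integral \<tau> v = ennreal d * \<tau> + (\<integral>\<^sup>+s. ennreal (\<bar>v s\<bar> - d) \<partial>half_line)"
      using truncated_integral_attained[OF v 3(3,1)] by blast
    have "truncated_integral \<tau> (\<lambda>s. u s + v s) \<le>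
        ennreal (c + d) * \<tau> + (\<integral>\<^sup>+s. ennreal (\<bar>u s + v s\<bar> - (c + d)) \<partial>half_line)"
      using c d by (intro truncated_integral_le) auto
    also have "(\<integral>\<^sup>+s. ennreal (\<bar>u s + v s\<bar> - (c + d)) \<partial>half_line) \<le>
        (\<integral>\<^sup>+s. ennreal (\<bar>u s\<bar> - c) + ennreal (\<bar>v s\<bar> - d) \<partial>half_line)"
      by (intro nn_integral_mono sum_excess_le)
    also have "\<dots> = (\<integral>\<^sup>+s. ennreal (\<bar>u s\<bar> - c) \<partial>half_line) + (\<integral>\<^sup>+s. ennreal (\<bar>v s\<bar> - d) \<partial>half_line)"
      by (intro nn_integral_add) auto
    finally show ?thesis
      using c d by (simp add: distrib_left distrib_right ac_simps add_left_mono)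
  qed
qed

section \<open>The weight, its primitive and the functional it defines\<close>

locale weight =
  fixes \<omega> :: "real \<Rightarrow> real"
  assumes weight: "weight_function \<omega>"
begin

lemma weight_nonneg: "0 \<le> t \<Longrightarrow> 0 \<le> \<omega> t"
  using weight by (auto simp: weight_function_def)

lemma weight_antimono: "0 < s \<Longrightarrow> s \<le> t \<Longrightarrow> \<omega> t \<le> \<omega> s"
  using weight by (auto simp: weight_function_def monotone_on_def)

lemma weight_measurable [measurable]: "(\<lambda>t. indicator {0<..} t * ennreal (\<omega> t)) \<in> borel_measurable borel"
proof -
  have "(\<lambda>t. - \<omega> t) \<in> borel_measurable (restrict_space borel {0<..})"
    using weight by (intro borel_measurable_mono_on_fnc) (auto simp: weight_function_def monotone_on_def)
  then have "(\<lambda>t. - (- \<omega> t)) \<in> borel_measurable (restrict_space borel {0<..})" by (rule borel_measurable_uminus)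
  then have "(\<lambda>t. ennreal (\<omega> t)) \<in> borel_measurable (restrict_space borel {0<..})" by simp
  then show ?thesis by (subst (asm) borel_measurable_restrict_space_iff_ennreal) (auto simp: mult.commute)
qed

text \<open>The indicator confines the density to the open half-line, the only place where
  monotonicity, and with it Borel measurability of the weight, is available.\<close>

definition weight_measure :: "real measure" where
  "weight_measure = density lborel (\<lambda>t. indicator {0<..} t * ennreal (\<omega> t))"

lemma sets_weight_measure [simp, measurable_cong]: "sets weight_measure = sets borel"
  by (simp add: weight_measure_def)

lemma space_weight_measure [simp]: "space weight_measure = UNIV"
  by (simp add: weight_measure_def)

lemma nn_integral_weight_measure:
  "F \<in> borel_measurable borel \<Longrightarrow>
    (\<integral>\<^sup>+t. F t \<partial>weight_measure) = (\<integral>\<^sup>+t. indicator {0<..} t * ennreal (\<omega> t) * F t \<partial>lborel)"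
  unfolding weight_measure_def by (rule nn_integral_density) auto

lemma nn_integral_weight:
  assumes F: "F \<in> borel_measurable borel"
  shows "(\<integral>\<^sup>+t\<in>{0..}. (F t * ennreal (\<omega> t)) \<partial>lebesgue) = (\<integral>\<^sup>+t. F t \<partial>weight_measure)"
  unfolding nn_integral_weight_measure[OF F] nn_integral_completion
  using AE_lborel_singleton[of "0::real"]
  by (intro nn_integral_cong_AE) (auto elim!: eventually_mono split: split_indicator simp: mult.commute)

lemma AE_weight_measureI:
  assumes "AE t in lborel. 0 < t \<longrightarrow> P t" shows "AE t in weight_measure. P t"
  unfolding weight_measure_def
  by (subst AE_density) (use assms in \<open>auto elim!: eventually_mono split: split_indicator_asm\<close>)

lemma AE_weight_measure_pos: "AE t in weight_measure. 0 < t"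
  by (rule AE_weight_measureI) auto

lemma sigma_finite_weight_measure: "sigma_finite_measure weight_measure"
  unfolding weight_measure_def
  by (subst sigma_finite_measure.sigma_finite_iff_density_finite[OF sigma_finite_lborel]) (auto split: split_indicator)

text \<open>The primitive of \<open>\<omega>\<close>, with arguments in \<open>ennreal\<close> so
  that it can be composed with distribution functions; at \<open>top\<close> it is the total
  weight.\<close>

definition cumulative :: "ennreal \<Rightarrow> ennreal" where
  "cumulative d = emeasure weight_measure {t. 0 < t \<and> ennreal t < d}"

lemma cumulative_mono: "d \<le> e \<Longrightarrow> cumulative d \<le> cumulative e"
  unfolding cumulative_def by (intro emeasure_mono) auto

lemma cumulative_0 [simp]: "cumulative 0 = 0"
  by (simp add: cumulative_def)

lemma cumulative_top: "cumulative top = (\<integral>\<^sup>+t\<in>{0..}. ennreal (\<omega> t) \<partial>lebesgue)"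
proof -
  have "cumulative top = emeasure weight_measure UNIV"
    unfolding cumulative_def using AE_weight_measure_pos by (intro emeasure_eq_AE) auto
  also have "\<dots> = (\<integral>\<^sup>+t. 1 \<partial>weight_measure)" by simp
  also have "\<dots> = (\<integral>\<^sup>+t\<in>{0..}. (1 * ennreal (\<omega> t)) \<partial>lebesgue)" by (rule nn_integral_weight[symmetric]) simp
  finally show ?thesis by simp
qed

lemma cumulative_finite: "d < top \<Longrightarrow> cumulative d < top"
proof -
  assume "d < top"
  then obtain a where a: "0 \<le> a" "d = ennreal a" by (cases d) auto
  define b where "b = a + 1"
  have b: "b > 0" using a by (simp add: b_def)
  have "cumulative d \<le> emeasure weight_measure {0..b}"
    unfolding cumulative_def using a by (intro emeasure_mono) (auto simp: ennreal_less_iff b_def)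
  also have "\<dots> = (\<integral>\<^sup>+t\<in>{0..}. (indicator {0..b} t * ennreal (\<omega> t)) \<partial>lebesgue)"
    by (subst nn_integral_weight) auto
  also have "\<dots> = (\<integral>\<^sup>+t. ennreal (norm (indicator {0..b} t *\<^sub>R \<omega> t)) \<partial>lebesgue)"
    by (intro nn_integral_cong) (auto split: split_indicator simp: weight_nonneg)
  also have "\<dots> < \<infinity>"
    using weight b by (auto simp: weight_function_def set_integrable_def integrable_iff_bounded)
  finally show ?thesis by simp
qed

definition level :: "real \<Rightarrow> ennreal" where
  "level s = emeasure lborel {t. 0 < t \<and> s < \<omega> t}"

lemma level_set_borel: "{t. 0 < t \<and> s < \<omega> t} \<in> sets borel"
proof (rule real_interval_borel_measurable)
  show "is_interval {t. 0 < t \<and> s < \<omega> t}"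
    unfolding is_interval_1 using weight_antimono by (auto intro: less_le_trans)
qed

lemma level_measurable [measurable]: "level \<in> borel_measurable borel"
proof (rule antimono_borel_measurable, rule antimonoI)
  fix r s :: real assume "r \<le> s"
  then show "level s \<le> level r"
    unfolding level_def using level_set_borel[of r] by (intro emeasure_mono) auto
qed

text \<open>Tonelli under the graph of \<open>\<omega>\<close>. As \<open>\<omega>\<close> is
  non-increasing, its superlevel sets are initial intervals, nested with the interval up to
  \<open>d\<close>, so the intersection has the smaller measure. Thus the primitive is a mixture of
  truncations, each of them subadditive.\<close>

lemma cumulative_eq: "cumulative d = (\<integral>\<^sup>+s\<in>{0..}. min d (level s) \<partial>lborel)"
proof -
  let ?w = "\<lambda>t. indicator {0<..} t * ennreal (\<omega> t)"
  let ?f = "\<lambda>t s. indicator {p. 0 < fst p \<and> ennreal (fst p) < d \<and> 0 \<le> snd p \<and> ennreal (snd p) < ?w (fst p)} (t, s) :: ennreal"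
  have f: "case_prod ?f \<in> borel_measurable (lborel \<Otimes>\<^sub>M lborel)" by measurable
  have "cumulative d = (\<integral>\<^sup>+t. ?w t * indicator {t. 0 < t \<and> ennreal t < d} t \<partial>lborel)"
    unfolding cumulative_def by (subst nn_integral_weight_measure[symmetric]) auto
  also have "\<dots> = (\<integral>\<^sup>+t. (\<integral>\<^sup>+s. ?f t s \<partial>lborel) \<partial>lborel)"
  proof (intro nn_integral_cong)
    fix t :: real
    have "?w t * indicator {t. 0 < t \<and> ennreal t < d} t =
      (\<integral>\<^sup>+s. indicator {s. 0 \<le> s \<and> ennreal s < ?w t} s \<partial>lborel) * indicator {t. 0 < t \<and> ennreal t < d} t"
      by (subst nn_integral_indicator) (auto simp: emeasure_initial_interval)
    also have "\<dots> = (\<integral>\<^sup>+s. indicator {s. 0 \<le> s \<and> ennreal s < ?w t} s * indicator {t. 0 < t \<and> ennreal t < d} t \<partial>lborel)"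
      by (intro nn_integral_multc[symmetric]) auto
    also have "\<dots> = (\<integral>\<^sup>+s. ?f t s \<partial>lborel)"
      by (intro nn_integral_cong) (auto split: split_indicator)
    finally show "?w t * indicator {t. 0 < t \<and> ennreal t < d} t = (\<integral>\<^sup>+s. ?f t s \<partial>lborel)" .
  qed
  also have "\<dots> = (\<integral>\<^sup>+s. (\<integral>\<^sup>+t. ?f t s \<partial>lborel) \<partial>lborel)" by (rule lborel_pair.Fubini'[OF f, symmetric])
  also have "\<dots> = (\<integral>\<^sup>+s\<in>{0..}. min d (level s) \<partial>lborel)"
  proof (intro nn_integral_cong)
    fix s :: real
    show "(\<integral>\<^sup>+t. ?f t s \<partial>lborel) = min d (level s) * indicator {0..} s"
    proof (cases "0 \<le> s")
      case True
      let ?A = "{t. 0 < t \<and> ennreal t < d}" and ?B = "{t. 0 < t \<and> s < \<omega> t}"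
      have A: "?A \<in> sets borel" by measurable
      have B: "?B \<in> sets borel" by (rule level_set_borel)
      have "(\<integral>\<^sup>+t. ?f t s \<partial>lborel) = (\<integral>\<^sup>+t. indicator (?A \<inter> ?B) t \<partial>lborel)"
        using True by (intro nn_integral_cong) (auto split: split_indicator simp: ennreal_less_iff)
      also have "\<dots> = emeasure lborel (?A \<inter> ?B)"
        by (rule nn_integral_indicator) (unfold sets_lborel, intro sets.Int A B)
      also have "\<dots> = min (emeasure lborel ?A) (emeasure lborel ?B)"
      proof (rule emeasure_Int_nested)
        show "?A \<subseteq> ?B \<or> ?B \<subseteq> ?A"
        proof (rule ccontr)
          assume "\<not> ?thesis"
          then obtain a b where ab: "0 < a" "ennreal a < d" "\<not> s < \<omega> a" "0 < b" "s < \<omega> b" "\<not> ennreal b < d" by auto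
          then have "a < b" by (meson ennreal_leI le_less_trans not_le)
          then show False using weight_antimono[of a b] ab by auto
        qed
      qed (unfold sets_lborel, rule A, rule B)
      finally show ?thesis using True by (simp add: emeasure_initial_interval level_def)
    qed simp
  qed
  finally show ?thesis .
qed

lemma cumulative_add_le: "cumulative (d + e) \<le> cumulative d + cumulative e"
proof -
  have "cumulative (d + e) \<le> (\<integral>\<^sup>+s. min d (level s) * indicator {0..} s + min e (level s) * indicator {0..} s \<partial>lborel)"
    unfolding cumulative_eq
    by (intro nn_integral_mono) (auto split: split_indicator simp: min_def add_increasing add_increasing2 add_mono)
  also have "\<dots> = cumulative d + cumulative e"
    unfolding cumulative_eq by (intro nn_integral_add) auto
  finally show ?thesis .
qed

text \<open>Layer form of the integral of the rearrangement of \<open>u\<close> against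
  \<open>\<omega>\<close>. It refers to the distribution function alone, for which disjoint
  splittings are additive.\<close>

definition lorentz :: "(real \<Rightarrow> real) \<Rightarrow> ennreal" where
  "lorentz u = (\<integral>\<^sup>+\<theta>\<in>{0..}. cumulative (distribution_function u \<theta>) \<partial>lborel)"

lemma cumulative_distribution_measurable:
  "u \<in> borel_measurable half_line \<Longrightarrow> (\<lambda>\<theta>. cumulative (distribution_function u \<theta>)) \<in> borel_measurable borel"
  by (intro antimono_borel_measurable antimonoI cumulative_mono distribution_function_antimono)

text \<open>The hypothesis says that \<open>D\<close> is the generalised inverse of
  \<open>G\<close>, so each layer of \<open>G\<close> is an initial interval whose weight is given
  by \<open>cumulative\<close>.\<close>

lemma nn_integral_weight_layers:
  assumes G: "G \<in> borel_measurable borel"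
    and D: "\<And>\<theta> t. 0 \<le> \<theta> \<Longrightarrow> ennreal \<theta> < G t \<longleftrightarrow> ennreal t < D \<theta>"
  shows "(\<integral>\<^sup>+t. G t \<partial>weight_measure) = (\<integral>\<^sup>+\<theta>\<in>{0..}. cumulative (D \<theta>) \<partial>lborel)"
proof -
  interpret sigma_finite_measure weight_measure by (rule sigma_finite_weight_measure)
  interpret pair_sigma_finite weight_measure lborel ..
  note G [measurable]
  let ?f = "\<lambda>t \<theta>. indicator {p. 0 \<le> snd p \<and> ennreal (snd p) < G (fst p)} (t, \<theta>) :: ennreal"
  have f: "case_prod ?f \<in> borel_measurable (weight_measure \<Otimes>\<^sub>M lborel)" by measurable
  have "(\<integral>\<^sup>+t. G t \<partial>weight_measure) = (\<integral>\<^sup>+t. (\<integral>\<^sup>+\<theta>. ?f t \<theta> \<partial>lborel) \<partial>weight_measure)"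
  proof (intro nn_integral_cong)
    fix t
    have "G t = (\<integral>\<^sup>+\<theta>. indicator {\<theta>. 0 \<le> \<theta> \<and> ennreal \<theta> < G t} \<theta> \<partial>lborel)"
      by (subst nn_integral_indicator) (auto simp: emeasure_initial_interval)
    also have "\<dots> = (\<integral>\<^sup>+\<theta>. ?f t \<theta> \<partial>lborel)" by (intro nn_integral_cong) (auto split: split_indicator)
    finally show "G t = (\<integral>\<^sup>+\<theta>. ?f t \<theta> \<partial>lborel)" .
  qed
  also have "\<dots> = (\<integral>\<^sup>+\<theta>. (\<integral>\<^sup>+t. ?f t \<theta> \<partial>weight_measure) \<partial>lborel)" by (rule Fubini'[OF f, symmetric])
  also have "\<dots> = (\<integral>\<^sup>+\<theta>\<in>{0..}. cumulative (D \<theta>) \<partial>lborel)"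
  proof (intro nn_integral_cong)
    fix \<theta> :: real
    show "(\<integral>\<^sup>+t. ?f t \<theta> \<partial>weight_measure) = cumulative (D \<theta>) * indicator {0..} \<theta>"
    proof (cases "0 \<le> \<theta>")
      case True
      have "(\<integral>\<^sup>+t. ?f t \<theta> \<partial>weight_measure) = (\<integral>\<^sup>+t. indicator {t. 0 < t \<and> ennreal t < D \<theta>} t \<partial>weight_measure)"
        using AE_weight_measure_pos True D[OF True]
        by (intro nn_integral_cong_AE) (auto elim!: eventually_mono split: split_indicator)
      then show ?thesis using True by (simp add: cumulative_def)
    qed simp
  qed
  finally show ?thesis .
qed

text \<open>Exchanging the two layer integrals shows the functional as an average, over the levels
  of \<open>\<omega>\<close>, of truncated integrals; subadditivity is inherited from them.\<close>

lemma lorentz_eq: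
  assumes u: "u \<in> borel_measurable half_line"
  shows "lorentz u = (\<integral>\<^sup>+s\<in>{0..}. truncated_integral (level s) u \<partial>lborel)"
proof -
  note [measurable] = distribution_function_measurable[OF u]
  let ?f = "\<lambda>s \<theta>. min (distribution_function u \<theta>) (level s) * indicator {0..} s * indicator {0..} \<theta>"
  have f: "case_prod ?f \<in> borel_measurable (lborel \<Otimes>\<^sub>M lborel)" by measurable
  have "lorentz u = (\<integral>\<^sup>+\<theta>. (\<integral>\<^sup>+s. ?f s \<theta> \<partial>lborel) \<partial>lborel)"
    unfolding lorentz_def cumulative_eq
    by (intro nn_integral_cong nn_integral_multc[symmetric]) measurable
  also have "\<dots> = (\<integral>\<^sup>+s. (\<integral>\<^sup>+\<theta>. ?f s \<theta> \<partial>lborel) \<partial>lborel)" by (rule lborel_pair.Fubini'[OF f])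
  also have "\<dots> = (\<integral>\<^sup>+s. (\<integral>\<^sup>+\<theta>. min (distribution_function u \<theta>) (level s) * indicator {0..} \<theta> * indicator {0..} s \<partial>lborel) \<partial>lborel)"
    by (simp add: ac_simps)
  also have "\<dots> = (\<integral>\<^sup>+s\<in>{0..}. truncated_integral (level s) u \<partial>lborel)"
    unfolding truncated_integral_def by (intro nn_integral_cong nn_integral_multc) measurable
  finally show ?thesis .
qed

lemma truncated_integral_level_measurable:
  assumes u: "u \<in> borel_measurable half_line"
  shows "(\<lambda>s. truncated_integral (level s) u) \<in> borel_measurable borel"
proof -
  note [measurable] = distribution_function_measurable[OF u]
  show ?thesis unfolding truncated_integral_def by measurable
qed

lemma lorentz_add_le:
  assumes u: "u \<in> borel_measurable half_line" and v: "v \<in> borel_measurable half_line"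
  shows "lorentz (\<lambda>s. u s + v s) \<le> lorentz u + lorentz v"
proof -
  note [measurable] = u v truncated_integral_level_measurable[OF u] truncated_integral_level_measurable[OF v]
  have "lorentz (\<lambda>s. u s + v s) \<le> (\<integral>\<^sup>+s. truncated_integral (level s) u * indicator {0..} s
      + truncated_integral (level s) v * indicator {0..} s \<partial>lborel)"
    by (subst lorentz_eq)
       (auto intro!: nn_integral_mono truncated_integral_add_le u v split: split_indicator)
  also have "\<dots> = lorentz u + lorentz v"
    unfolding lorentz_eq[OF u] lorentz_eq[OF v] by (intro nn_integral_add) auto
  finally show ?thesis .
qed

lemma lorentz_mono:
  "v \<in> borel_measurable half_line \<Longrightarrow> (\<And>s. 0 \<le> s \<Longrightarrow> \<bar>u s\<bar> \<le> \<bar>v s\<bar>) \<Longrightarrow> lorentz u \<le> lorentz v"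
  unfolding lorentz_def
  by (intro nn_integral_mono mult_right_mono cumulative_mono distribution_function_mono) auto

lemma lorentz_cmult:
  assumes u: "u \<in> borel_measurable half_line" and a: "0 \<le> a"
  shows "lorentz (\<lambda>s. a * u s) = ennreal a * lorentz u"
proof (cases "a = 0")
  case True
  have "distribution_function (\<lambda>s. 0) \<theta> = 0" if "0 \<le> \<theta>" for \<theta>
    using that by (simp add: distribution_function_def)
  then have "lorentz (\<lambda>s. 0) = (\<integral>\<^sup>+\<theta>. 0 \<partial>(lborel :: real measure))"
    unfolding lorentz_def by (intro nn_integral_cong) (auto split: split_indicator)
  then show ?thesis using True by simp
next
  case False
  then have a: "a > 0" using a by simp
  note [measurable] = cumulative_distribution_measurable[OF u]
  let ?g = "\<lambda>\<theta>. cumulative (distribution_function u (\<theta> / a)) * indicator {0..} \<theta>"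
  have "distribution_function (\<lambda>s. a * u s) \<theta> = distribution_function u (\<theta> / a)" for \<theta>
    using a by (intro distribution_function_cong) (auto simp: field_simps abs_mult)
  then have "lorentz (\<lambda>s. a * u s) = (\<integral>\<^sup>+\<theta>. ?g \<theta> \<partial>lborel)" by (simp add: lorentz_def)
  also have "\<dots> = ennreal \<bar>a\<bar> * (\<integral>\<^sup>+\<theta>. ?g (0 + a * \<theta>) \<partial>lborel)"
    using a by (intro nn_integral_real_affine) auto
  also have "(\<integral>\<^sup>+\<theta>. ?g (0 + a * \<theta>) \<partial>lborel) = lorentz u"
    unfolding lorentz_def using a
    by (intro nn_integral_cong) (auto split: split_indicator simp: zero_le_mult_iff)
  finally show ?thesis using a by simp
qed

end

subsection \<open>The Orlicz norm\<close>

lemma extend_top_measurable [measurable]: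
  assumes [measurable]: "\<Phi> \<in> borel_measurable borel" shows "extend_top \<Phi> \<in> borel_measurable borel"
  unfolding extend_top_def[abs_def] by measurable

lemma (in weight) modular_eq_weight_measure:
  assumes x: "x \<in> borel_measurable half_line" and [measurable]: "\<Phi> \<in> borel_measurable borel"
  shows "modular \<Phi> \<omega> x = (\<integral>\<^sup>+t. extend_top \<Phi> (rearrangement x t) \<partial>weight_measure)"
proof -
  note [measurable] = rearrangement_measurable[OF x]
  show ?thesis unfolding modular_def by (rule nn_integral_weight) measurable
qed

section \<open>Strict growth of the primitive\<close>

text \<open>A zero of the non-increasing weight persists to the right, and then the total weight
  would be the finite weight of a bounded interval.\<close>

lemma (in weight) weight_pos:
  assumes top: "cumulative top = top" and t: "0 < t"
  shows "0 < \<omega> t"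
proof (rule ccontr)
  assume "\<not> 0 < \<omega> t"
  then have 0: "\<omega> s = 0" if "t \<le> s" for s
    using weight_antimono[of t s] weight_nonneg[of s] weight_nonneg[of t] t that by auto
  have "AE s in weight_measure. s < t"
    unfolding weight_measure_def
    by (subst AE_density) (auto split: split_indicator_asm simp: 0 not_le[symmetric])
  then have "cumulative top = cumulative (ennreal t)"
    unfolding cumulative_def using t
    by (intro emeasure_eq_AE) (auto elim!: eventually_mono simp: ennreal_less_iff)
  then show False using top cumulative_finite[of "ennreal t"] by simp
qed

lemma (in weight) cumulative_gap:
  assumes ab: "0 \<le> a" "a \<le> b" "0 < b"
  shows "cumulative (ennreal a) + ennreal ((b - a) * \<omega> b) \<le> cumulative (ennreal b)"
proof -
  let ?A = "{t. 0 < t \<and> ennreal t < ennreal a}" and ?B = "{t. 0 < t \<and> a \<le> t \<and> t < b}"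
  have "ennreal ((b - a) * \<omega> b) = (\<integral>\<^sup>+t. ennreal (\<omega> b) * indicator {a<..<b} t \<partial>lborel)"
    using ab weight_nonneg[of b] by (simp add: nn_integral_cmult ennreal_mult[symmetric] mult.commute)
  also have "\<dots> \<le> (\<integral>\<^sup>+t. indicator {0<..} t * ennreal (\<omega> t) * indicator ?B t \<partial>lborel)"
    using ab weight_antimono by (intro nn_integral_mono) (auto split: split_indicator simp: ennreal_leI)
  also have "\<dots> = emeasure weight_measure ?B"
    by (subst nn_integral_weight_measure[symmetric]) auto
  finally have "cumulative (ennreal a) + ennreal ((b - a) * \<omega> b) \<le> emeasure weight_measure ?A + emeasure weight_measure ?B"
    unfolding cumulative_def by (intro add_left_mono)
  also have "\<dots> = emeasure weight_measure (?A \<union> ?B)"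
    using ab by (intro plus_emeasure) (auto simp: ennreal_less_iff)
  also have "\<dots> \<le> cumulative (ennreal b)"
    unfolding cumulative_def using ab by (intro emeasure_mono) (auto simp: ennreal_less_iff)
  finally show ?thesis .
qed

text \<open>From the smaller part to the whole there is a distance of at least
  \<open>d0 / 2\<close>, on which the weight is at least \<open>\<omega> d1\<close>; for the larger
  part monotonicity suffices. The surplus depends on \<open>d0\<close> and \<open>d1\<close> only,
  not on how the set is split.\<close>

lemma (in weight) cumulative_halving:
  assumes e: "d0 \<le> e1 + e2" "e1 + e2 \<le> d1" and d: "0 < d0" "0 \<le> d1"
    and e0: "0 \<le> e1" "0 \<le> e2"
  shows "cumulative (ennreal e1) + cumulative (ennreal e2) + ennreal (d0 / 2 * \<omega> d1)
    \<le> 2 * cumulative (ennreal (e1 + e2))"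
proof -
  have *: "cumulative (ennreal a) + cumulative (ennreal b) + ennreal (d0 / 2 * \<omega> d1)
      \<le> 2 * cumulative (ennreal (a + b))"
    if ab: "0 \<le> a" "0 \<le> b" "a \<le> b" "d0 \<le> a + b" "a + b \<le> d1" for a b
  proof -
    have "d0 / 2 * \<omega> d1 \<le> (a + b - a) * \<omega> (a + b)"
      using ab d weight_antimono[of "a + b" d1] weight_nonneg[of d1] by (intro mult_mono) auto
    then have "cumulative (ennreal a) + ennreal (d0 / 2 * \<omega> d1) \<le>
        cumulative (ennreal a) + ennreal ((a + b - a) * \<omega> (a + b))"
      by (intro add_left_mono ennreal_leI)
    also have "\<dots> \<le> cumulative (ennreal (a + b))"
      using ab d by (intro cumulative_gap) auto
    finally have 1: "cumulative (ennreal a) + ennreal (d0 / 2 * \<omega> d1) \<le> cumulative (ennreal (a + b))" .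
    have "cumulative (ennreal b) \<le> cumulative (ennreal (a + b))"
      using ab by (intro cumulative_mono ennreal_leI) auto
    from add_mono[OF 1 this] show ?thesis by (simp add: ac_simps mult_2)
  qed
  show ?thesis
    using *[of e1 e2] *[of e2 e1] e e0 by (cases "e1 \<le> e2") (auto simp: ac_simps)
qed

locale orlicz_lorentz = orlicz \<phi> + weight \<omega> for \<phi> \<omega>
begin

text \<open>\<open>\<phi>\<close> maps the nonnegative reals strictly increasingly onto themselves,
  so each level of \<open>\<phi> \<circ> x\<close> is a level of \<open>x\<close>. This trades
  rearrangements for a subadditive functional of an ordinary function.\<close>

lemma modular_eq_lorentz:
  assumes x: "x \<in> borel_measurable half_line"
  shows "modular \<phi> \<omega> x = lorentz (\<lambda>s. \<phi> (x s))"
  unfolding modular_eq_weight_measure[OF x measurable] lorentz_def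
proof (rule nn_integral_weight_layers)
  note [measurable] = rearrangement_measurable[OF x]
  show "(\<lambda>t. extend_top \<phi> (rearrangement x t)) \<in> borel_measurable borel" by measurable
  fix \<theta> t :: real assume "0 \<le> \<theta>"
  then obtain \<alpha> where \<alpha>: "0 \<le> \<alpha>" "\<phi> \<alpha> = \<theta>" using surj_nonneg by blast
  have "ennreal \<theta> < extend_top \<phi> a \<longleftrightarrow> ennreal \<alpha> < a" for a
  proof (cases a)
    case (real r)
    then show ?thesis using \<alpha> less_iff[of \<alpha> r] by (auto simp: extend_top_def ennreal_less_iff)
  qed (simp add: extend_top_def)
  moreover have "distribution_function (\<lambda>s. \<phi> (x s)) \<theta> = distribution_function x \<alpha>"
    using \<alpha> less_iff[of \<alpha> "\<bar>x s\<bar>" for s] by (intro distribution_function_cong) simp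
  ultimately show "ennreal \<theta> < extend_top \<phi> (rearrangement x t) \<longleftrightarrow>
      ennreal t < distribution_function (\<lambda>s. \<phi> (x s)) \<theta>"
    using less_rearrangement_iff[OF x \<alpha>(1)] by simp
qed

section \<open>The norm with extended values, and the easy half of the Amemiya formula\<close>

definition sup_norm :: "(real \<Rightarrow> real) \<Rightarrow> ennreal" where
  "sup_norm x = (SUP y\<in>{y \<in> borel_measurable half_line. modular \<psi> \<omega> y \<le> 1}.
     \<integral>\<^sup>+t\<in>{0..}. (rearrangement x t * rearrangement y t * ennreal (\<omega> t)) \<partial>lebesgue)"

lemma orlicz_norm_eq: "orlicz_norm \<phi> \<omega> x = enn2real (sup_norm x)"
  by (simp add: orlicz_norm_def sup_norm_def)

lemma pairing_eq:
  assumes "x \<in> borel_measurable half_line" "y \<in> borel_measurable half_line"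
  shows "(\<integral>\<^sup>+t\<in>{0..}. (rearrangement x t * rearrangement y t * ennreal (\<omega> t)) \<partial>lebesgue)
    = (\<integral>\<^sup>+t. rearrangement x t * rearrangement y t \<partial>weight_measure)"
proof -
  note [measurable] = assms[THEN rearrangement_measurable]
  show ?thesis by (rule nn_integral_weight) measurable
qed

lemma sup_norm_ge:
  assumes "x \<in> borel_measurable half_line" "y \<in> borel_measurable half_line" "modular \<psi> \<omega> y \<le> 1"
  shows "(\<integral>\<^sup>+t. rearrangement x t * rearrangement y t \<partial>weight_measure) \<le> sup_norm x"
  unfolding sup_norm_def pairing_eq[OF assms(1,2), symmetric] using assms by (intro SUP_upper) auto

lemma young_extend_top:
  assumes k: "0 < k"
  shows "a * b \<le> ennreal (1 / k) * (extend_top \<phi> (ennreal k * a) + extend_top \<psi> b)"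
proof (cases "a = top \<or> b = top")
  case True
  then have *: "extend_top \<phi> (ennreal k * a) + extend_top \<psi> b = top"
    using k by (auto simp: extend_top_def ennreal_mult_top)
  show ?thesis unfolding * using k by (simp add: ennreal_mult_top)
next
  case False
  then obtain r s where rs: "0 \<le> r" "a = ennreal r" "0 \<le> s" "b = ennreal s" by (cases a; cases b) auto
  have "r * s \<le> 1 / k * (\<phi> (k * r) + \<psi> s)"
    using young[of "k * r" s] rs k by (simp add: field_simps)
  then have "ennreal (r * s) \<le> ennreal (1 / k * (\<phi> (k * r) + \<psi> s))" by (rule ennreal_leI)
  then show ?thesis
    using rs k unfolding ennreal_mult[of "1/k", symmetric]
    by (simp add: extend_top_def ennreal_mult'[symmetric] ennreal_plus[symmetric] del: ennreal_plus)
qed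

lemma amemiya_le:
  assumes x: "x \<in> borel_measurable half_line" and k: "0 < k"
  shows "sup_norm x \<le> ennreal (1 / k) * (1 + modular \<phi> \<omega> (\<lambda>s. k * x s))"
  unfolding sup_norm_def
proof (rule SUP_least, clarify)
  fix y assume y: "y \<in> borel_measurable half_line" "modular \<psi> \<omega> y \<le> 1"
  have kx: "(\<lambda>s. k * x s) \<in> borel_measurable half_line" using x by measurable
  note [measurable] = x[THEN rearrangement_measurable] y(1)[THEN rearrangement_measurable]
  have "(\<integral>\<^sup>+t. rearrangement x t * rearrangement y t \<partial>weight_measure) \<le>
    (\<integral>\<^sup>+t. ennreal (1 / k) * (extend_top \<phi> (ennreal k * rearrangement x t) + extend_top \<psi> (rearrangement y t)) \<partial>weight_measure)"
    by (intro nn_integral_mono young_extend_top k)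
  also have "\<dots> = ennreal (1 / k) * (modular \<phi> \<omega> (\<lambda>s. k * x s) + modular \<psi> \<omega> y)"
    unfolding modular_eq_weight_measure[OF kx measurable] modular_eq_weight_measure[OF y(1) complementary_measurable]
      rearrangement_cmult[OF x k]
    by (subst nn_integral_cmult) (auto intro!: arg_cong2[where f="(*)"] nn_integral_add)
  also have "\<dots> \<le> ennreal (1 / k) * (modular \<phi> \<omega> (\<lambda>s. k * x s) + 1)"
    using y by (intro mult_left_mono add_left_mono) auto
  finally show "(\<integral>\<^sup>+t\<in>{0..}. (rearrangement x t * rearrangement y t * ennreal (\<omega> t)) \<partial>lebesgue)
      \<le> ennreal (1 / k) * (1 + modular \<phi> \<omega> (\<lambda>s. k * x s))"
    unfolding pairing_eq[OF x y(1)] by (simp add: add.commute)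
qed

lemma space_measurable: "x \<in> orlicz_lorentz_space \<phi> \<omega> \<Longrightarrow> x \<in> borel_measurable half_line"
  by (simp add: orlicz_lorentz_space_def)

lemma sup_norm_finite: "x \<in> orlicz_lorentz_space \<phi> \<omega> \<Longrightarrow> sup_norm x < top"
proof -
  assume "x \<in> orlicz_lorentz_space \<phi> \<omega>"
  then obtain l where l: "l > 0" "modular \<phi> \<omega> (\<lambda>s. l * x s) < top" "x \<in> borel_measurable half_line"
    by (auto simp: orlicz_lorentz_space_def)
  have "ennreal (1 / l) * (1 + modular \<phi> \<omega> (\<lambda>s. l * x s)) < top"
    using l by (auto simp: ennreal_mult_less_top)
  then show ?thesis using amemiya_le[OF l(3,1)] by order
qed

lemma ennreal_orlicz_norm: "x \<in> orlicz_lorentz_space \<phi> \<omega> \<Longrightarrow> ennreal (orlicz_norm \<phi> \<omega> x) = sup_norm x"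
  using sup_norm_finite[of x] by (simp add: orlicz_norm_eq)

text \<open>An infinite value at \<open>t\<close> would persist on the whole interval up to
  \<open>t\<close>, which has positive weight, and every positive multiple of \<open>x\<close> would
  have infinite modular.\<close>

lemma rearrangement_finite:
  assumes top: "cumulative top = top" and x: "x \<in> orlicz_lorentz_space \<phi> \<omega>" and t: "0 < t"
  shows "rearrangement x t < top"
proof (rule ccontr)
  assume "\<not> ?thesis"
  then have inf: "rearrangement x s = top" if "s \<le> t" for s
    using rearrangement_antimono[OF that, of x] by (auto simp: less_top[symmetric] top_unique)
  obtain l where l: "l > 0" "modular \<phi> \<omega> (\<lambda>s. l * x s) < top" "x \<in> borel_measurable half_line"
    using x by (auto simp: orlicz_lorentz_space_def)
  note [measurable] = l(3)
  have "(\<integral>\<^sup>+s. top * indicator {s. 0 < s \<and> ennreal s < ennreal t} s \<partial>weight_measure)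
      \<le> (\<integral>\<^sup>+s. extend_top \<phi> (rearrangement (\<lambda>s. l * x s) s) \<partial>weight_measure)"
    unfolding rearrangement_cmult[OF l(3,1)]
    using inf l by (intro nn_integral_mono) (auto split: split_indicator simp: extend_top_def ennreal_less_iff ennreal_mult_top)
  also have "\<dots> < top"
    using l(2) by (subst modular_eq_weight_measure[symmetric]) auto
  finally have "top * cumulative (ennreal t) < top"
    unfolding cumulative_def by (subst (asm) nn_integral_cmult) auto
  then have "cumulative (ennreal t) = 0" by (cases "cumulative (ennreal t) = 0") (auto simp: ennreal_top_mult)
  moreover have "ennreal ((t - 0) * \<omega> t) > 0"
    using t weight_pos[OF top t] by (simp add: zero_less_mult_iff)
  ultimately show False using cumulative_gap[of 0 t] t by simp
qed

lemma modular_enn2real: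
  assumes x: "x \<in> borel_measurable half_line" and fin: "\<And>t. 0 < t \<Longrightarrow> rearrangement x t < top"
    and k: "0 < k"
  shows "modular \<phi> \<omega> (\<lambda>s. k * x s) = (\<integral>\<^sup>+t. ennreal (\<phi> (k * enn2real (rearrangement x t))) \<partial>weight_measure)"
proof -
  note [measurable] = x
  have "modular \<phi> \<omega> (\<lambda>s. k * x s) = (\<integral>\<^sup>+t. extend_top \<phi> (rearrangement (\<lambda>s. k * x s) t) \<partial>weight_measure)"
    by (intro modular_eq_weight_measure) measurable
  also have "\<dots> = (\<integral>\<^sup>+t. ennreal (\<phi> (k * enn2real (rearrangement x t))) \<partial>weight_measure)"
    unfolding rearrangement_cmult[OF x k]
  proof (intro nn_integral_cong_AE, use AE_weight_measure_pos in eventually_elim)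
    fix t :: real assume "0 < t"
    then obtain r where "0 \<le> r" "rearrangement x t = ennreal r"
      using fin[of t] by (cases "rearrangement x t") auto
    then show "extend_top \<phi> (ennreal k * rearrangement x t) = ennreal (\<phi> (k * enn2real (rearrangement x t)))"
      using k by (simp add: extend_top_def ennreal_mult[symmetric])
  qed
  finally show ?thesis .
qed

subsection \<open>The Amemiya formula\<close>

text \<open>A non-increasing function can be inserted as a test function in the supremum, since it
  is almost everywhere its own rearrangement.\<close>

lemma modular_antimono_eq:
  assumes g: "antimono_on {0<..} g" "\<And>s. 0 < s \<Longrightarrow> 0 \<le> g s" "g \<in> borel_measurable borel"
  shows "g \<in> borel_measurable half_line"
    and "modular \<psi> \<omega> g = (\<integral>\<^sup>+t. ennreal (\<psi> (g t)) \<partial>weight_measure)"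
    and "AE t in weight_measure. rearrangement g t = ennreal (g t)"
proof -
  show gm: "g \<in> borel_measurable half_line"
    using g(3) by (intro measurable_restrict_space1 measurable_completion) simp
  show AE: "AE t in weight_measure. rearrangement g t = ennreal (g t)"
    by (intro AE_weight_measureI AE_rearrangement_antimono g gm)
  show "modular \<psi> \<omega> g = (\<integral>\<^sup>+t. ennreal (\<psi> (g t)) \<partial>weight_measure)"
    unfolding modular_eq_weight_measure[OF gm complementary_measurable]
  proof (intro nn_integral_cong_AE)
    show "AE t in weight_measure. extend_top \<psi> (rearrangement g t) = ennreal (\<psi> (g t))"
      using AE AE_weight_measure_pos
      by eventually_elim (simp add: extend_top_def g(2))
  qed
qed

lemma emeasure_weight_measure_Ioc:
  "0 \<le> a \<Longrightarrow> emeasure weight_measure {0<..a} = cumulative (ennreal a)"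
  unfolding cumulative_def
  by (intro emeasure_eq_AE AE_weight_measureI)
     (use AE_lborel_singleton[of a] in \<open>auto elim!: eventually_mono simp: ennreal_less_iff\<close>)

text \<open>The chain \<open>\<psi> (slope u) \<le> u * slope u \<le> \<phi> (2 * u)\<close> reduces
  this to the modular of \<open>f\<close>. With \<open>k = l / (2 * r)\<close> convexity leaves a
  factor \<open>1 / r\<close>, which brings the finite value \<open>C\<close> below
  \<open>1\<close>.\<close>

lemma slope_modular_small:
  assumes f: "f \<in> borel_measurable borel" "\<And>t. 0 \<le> f t" and l: "0 < l"
    and fin: "(\<integral>\<^sup>+t. ennreal (\<phi> (l * f t)) \<partial>weight_measure) < top"
  shows "\<exists>k>0. (\<integral>\<^sup>+t. ennreal (\<psi> (slope (k * f t))) \<partial>weight_measure) \<le> 1"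
proof -
  note [measurable] = f(1)
  obtain C where C: "0 \<le> C" "(\<integral>\<^sup>+t. ennreal (\<phi> (l * f t)) \<partial>weight_measure) = ennreal C"
    using fin by (cases "\<integral>\<^sup>+t. ennreal (\<phi> (l * f t)) \<partial>weight_measure") auto
  define r where "r = max 1 C"
  have r: "1 \<le> r" "C \<le> r" by (auto simp: r_def)
  define k where "k = l / (2 * r)"
  have "\<psi> (slope (k * f t)) \<le> 1 / r * \<phi> (l * f t)" for t
  proof -
    have kf: "0 \<le> k * f t" using f l r by (simp add: k_def)
    have "\<psi> (slope (k * f t)) \<le> \<phi> (2 * (k * f t))"
      using complementary_slope[OF kf] mult_slope_le[OF kf] by linarith
    also have "2 * (k * f t) = 1 / r * (l * f t)" using r by (simp add: k_def)
    also have "\<phi> (1 / r * (l * f t)) \<le> 1 / r * \<phi> (l * f t)" using r by (intro scale_le) auto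
    finally show ?thesis .
  qed
  then have "(\<integral>\<^sup>+t. ennreal (\<psi> (slope (k * f t))) \<partial>weight_measure)
      \<le> (\<integral>\<^sup>+t. ennreal (1 / r) * ennreal (\<phi> (l * f t)) \<partial>weight_measure)"
    using r by (intro nn_integral_mono) (auto simp: ennreal_mult'[symmetric] intro!: ennreal_leI)
  also have "\<dots> = ennreal (1 / r * C)"
    using C r by (subst nn_integral_cmult) (auto simp: ennreal_mult'[symmetric])
  also have "\<dots> \<le> 1" using r by (simp add: divide_le_eq_1)
  finally show ?thesis using l r by (intro exI[of _ k]) (auto simp: k_def)
qed

lemma slope_modular_large:
  assumes top: "cumulative top = top" and t0: "0 < t0" "0 < \<beta>" "\<And>t. 0 < t \<Longrightarrow> t \<le> t0 \<Longrightarrow> \<beta> \<le> f t"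
  shows "\<exists>L. \<forall>l\<ge>L. 1 < (\<integral>\<^sup>+t. ennreal (\<psi> (slope (l * f t))) \<partial>weight_measure)"
proof -
  obtain r where r: "0 \<le> r" "cumulative (ennreal t0) = ennreal r"
    using cumulative_finite[of "ennreal t0"] by (cases "cumulative (ennreal t0)") auto
  have "0 < ennreal ((t0 - 0) * \<omega> t0)" using t0 weight_pos[OF top t0(1)] by simp
  also have "\<dots> \<le> ennreal r" using cumulative_gap[of 0 t0] t0 r by simp
  finally have r0: "0 < r" by (simp add: ennreal_less_zero_iff)
  \<comment> \<open>Superlinearity pushes the slope above \<open>c\<close>, and then
    \<open>\<psi>\<close> of it is at least \<open>c - \<phi> 1 = 2 / r\<close>; on an interval of
    weight \<open>r\<close> this integrates to \<open>2\<close>.\<close>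
  define c where "c = 2 / r + \<phi> 1"
  obtain U where U: "U > 0" "\<And>u. u \<ge> U \<Longrightarrow> c * u \<le> \<phi> u" using superlinear by blast
  define L where "L = U / \<beta>"
  have "1 < (\<integral>\<^sup>+t. ennreal (\<psi> (slope (l * f t))) \<partial>weight_measure)" if l: "l \<ge> L" for l
  proof -
    have l0: "0 < l" using l U t0 by (simp add: L_def) (meson divide_pos_pos less_le_trans)
    have u: "U \<le> l * \<beta>" using l t0 by (simp add: L_def field_simps)
    then have u0: "0 < l * \<beta>" using U by linarith
    have "c * (l * \<beta>) \<le> (l * \<beta>) * slope (l * \<beta>)"
      using U(2)[OF u] slope_ge[of "l * \<beta>"] u0 by linarith
    then have "(l * \<beta>) * c \<le> (l * \<beta>) * slope (l * \<beta>)" by (simp only: mult.commute)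
    then have "c \<le> slope (l * \<beta>)" using u0 by (simp only: mult_le_cancel_left_pos)
    then have ge: "2 / r \<le> \<psi> (slope (l * \<beta>))"
      using complementary_ge_linear[of "slope (l * \<beta>)"] by (simp add: c_def)
    have "ennreal (2 / r) \<le> ennreal (\<psi> (slope (l * f t)))" if "0 < t" "t \<le> t0" for t
    proof -
      have "slope (l * \<beta>) \<le> slope (l * f t)" using t0(3)[OF that] l0 by (intro slope_mono) auto
      then have "\<psi> (slope (l * \<beta>)) \<le> \<psi> (slope (l * f t))" by (intro complementary_mono) auto
      then show ?thesis using ge by (intro ennreal_leI) auto
    qed
    then have "(\<integral>\<^sup>+t. ennreal (2 / r) * indicator {0<..t0} t \<partial>weight_measure)
        \<le> (\<integral>\<^sup>+t. ennreal (\<psi> (slope (l * f t))) \<partial>weight_measure)"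
      by (intro nn_integral_mono) (auto split: split_indicator)
    moreover have "(\<integral>\<^sup>+t. ennreal (2 / r) * indicator {0<..t0} t \<partial>weight_measure) = ennreal 2"
      using r r0 t0 by (subst nn_integral_cmult_indicator) (auto simp: emeasure_weight_measure_Ioc ennreal_mult'[symmetric])
    moreover have "1 < ennreal 2" by simp
    ultimately show ?thesis by order
  qed
  then show ?thesis by blast
qed

text \<open>The truncation \<open>min T (q t)\<close> on \<open>{..T}\<close> keeps the integral finite, although the
  integral of \<open>\<psi> \<circ> q\<close> may be infinite; letting the truncation level grow makes the value \<open>1\<close>
  attained.\<close>

lemma interpolating_function:
  fixes p q :: "real \<Rightarrow> real"
  assumes p [measurable]: "p \<in> borel_measurable borel" and q [measurable]: "q \<in> borel_measurable borel"
    and pq: "\<And>t. 0 \<le> p t" "\<And>t. p t \<le> q t"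
    and le: "(\<integral>\<^sup>+t. ennreal (\<psi> (p t)) \<partial>weight_measure) \<le> 1"
    and gt: "1 < (\<integral>\<^sup>+t. ennreal (\<psi> (q t)) \<partial>weight_measure)"
  shows "\<exists>T\<ge>0. (\<integral>\<^sup>+t. ennreal (\<psi> (max (p t) (if t \<le> T then min T (q t) else 0))) \<partial>weight_measure) = 1"
proof -
  define z where "z T t = max (p t) (if t \<le> T then min T (q t) else 0)" for T t
  have z_meas [measurable]: "z T \<in> borel_measurable borel" for T unfolding z_def by measurable
  have z0: "0 \<le> z T t" for T t using pq(1)[of t] by (simp add: z_def)
  have z_mono: "z S t \<le> z T t" if "0 \<le> S" "S \<le> T" for S T t
    using that pq(1)[of t] pq(2)[of t] by (auto simp: z_def)
  have q0: "0 \<le> q t" for t using pq[of t] by linarith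
  have p_int: "integrable weight_measure (\<lambda>t. \<psi> (p t))"
    using le by (intro integrableI_nonneg) (auto simp: order_le_less_trans)
  have i_int: "integrable weight_measure (\<lambda>t. \<psi> B * indicator {0<..B} t)" if "0 \<le> B" for B
    using cumulative_finite[of "ennreal B"] that
    by (intro integrable_mult_right integrable_real_indicator) (auto simp: emeasure_weight_measure_Ioc)
  have bound: "\<psi> (z T t) \<le> \<psi> (p t) + \<psi> B * indicator {0<..B} t" if "0 < t" "0 \<le> T" "T \<le> B" for T B t
  proof (cases "t \<le> T \<and> p t \<le> min T (q t)")
    case True
    then have "\<psi> (z T t) \<le> \<psi> B" using that z0[of T t] by (intro complementary_mono) (auto simp: z_def)
    moreover have "\<psi> B * indicator {0<..B} t = \<psi> B" using True that by simp
    moreover have "0 \<le> \<psi> (p t)" by (rule complementary_nonneg)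
    ultimately show ?thesis by linarith
  next
    case False
    then have "z T t = p t" using pq(1)[of t] by (auto simp: z_def max_def)
    then show ?thesis by (simp split: split_indicator)
  qed
  have int: "integrable weight_measure (\<lambda>t. \<psi> (z T t))" if "0 \<le> T" for T
  proof (rule Bochner_Integration.integrable_bound[OF Bochner_Integration.integrable_add[OF p_int i_int[OF that]]])
    show "AE t in weight_measure. norm (\<psi> (z T t)) \<le> norm (\<psi> (p t) + \<psi> T * indicator {0<..T} t)"
      using AE_weight_measure_pos
    proof eventually_elim
      case (elim t)
      have "0 \<le> \<psi> (p t) + \<psi> T * indicator {0<..T} t" by (intro add_nonneg_nonneg) auto
      then show ?case using bound[OF elim that order_refl] by simp
    qed
  qed measurable
  define g where "g T = (\<integral>t. \<psi> (z T t) \<partial>weight_measure)" for T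
  have g: "(\<integral>\<^sup>+t. ennreal (\<psi> (z T t)) \<partial>weight_measure) = ennreal (g T)" if "0 \<le> T" for T
    unfolding g_def by (rule nn_integral_eq_integral[OF int[OF that]]) simp
  have cont: "continuous_on {0..} g"
    unfolding continuous_on_sequentially
  proof (intro allI ballI impI, elim conjE)
    fix a :: real and X assume a: "a \<in> {0..}" "\<forall>n. X n \<in> {0..}" "X \<longlonglongrightarrow> a"
    obtain B where B: "0 < B" "\<And>n. norm (X n) \<le> B"
      using convergent_imp_Bseq[of X] a(3) by (auto simp: convergent_def Bseq_def)
    have XB: "0 \<le> X n" "X n \<le> B" for n using a(2) B(2)[of n] by auto
    show "(g \<circ> X) \<longlonglongrightarrow> g a"
      unfolding g_def comp_def
    proof (rule integral_dominated_convergence[where w="\<lambda>t. \<psi> (p t) + \<psi> B * indicator {0<..B} t"])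
      show "integrable weight_measure (\<lambda>t. \<psi> (p t) + \<psi> B * indicator {0<..B} t)"
        using B p_int i_int[of B] by (intro Bochner_Integration.integrable_add) auto
      show "AE t in weight_measure. norm (\<psi> (z (X n) t)) \<le> \<psi> (p t) + \<psi> B * indicator {0<..B} t" for n
        using AE_weight_measure_pos
        by eventually_elim (use bound XB in auto)
      have "AE t in weight_measure. t \<noteq> a"
        by (rule AE_weight_measureI) (use AE_lborel_singleton[of a] in \<open>auto elim!: eventually_mono\<close>)
      then show "AE t in weight_measure. (\<lambda>n. \<psi> (z (X n) t)) \<longlonglongrightarrow> \<psi> (z a t)"
      proof eventually_elim
        case (elim t)
        have "(\<lambda>n. z (X n) t) \<longlonglongrightarrow> z a t"
        proof (cases "t < a")
          case True
          have "eventually (\<lambda>n. t < X n) sequentially" using a(3) True by (rule order_tendstoD(1))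
          then have ev: "eventually (\<lambda>n. max (p t) (min (X n) (q t)) = z (X n) t) sequentially"
            by eventually_elim (simp add: z_def)
          have "(\<lambda>n. max (p t) (min (X n) (q t))) \<longlonglongrightarrow> max (p t) (min a (q t))"
            by (intro tendsto_intros a(3))
          then show ?thesis using True Lim_transform_eventually[OF _ ev] by (simp add: z_def)
        next
          case False
          then have "eventually (\<lambda>n. X n < t) sequentially" using a(3) elim by (intro order_tendstoD(2)) auto
          then have ev: "eventually (\<lambda>n. p t = z (X n) t) sequentially"
            by eventually_elim (use pq in \<open>simp add: z_def max_absorb1\<close>)
          have "z a t = p t" using False elim pq by (simp add: z_def max_absorb1)
          then show ?thesis using Lim_transform_eventually[OF tendsto_const ev] by simp
        qed
        moreover have "isCont \<psi> (z a t)"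
          using complementary_continuous[of UNIV] by (simp add: continuous_on_eq_continuous_at)
        ultimately show ?case by (rule isCont_tendsto_compose[rotated])
      qed
    qed measurable
  qed
  have "(\<lambda>n. \<integral>\<^sup>+t. ennreal (\<psi> (z (real n) t)) \<partial>weight_measure) \<longlonglongrightarrow> (\<integral>\<^sup>+t. ennreal (\<psi> (q t)) \<partial>weight_measure)"
  proof (rule nn_integral_LIMSEQ)
    show "incseq (\<lambda>n t. ennreal (\<psi> (z (real n) t)))"
      by (intro incseq_SucI le_funI ennreal_leI complementary_mono z0 z_mono) auto
    show "(\<lambda>n. ennreal (\<psi> (z (real n) t))) \<longlonglongrightarrow> ennreal (\<psi> (q t))" for t
    proof (rule tendsto_eventually)
      obtain N where N: "max t (q t) \<le> real N" using real_arch_simple by blast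
      show "eventually (\<lambda>n. ennreal (\<psi> (z (real n) t)) = ennreal (\<psi> (q t))) sequentially"
        using eventually_ge_at_top[of N]
      proof eventually_elim
        case (elim n)
        then have "t \<le> real n" "q t \<le> real n" using N by (auto intro: order_trans)
        then show ?case using pq(2)[of t] by (simp add: z_def min_absorb2 max_absorb2)
      qed
    qed
  qed measurable
  then have "eventually (\<lambda>n. 1 < (\<integral>\<^sup>+t. ennreal (\<psi> (z (real n) t)) \<partial>weight_measure)) sequentially"
    using gt by (rule order_tendstoD(1))
  then obtain n where "1 < (\<integral>\<^sup>+t. ennreal (\<psi> (z (real n) t)) \<partial>weight_measure)"
    by (auto simp: eventually_sequentially)
  then have n: "1 < g (real n)" by (simp add: g)
  \<comment> \<open>At \<open>T = 0\<close> the truncation differs from \<open>p\<close> at most for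
    \<open>t \<le> 0\<close>, which carries no weight.\<close>
  have "(\<integral>\<^sup>+t. ennreal (\<psi> (z 0 t)) \<partial>weight_measure) = (\<integral>\<^sup>+t. ennreal (\<psi> (p t)) \<partial>weight_measure)"
    using AE_weight_measure_pos pq by (intro nn_integral_cong_AE) (auto elim!: eventually_mono simp: z_def max_absorb1)
  then have "ennreal (g 0) \<le> ennreal 1" using le by (simp add: g)
  then have "g 0 \<le> 1" by (simp only: ennreal_le_iff[OF zero_le_one])
  then obtain T where "0 \<le> T" "g T = 1"
    using IVT'[of g 0 1 "real n"] n continuous_on_subset[OF cont, of "{0..real n}"] by auto
  then show ?thesis using g[of T] by (intro exI[of _ T]) (auto simp: z_def)
qed

text \<open>An ideal \<open>k\<close> would give \<open>slope (k * f)\<close> the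
  \<open>\<psi>\<close>-modular \<open>1\<close>, but the modular can jump across \<open>1\<close>.
  So two parameters \<open>k\<close> and \<open>l = k * (1 + e)\<close> bracket the jump, and a test
  function \<open>z\<close> between the two slopes has modular exactly \<open>1\<close>. Integrating
  \<open>young_reverse\<close> bounds \<open>\<rho>(k x) / k + 1 / l\<close> by the pairing of
  \<open>x\<close> with \<open>z\<close>, hence by \<open>1\<close>.\<close>

lemma amemiya_approx:
  assumes top: "cumulative top = top" and x: "x \<in> orlicz_lorentz_space \<phi> \<omega>"
    and norm: "sup_norm x \<le> 1" and e: "0 < e"
  shows "\<exists>k>0. 1 + modular \<phi> \<omega> (\<lambda>s. k * x s) \<le> ennreal (k * (1 + e))"
proof -
  note xm = space_measurable[OF x]
  define f where "f t = enn2real (rearrangement x t)" for t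
  have fm [measurable]: "f \<in> borel_measurable borel"
    unfolding f_def using rearrangement_measurable[OF xm] by measurable
  have f0: "0 \<le> f t" for t by (simp add: f_def)
  have fin: "rearrangement x t < top" if "0 < t" for t using rearrangement_finite[OF top x that] .
  have f_eq: "rearrangement x t = ennreal (f t)" if "0 < t" for t
    using fin[OF that] by (simp add: f_def)
  have f_anti: "f t \<le> f s" if "0 < s" "s \<le> t" for s t
    using rearrangement_antimono[OF that(2), of x] fin[of s] that by (simp add: f_def enn2real_mono)
  have modular_f: "modular \<phi> \<omega> (\<lambda>s. k * x s) = (\<integral>\<^sup>+t. ennreal (\<phi> (k * f t)) \<partial>weight_measure)" if "0 < k" for k
    unfolding f_def by (rule modular_enn2real[OF xm fin that])
  define m where "m k = (\<integral>\<^sup>+t. ennreal (\<psi> (slope (k * f t))) \<partial>weight_measure)" for k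
  show ?thesis
  proof (cases "\<exists>t>0. 0 < f t")
    case False
    then have "f t = 0" if "0 < t" for t using f0[of t] that by force
    then have "(\<integral>\<^sup>+t. ennreal (\<phi> (1 * f t)) \<partial>weight_measure) = (\<integral>\<^sup>+t. 0 \<partial>weight_measure)"
      using AE_weight_measure_pos by (intro nn_integral_cong_AE) (auto elim!: eventually_mono)
    then have "modular \<phi> \<omega> (\<lambda>s. 1 * x s) = 0" by (subst modular_f) auto
    then show ?thesis using e by (intro exI[of _ 1]) auto
  next
    case True
    then obtain t0 where t0: "0 < t0" "0 < f t0" by blast
    obtain L where L: "\<And>l. l \<ge> L \<Longrightarrow> 1 < m l"
      using slope_modular_large[OF top t0, of f] f_anti by (auto simp: m_def)
    obtain l where l: "l > 0" "modular \<phi> \<omega> (\<lambda>s. l * x s) < top"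
      using x by (auto simp: orlicz_lorentz_space_def)
    obtain k0 where k0: "0 < k0" "m k0 \<le> 1"
      using slope_modular_small[OF fm f0 l(1)] l unfolding modular_f[OF l(1)] m_def by blast
    obtain N where N: "L / k0 < (1 + e) ^ N" using real_arch_pow[of "1 + e" "L / k0"] e by auto
    \<comment> \<open>On the geometric grid of ratio \<open>1 + e\<close> the modular starts at most
      \<open>1\<close> and eventually exceeds \<open>1\<close>, so some step crosses; no
      monotonicity of \<open>m\<close> enters.\<close>
    have "\<exists>n. m (k0 * (1 + e) ^ n) \<le> 1 \<and> 1 < m (k0 * (1 + e) ^ Suc n)"
    proof (rule ccontr)
      assume no: "\<not> ?thesis"
      have "m (k0 * (1 + e) ^ n) \<le> 1" for n
      proof (induction n)
        case (Suc n)
        then show ?case using no by (meson not_le)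
      qed (use k0 in simp)
      moreover have "1 < m (k0 * (1 + e) ^ N)" using N k0 by (intro L) (simp add: field_simps)
      ultimately show False by (meson not_le)
    qed
    then obtain n where n: "m (k0 * (1 + e) ^ n) \<le> 1" "1 < m (k0 * (1 + e) ^ Suc n)" by blast
    define k l where "k = k0 * (1 + e) ^ n" and "l = k * (1 + e)"
    have k: "0 < k" "m k \<le> 1" using n k0 e by (auto simp: k_def)
    have "k * 1 < k * (1 + e)" using k e by (intro mult_strict_left_mono) auto
    then have l: "k < l" "1 < m l" using n by (auto simp: l_def k_def ac_simps)
    define p q where "p t = slope (k * f t)" and "q t = slope (l * f t)" for t
    have [measurable]: "p \<in> borel_measurable borel" "q \<in> borel_measurable borel"
      unfolding p_def q_def by measurable
    have pq: "0 \<le> p t" "p t \<le> q t" for t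
      using f0[of t] l by (auto simp: p_def q_def intro!: slope_mono mult_right_mono)
    obtain T where T: "0 \<le> T" "(\<integral>\<^sup>+t. ennreal (\<psi> (max (p t) (if t \<le> T then min T (q t) else 0))) \<partial>weight_measure) = 1"
      using interpolating_function[of p q] pq k(2) l(2) by (auto simp: m_def p_def q_def)
    define z where "z t = max (p t) (if t \<le> T then min T (q t) else 0)" for t
    have z_meas [measurable]: "z \<in> borel_measurable borel" unfolding z_def by measurable
    have z0: "0 \<le> z t" for t using pq(1)[of t] by (simp add: z_def)
    have "antimono_on {0<..} z"
    proof (rule monotone_onI)
      fix s t :: real assume st: "s \<in> {0<..}" "t \<in> {0<..}" "s \<le> t"
      then have "f t \<le> f s" using f_anti by auto
      then have "p t \<le> p s" "q t \<le> q s"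
        using k l by (auto simp: p_def q_def intro!: slope_mono mult_left_mono)
      then show "z t \<le> z s" using st T(1) pq[of s] pq[of t] by (auto simp: z_def)
    qed
    note z_eq = modular_antimono_eq[OF this z0 z_meas]
    have "modular \<psi> \<omega> z \<le> 1" using z_eq(2) T(2) by (simp add: z_def)
    then have "(\<integral>\<^sup>+t. rearrangement x t * rearrangement z t \<partial>weight_measure) \<le> 1"
      using order_trans[OF sup_norm_ge[OF xm z_eq(1)] norm] by blast
    also have "(\<integral>\<^sup>+t. rearrangement x t * rearrangement z t \<partial>weight_measure) = (\<integral>\<^sup>+t. ennreal (f t * z t) \<partial>weight_measure)"
    proof (intro nn_integral_cong_AE)
      show "AE t in weight_measure. rearrangement x t * rearrangement z t = ennreal (f t * z t)"
        using z_eq(3) AE_weight_measure_pos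
        by eventually_elim (use f_eq f0 z0 in \<open>simp add: ennreal_mult\<close>)
    qed
    finally have le1: "(\<integral>\<^sup>+t. ennreal (f t * z t) \<partial>weight_measure) \<le> 1" .
    have "(\<integral>\<^sup>+t. ennreal (1 / k) * ennreal (\<phi> (k * f t)) + ennreal (1 / l) * ennreal (\<psi> (z t)) \<partial>weight_measure)
        \<le> (\<integral>\<^sup>+t. ennreal (f t * z t) \<partial>weight_measure)"
    proof (intro nn_integral_mono)
      fix t
      have "\<phi> (k * f t) / k + \<psi> (z t) / l \<le> f t * z t"
        using k l f0[of t] pq[of t] pq(1)[of t] by (intro young_reverse) (auto simp: z_def p_def q_def)
      then have "ennreal (\<phi> (k * f t) / k + \<psi> (z t) / l) \<le> ennreal (f t * z t)" by (rule ennreal_leI)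
      then show "ennreal (1 / k) * ennreal (\<phi> (k * f t)) + ennreal (1 / l) * ennreal (\<psi> (z t)) \<le> ennreal (f t * z t)"
        using k l by (simp add: ennreal_mult'[symmetric])
    qed
    also have "(\<integral>\<^sup>+t. ennreal (1 / k) * ennreal (\<phi> (k * f t)) + ennreal (1 / l) * ennreal (\<psi> (z t)) \<partial>weight_measure)
        = ennreal (1 / k) * modular \<phi> \<omega> (\<lambda>s. k * x s) + ennreal (1 / l)"
      using T(2) unfolding modular_f[OF k(1)] z_def[symmetric]
      by (subst nn_integral_add) (auto simp: nn_integral_cmult)
    finally have main: "ennreal (1 / k) * modular \<phi> \<omega> (\<lambda>s. k * x s) + ennreal (1 / l) \<le> 1" using le1 by order
    obtain M where M: "0 \<le> M" "modular \<phi> \<omega> (\<lambda>s. k * x s) = ennreal M"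
      using main k by (cases "modular \<phi> \<omega> (\<lambda>s. k * x s)") (auto simp: ennreal_mult_top top_unique)
    have lpos: "0 < l" using k l by linarith
    have "ennreal (M / k + 1 / l) \<le> ennreal 1"
      using main M k lpos by (simp add: ennreal_mult'[symmetric] ennreal_plus[symmetric] del: ennreal_plus)
    then have "M / k + 1 / l \<le> 1" by (simp only: ennreal_le_iff[OF zero_le_one])
    \<comment> \<open>Clearing \<open>1 / l\<close> turns the bound into
      \<open>(l / k) * M + 1 \<le> l\<close>. Dropping the factor \<open>l / k \<ge> 1\<close>
      leaves \<open>1 + M \<le> k * (1 + e)\<close>.\<close>
    then have "l * (M / k + 1 / l) \<le> l * 1" using lpos by (intro mult_left_mono) auto
    moreover have "l * (M / k + 1 / l) = (l / k) * M + 1" using lpos by (simp add: distrib_left)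
    ultimately have "(l / k) * M + 1 \<le> l" by linarith
    moreover have "1 * M \<le> (l / k) * M" using M k l by (intro mult_right_mono) auto
    ultimately have "1 + M \<le> k * (1 + e)" by (simp add: l_def)
    then have "ennreal (1 + M) \<le> ennreal (k * (1 + e))" by (rule ennreal_leI)
    then show ?thesis using k M by (intro exI[of _ k]) (simp add: ennreal_plus)
  qed
qed

subsection \<open>Sufficiency\<close>

text \<open>A level set of infinite measure has infinite weight, and \<open>\<phi> (l * x s)\<close>
  stays above a positive constant on it, which would make every modular infinite.\<close>

lemma distribution_finite:
  assumes top: "cumulative top = top" and x: "x \<in> orlicz_lorentz_space \<phi> \<omega>" and \<alpha>: "0 < \<alpha>"
  shows "distribution_function x \<alpha> < top"
proof (rule ccontr)
  assume "\<not> ?thesis"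
  then have inf: "distribution_function x \<alpha> = top" by (simp add: less_top[symmetric])
  obtain l where l: "l > 0" "modular \<phi> \<omega> (\<lambda>s. l * x s) < top" "x \<in> borel_measurable half_line"
    using x by (auto simp: orlicz_lorentz_space_def)
  note [measurable] = l(3)
  have "top \<le> distribution_function (\<lambda>s. \<phi> (l * x s)) \<theta>" if "0 \<le> \<theta>" "\<theta> < \<phi> (l * \<alpha>)" for \<theta>
  proof -
    have "\<theta> < \<bar>\<phi> (l * x s)\<bar>" if "\<alpha> < \<bar>x s\<bar>" for s
    proof -
      have "\<phi> (l * \<alpha>) \<le> \<phi> (l * x s)" using that l \<alpha> by (intro mono_abs) (auto simp: abs_mult)
      then show ?thesis using \<open>\<theta> < \<phi> (l * \<alpha>)\<close> by simp
    qed
    then have "distribution_function x \<alpha> \<le> distribution_function (\<lambda>s. \<phi> (l * x s)) \<theta>"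
      unfolding distribution_function_def by (intro emeasure_mono superlevel_measurable) auto
    then show ?thesis using inf by simp
  qed
  then have "(\<integral>\<^sup>+\<theta>. top * indicator {0..<\<phi> (l * \<alpha>)} \<theta> \<partial>lborel) \<le> lorentz (\<lambda>s. \<phi> (l * x s))"
    unfolding lorentz_def using top
    by (intro nn_integral_mono) (auto split: split_indicator simp: top_unique)
  moreover have "(\<integral>\<^sup>+\<theta>. top * indicator {0..<\<phi> (l * \<alpha>)} \<theta> \<partial>lborel) = top"
    using pos[of "l * \<alpha>"] l \<alpha> by (subst nn_integral_cmult_indicator) (auto simp: ennreal_top_mult)
  ultimately show False using l(2) by (simp add: modular_eq_lorentz top_unique)
qed

text \<open>For levels between \<open>\<phi> (k * (\<alpha> / 2))\<close> and
  \<open>\<phi> (k * \<alpha>)\<close> the superlevel set of \<open>\<phi> (k * x s)\<close> has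
  measure between \<open>d0\<close> and \<open>d1\<close>, whatever \<open>k\<close> is, so
  \<open>cumulative_halving\<close> yields \<open>c1\<close> there. By convexity this range has
  length at least \<open>\<phi> (k * \<alpha>) / 2\<close>, and \<open>k \<ge> 1/2\<close> makes
  that at least \<open>\<phi> (\<alpha> / 2) / 2\<close>.\<close>

lemma splitting_gap:
  assumes top: "cumulative top = top" and x: "x \<in> orlicz_lorentz_space \<phi> \<omega>"
    and \<alpha>: "0 < \<alpha>" "0 < distribution_function x \<alpha>"
  shows "\<exists>c>0. \<forall>k\<ge>1/2. \<forall>E\<in>sets half_line.
    lorentz (\<lambda>s. \<phi> (k * x s) * indicator E s) + lorentz (\<lambda>s. \<phi> (k * x s) * (1 - indicator E s)) + ennreal c
      \<le> 2 * lorentz (\<lambda>s. \<phi> (k * x s))"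
proof -
  note xm [measurable] = space_measurable[OF x]
  obtain d0 where d0: "0 \<le> d0" "distribution_function x \<alpha> = ennreal d0"
    using distribution_finite[OF top x \<alpha>(1)] by (cases "distribution_function x \<alpha>") auto
  obtain d1 where d1: "0 \<le> d1" "distribution_function x (\<alpha> / 2) = ennreal d1"
    using distribution_finite[OF top x, of "\<alpha> / 2"] \<alpha> by (cases "distribution_function x (\<alpha> / 2)") auto
  have d0_pos: "0 < d0" using \<alpha> d0 by simp
  have "ennreal d0 \<le> ennreal d1"
    using distribution_function_antimono[OF xm, of "\<alpha> / 2" \<alpha>] \<alpha> d0 d1 by simp
  then have d01: "d0 \<le> d1" using d1 by simp
  define c1 where "c1 = d0 / 2 * \<omega> d1"
  have c1: "0 < c1" using d0_pos d01 weight_pos[OF top, of d1] by (simp add: c1_def)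
  define c where "c = c1 * (\<phi> (\<alpha> / 2) / 2)"
  have "0 < c" using c1 pos[of "\<alpha> / 2"] \<alpha> by (simp add: c_def)
  moreover have "lorentz (\<lambda>s. \<phi> (k * x s) * indicator E s) + lorentz (\<lambda>s. \<phi> (k * x s) * (1 - indicator E s)) + ennreal c
      \<le> 2 * lorentz (\<lambda>s. \<phi> (k * x s))" if k: "1/2 \<le> k" and E [measurable]: "E \<in> sets half_line" for k E
  proof -
    let ?u = "\<lambda>s. \<phi> (k * x s)"
    let ?v = "\<lambda>s. ?u s * indicator E s" and ?w = "\<lambda>s. ?u s * (1 - indicator E s)"
    have m: "?u \<in> borel_measurable half_line" "?v \<in> borel_measurable half_line" "?w \<in> borel_measurable half_line"
      by measurable
    note [measurable] = m[THEN cumulative_distribution_measurable]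
    define I where "I = {\<phi> (k * (\<alpha> / 2))..<\<phi> (k * \<alpha>)}"
    have half: "\<phi> (k * (\<alpha> / 2)) \<le> 1 / 2 * \<phi> (k * \<alpha>)" using scale_le[of "1/2" "k * \<alpha>"] by simp
    have I0: "0 \<le> \<theta>" if "\<theta> \<in> I" for \<theta> using that nonneg[of "k * (\<alpha> / 2)"] unfolding I_def by (auto intro: order_trans simp del: nonneg)
    \<comment> \<open>The two restrictions have disjoint supports, so for
      \<open>\<theta> \<ge> 0\<close> their superlevel sets partition that of the whole
      function.\<close>
    have split: "distribution_function ?u \<theta> = distribution_function ?v \<theta> + distribution_function ?w \<theta>" if "0 \<le> \<theta>" for \<theta>
    proof -
      let ?S = "\<lambda>v. {s \<in> space half_line. \<theta> < \<bar>v s\<bar>}"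
      have un: "?S ?u = ?S ?v \<union> ?S ?w" and disj: "?S ?v \<inter> ?S ?w = {}"
        using that by (auto split: split_indicator_asm)
      have S: "?S v \<in> sets half_line" if [measurable]: "v \<in> borel_measurable half_line" for v :: "real \<Rightarrow> real"
        by measurable
      show ?thesis
        unfolding distribution_function_eq un by (rule plus_emeasure[OF S[OF m(2)] S[OF m(3)] disj, symmetric])
    qed
    have le: "cumulative (distribution_function ?v \<theta>) + cumulative (distribution_function ?w \<theta>) + ennreal c1 * indicator I \<theta>
        \<le> 2 * cumulative (distribution_function ?u \<theta>)" if \<theta>: "0 \<le> \<theta>" for \<theta>
    proof (cases "\<theta> \<in> I")
      case True
      have "distribution_function ?u \<theta> \<le> distribution_function x (\<alpha> / 2)"
        unfolding distribution_function_def
      proof (intro emeasure_mono superlevel_measurable[OF xm] subsetI)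
        fix s assume s: "s \<in> {s \<in> {0..}. \<theta> < \<bar>\<phi> (k * x s)\<bar>}"
        have "\<not> \<bar>x s\<bar> \<le> \<alpha> / 2"
        proof
          assume "\<bar>x s\<bar> \<le> \<alpha> / 2"
          then have "\<phi> (k * x s) \<le> \<phi> (k * (\<alpha> / 2))"
            using k \<alpha> by (intro mono_abs) (auto simp: abs_mult intro!: mult_left_mono)
          then show False using s True by (auto simp: I_def)
        qed
        then show "s \<in> {s \<in> {0..}. \<alpha> / 2 < \<bar>x s\<bar>}" using s by auto
      qed
      moreover have "distribution_function x \<alpha> \<le> distribution_function ?u \<theta>"
        unfolding distribution_function_def
      proof (intro emeasure_mono superlevel_measurable[OF m(1)] subsetI)
        fix s assume s: "s \<in> {s \<in> {0..}. \<alpha> < \<bar>x s\<bar>}"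
        have "\<phi> (k * \<alpha>) \<le> \<phi> (k * x s)"
          using s k \<alpha> by (intro mono_abs) (auto simp: abs_mult intro!: mult_left_mono)
        then show "s \<in> {s \<in> {0..}. \<theta> < \<bar>\<phi> (k * x s)\<bar>}" using s True by (auto simp: I_def)
      qed
      ultimately have b: "ennreal d0 \<le> distribution_function ?v \<theta> + distribution_function ?w \<theta>"
          "distribution_function ?v \<theta> + distribution_function ?w \<theta> \<le> ennreal d1"
        using d0 d1 split[OF \<theta>] by auto
      have "distribution_function ?v \<theta> + distribution_function ?w \<theta> < top"
        by (rule order_le_less_trans[OF b(2)]) simp
      then obtain e1 e2 where e: "0 \<le> e1" "0 \<le> e2" "distribution_function ?v \<theta> = ennreal e1" "distribution_function ?w \<theta> = ennreal e2"
        by (cases "distribution_function ?v \<theta>"; cases "distribution_function ?w \<theta>") auto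
      have "d0 \<le> e1 + e2" "e1 + e2 \<le> d1"
        using b d0(1) d1(1) e(1,2) unfolding e(3,4)
        by (simp_all add: ennreal_plus[symmetric] del: ennreal_plus)
      from cumulative_halving[OF this d0_pos d1(1) e(1,2)] show ?thesis
        using True e split[OF \<theta>] by (simp add: c1_def ennreal_plus[symmetric] del: ennreal_plus)
    next
      case False
      have "distribution_function ?v \<theta> \<le> distribution_function ?u \<theta>"
           "distribution_function ?w \<theta> \<le> distribution_function ?u \<theta>"
        unfolding split[OF \<theta>] by auto
      then show ?thesis using False by (auto simp: mult_2 intro!: add_mono cumulative_mono)
    qed
    have "ennreal c \<le> ennreal (c1 * (\<phi> (k * \<alpha>) - \<phi> (k * (\<alpha> / 2))))"
    proof (rule ennreal_leI)
      have "\<phi> (\<alpha> / 2) \<le> \<phi> (k * \<alpha>)" using k \<alpha> mult_right_mono[of "1/2" k \<alpha>] by (intro mono_nonneg) auto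
      then show "c \<le> c1 * (\<phi> (k * \<alpha>) - \<phi> (k * (\<alpha> / 2)))"
        unfolding c_def using c1 half by (intro mult_left_mono) auto
    qed
    also have "\<dots> = (\<integral>\<^sup>+\<theta>. ennreal c1 * indicator I \<theta> \<partial>lborel)"
      using half nonneg[of "k * \<alpha>"] c1 unfolding I_def
      by (subst nn_integral_cmult_indicator) (auto simp: ennreal_mult'[symmetric] simp del: nonneg)
    finally have "lorentz ?v + lorentz ?w + ennreal c \<le> lorentz ?v + lorentz ?w + (\<integral>\<^sup>+\<theta>. ennreal c1 * indicator I \<theta> \<partial>lborel)"
      by (intro add_left_mono)
    also have "\<dots> = (\<integral>\<^sup>+\<theta>. cumulative (distribution_function ?v \<theta>) * indicator {0..} \<theta>
        + cumulative (distribution_function ?w \<theta>) * indicator {0..} \<theta> + ennreal c1 * indicator I \<theta> \<partial>lborel)"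
      unfolding lorentz_def by (simp add: nn_integral_add I_def)
    also have "\<dots> \<le> (\<integral>\<^sup>+\<theta>. 2 * (cumulative (distribution_function ?u \<theta>) * indicator {0..} \<theta>) \<partial>lborel)"
    proof (intro nn_integral_mono)
      fix \<theta>
      show "cumulative (distribution_function ?v \<theta>) * indicator {0..} \<theta>
        + cumulative (distribution_function ?w \<theta>) * indicator {0..} \<theta> + ennreal c1 * indicator I \<theta>
        \<le> 2 * (cumulative (distribution_function ?u \<theta>) * indicator {0..} \<theta>)"
        using le[of \<theta>] I0[of \<theta>] by (cases "0 \<le> \<theta>"; cases "\<theta> \<in> I") auto
    qed
    also have "\<dots> = 2 * lorentz ?u"
      unfolding lorentz_def by (rule nn_integral_cmult) measurable
    finally show ?thesis .
  qed
  ultimately show ?thesis by blast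
qed

text \<open>The gain cannot be subtracted after applying a merely subadditive functional. It is
  absorbed before: the majorant is \<open>b * \<phi> (y s) + (a - q) * \<phi> (x s)\<close> plus
  \<open>q * \<phi> (x s)\<close> off \<open>E\<close>, with nonnegative coefficients because
  \<open>q \<le> a\<close>; the missing \<open>q\<close> is then added to both sides.\<close>

lemma difference_bound:
  assumes x: "x \<in> borel_measurable half_line" and y: "y \<in> borel_measurable half_line"
    and E: "E \<in> sets half_line" "\<And>s. s \<in> E \<Longrightarrow> 0 \<le> x s * y s"
    and c: "1 < c" "\<And>u. 2 * c * \<phi> (u / c) \<le> \<phi> u"
    and \<kappa>: "\<kappa> = min (1/2) (1 / (2 * (c - 1)))"
    and ab: "0 \<le> a" "0 \<le> b" "a + b = 1"
  shows "lorentz (\<lambda>s. \<phi> (a * x s - b * y s)) + ennreal (\<kappa> * a * b) * lorentz (\<lambda>s. \<phi> (x s))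
    \<le> ennreal a * lorentz (\<lambda>s. \<phi> (x s)) + ennreal b * lorentz (\<lambda>s. \<phi> (y s))
      + ennreal (\<kappa> * a * b) * lorentz (\<lambda>s. \<phi> (x s) * (1 - indicator E s))"
proof -
  note [measurable] = x y E(1)
  define q where "q = \<kappa> * a * b"
  have \<kappa>0: "0 \<le> \<kappa>" "\<kappa> \<le> 1" using c by (auto simp: \<kappa>)
  have q: "0 \<le> q" "q \<le> a"
  proof -
    show "0 \<le> q" using \<kappa>0 ab by (simp add: q_def)
    have "\<kappa> * (a * b) \<le> 1 * (a * 1)" using \<kappa>0 ab by (intro mult_mono) auto
    then show "q \<le> a" by (simp add: q_def mult.assoc)
  qed
  \<comment> \<open>For equal signs the difference is at most the larger of the two terms in
    modulus. If that is the \<open>X\<close> term, \<open>convexity_gap\<close> supplies the gain;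
    if it is the \<open>Y\<close> term, all of \<open>a * \<phi> X\<close> is saved, and this
    exceeds \<open>q * \<phi> X\<close>.\<close>
  have pointwise: "\<phi> (a * X - b * Y) \<le> b * \<phi> Y + a * \<phi> X - (if 0 \<le> X * Y then q * \<phi> X else 0)" for X Y
  proof (cases "0 \<le> X * Y")
    case True
    have "\<bar>a * X - b * Y\<bar> \<le> max \<bar>a * X\<bar> \<bar>b * Y\<bar>"
    proof -
      have "0 \<le> (a * X) * (b * Y)" using mult_nonneg_nonneg[OF mult_nonneg_nonneg[OF ab(1,2)] True] by (simp add: ac_simps)
      moreover have "\<bar>p - r\<bar> \<le> max \<bar>p\<bar> \<bar>r\<bar>" if "0 \<le> p * r" for p r :: real
        using that by (auto simp: zero_le_mult_iff)
      ultimately show ?thesis by blast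
    qed
    then have "\<phi> (a * X - b * Y) \<le> max (\<phi> (a * X)) (\<phi> (b * Y))"
      using mono_abs[of "a * X - b * Y" "a * X"] mono_abs[of "a * X - b * Y" "b * Y"] by linarith
    moreover have "\<phi> (a * X) + q * \<phi> X \<le> a * \<phi> X"
      using convexity_gap[OF c, of a X] ab by (simp add: q_def \<kappa> eq_diff_eq[symmetric] ac_simps)
    moreover have "\<phi> (b * Y) \<le> b * \<phi> Y" using ab by (intro scale_le) auto
    moreover have "q * \<phi> X \<le> a * \<phi> X" using q by (intro mult_right_mono) auto
    moreover have "0 \<le> b * \<phi> Y" using ab by simp
    ultimately show ?thesis using True by simp
  next
    case False
    have "\<phi> ((1 - b) *\<^sub>R X + b *\<^sub>R (- Y)) \<le> (1 - b) * \<phi> X + b * \<phi> (- Y)"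
      using ab by (intro convex_onD[OF convex]) auto
    moreover have "1 - b = a" using ab by simp
    ultimately show ?thesis using False by simp
  qed
  let ?u = "\<lambda>s. \<phi> (x s)" and ?v = "\<lambda>s. \<phi> (y s)" and ?w = "\<lambda>s. \<phi> (x s) * (1 - indicator E s)"
  have "lorentz (\<lambda>s. \<phi> (a * x s - b * y s)) \<le> lorentz (\<lambda>s. b * ?v s + ((a - q) * ?u s + q * ?w s))"
  proof (rule lorentz_mono)
    fix s :: real
    have "\<phi> (a * x s - b * y s) \<le> b * ?v s + ((a - q) * ?u s + q * ?w s)"
      using pointwise[of "x s" "y s"] E(2)[of s] mult_nonneg_nonneg[OF q(1) nonneg[of "x s"]]
      by (cases "s \<in> E"; cases "0 \<le> x s * y s") (auto simp: algebra_simps intro: order_trans)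
    moreover have "0 \<le> \<phi> (a * x s - b * y s)" by simp
    ultimately show "\<bar>\<phi> (a * x s - b * y s)\<bar> \<le> \<bar>b * ?v s + ((a - q) * ?u s + q * ?w s)\<bar>" by linarith
  qed measurable
  also have "\<dots> \<le> lorentz (\<lambda>s. b * ?v s) + lorentz (\<lambda>s. (a - q) * ?u s + q * ?w s)"
    by (intro lorentz_add_le) measurable
  also have "\<dots> \<le> lorentz (\<lambda>s. b * ?v s) + (lorentz (\<lambda>s. (a - q) * ?u s) + lorentz (\<lambda>s. q * ?w s))"
    by (intro add_left_mono lorentz_add_le) measurable
  also have "\<dots> = ennreal b * lorentz ?v + (ennreal (a - q) * lorentz ?u + ennreal q * lorentz ?w)"
    using ab q by (subst (1 2 3) lorentz_cmult) auto
  finally have "lorentz (\<lambda>s. \<phi> (a * x s - b * y s)) + ennreal q * lorentz ?u \<le>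
      ennreal b * lorentz ?v + (ennreal (a - q) * lorentz ?u + ennreal q * lorentz ?w) + ennreal q * lorentz ?u"
    by (intro add_right_mono)
  also have "\<dots> = (ennreal (a - q) + ennreal q) * lorentz ?u + ennreal b * lorentz ?v + ennreal q * lorentz ?w"
    by (simp add: distrib_right distrib_left ac_simps)
  also have "ennreal (a - q) + ennreal q = ennreal a"
    using q by (simp add: ennreal_plus[symmetric] del: ennreal_plus)
  finally show ?thesis by (simp add: q_def)
qed

text \<open>\<open>difference_bound\<close> is applied to \<open>y\<close> with the set of equal
  signs and to \<open>- y\<close> with its complement. The gains add to
  \<open>q * (2 * A - D - D')\<close>, and the hypothesis on \<open>g\<close> bounds this below by
  \<open>q * g\<close>.\<close>

lemma half_sum_bound:
  assumes x: "x \<in> borel_measurable half_line" and y: "y \<in> borel_measurable half_line"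
    and k: "0 < k" and l: "0 < l"
    and A: "0 \<le> A" "modular \<phi> \<omega> (\<lambda>s. k * x s) = ennreal A"
    and B: "0 \<le> B" "modular \<phi> \<omega> (\<lambda>s. l * y s) = ennreal B"
    and c: "1 < c" "\<And>u. 2 * c * \<phi> (u / c) \<le> \<phi> u"
    and \<kappa>: "\<kappa> = min (1/2) (1 / (2 * (c - 1)))"
    and g: "0 \<le> g" "\<And>E. E \<in> sets half_line \<Longrightarrow>
      lorentz (\<lambda>s. \<phi> (k * x s) * indicator E s) + lorentz (\<lambda>s. \<phi> (k * x s) * (1 - indicator E s)) + ennreal g
      \<le> 2 * lorentz (\<lambda>s. \<phi> (k * x s))"
  shows "orlicz_norm \<phi> \<omega> (\<lambda>s. (x s - y s) / 2) + orlicz_norm \<phi> \<omega> (\<lambda>s. (x s + y s) / 2)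
    \<le> (1 + A) / k + (1 + B) / l - \<kappa> * g / (2 * (k + l))"
proof -
  note [measurable] = x y
  define a b where "a = l / (k + l)" and "b = k / (k + l)"
  have ab: "0 \<le> a" "0 \<le> b" "a + b = 1" using k l by (auto simp: a_def b_def add_divide_distrib[symmetric])
  define q where "q = \<kappa> * a * b"
  have q: "0 \<le> q" using c ab by (simp add: q_def \<kappa>)
  define E where "E = {s \<in> space half_line. 0 \<le> x s * y s}"
  have E: "E \<in> sets half_line" unfolding E_def by measurable
  then have E': "space half_line - E \<in> sets half_line" by auto
  let ?u = "\<lambda>s. \<phi> (k * x s)"
  have LA: "lorentz ?u = ennreal A" using A by (simp add: modular_eq_lorentz)
  have LB: "lorentz (\<lambda>s. \<phi> (l * y s)) = ennreal B" using B by (simp add: modular_eq_lorentz)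
  have cong: "lorentz (\<lambda>s. ?u s * (1 - indicator (space half_line - E) s)) \<le> lorentz (\<lambda>s. ?u s * indicator E s)"
    using E by (intro lorentz_mono) (auto split: split_indicator)
  obtain D where D: "0 \<le> D" "lorentz (\<lambda>s. ?u s * (1 - indicator E s)) = ennreal D"
    using g(2)[OF E] LA by (cases "lorentz (\<lambda>s. ?u s * (1 - indicator E s))")
      (auto simp: top_unique ennreal_mult_eq_top_iff)
  obtain D' where D': "0 \<le> D'" "lorentz (\<lambda>s. ?u s * indicator E s) = ennreal D'"
    using g(2)[OF E] LA by (cases "lorentz (\<lambda>s. ?u s * indicator E s)")
      (auto simp: top_unique ennreal_mult_eq_top_iff)
  have gap: "D' + D + g \<le> 2 * A"
    using g(2)[OF E] g(1) D D' A unfolding LA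
    by (simp add: numeral_mult_ennreal ennreal_plus[symmetric] del: ennreal_plus)
  have bound: "\<exists>P. 0 \<le> P \<and> lorentz (\<lambda>s. \<phi> (a * (k * x s) - b * (l * z s))) = ennreal P \<and> P + q * A \<le> a * A + b * B + q * R"
    if z: "z \<in> borel_measurable half_line" "lorentz (\<lambda>s. \<phi> (l * z s)) = ennreal B"
      and F: "F \<in> sets half_line" "\<And>s. s \<in> F \<Longrightarrow> 0 \<le> x s * z s"
      and R: "0 \<le> R" "lorentz (\<lambda>s. ?u s * (1 - indicator F s)) \<le> ennreal R" for z F R
  proof -
    note [measurable] = z(1)
    have F2: "0 \<le> (k * x s) * (l * z s)" if "s \<in> F" for s
      using mult_nonneg_nonneg[OF _ F(2)[OF that], of "k * l"] k l by (simp add: ac_simps)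
    have "lorentz (\<lambda>s. \<phi> (a * (k * x s) - b * (l * z s))) + ennreal q * lorentz ?u
      \<le> ennreal a * lorentz ?u + ennreal b * lorentz (\<lambda>s. \<phi> (l * z s))
        + ennreal q * lorentz (\<lambda>s. ?u s * (1 - indicator F s))"
      unfolding q_def by (intro difference_bound[OF _ _ F(1) F2 c \<kappa> ab]) measurable
    also have "\<dots> \<le> ennreal a * ennreal A + ennreal b * ennreal B + ennreal q * ennreal R"
      unfolding LA z(2) using R by (intro add_left_mono mult_left_mono) auto
    also have "\<dots> = ennreal (a * A + b * B + q * R)"
      using A B R ab q by (simp add: ennreal_mult'[symmetric] ennreal_plus[symmetric] del: ennreal_plus)
    finally have *: "lorentz (\<lambda>s. \<phi> (a * (k * x s) - b * (l * z s))) + ennreal q * ennreal A \<le> ennreal (a * A + b * B + q * R)"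
      unfolding LA .
    then obtain P where P: "0 \<le> P" "lorentz (\<lambda>s. \<phi> (a * (k * x s) - b * (l * z s))) = ennreal P"
      by (cases "lorentz (\<lambda>s. \<phi> (a * (k * x s) - b * (l * z s)))") (auto simp: top_unique)
    have "ennreal (P + q * A) \<le> ennreal (a * A + b * B + q * R)"
      using * P A q by (simp add: ennreal_mult'[symmetric] ennreal_plus[symmetric] del: ennreal_plus)
    then have "P + q * A \<le> a * A + b * B + q * R" using A B R ab q by (subst (asm) ennreal_le_iff) auto
    then show ?thesis using P by blast
  qed
  obtain P where P: "0 \<le> P" "lorentz (\<lambda>s. \<phi> (a * (k * x s) - b * (l * y s))) = ennreal P" "P + q * A \<le> a * A + b * B + q * D"
    using bound[OF y LB E _ D(1)] D(2) by (auto simp: E_def)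
  obtain Q where Q: "0 \<le> Q" "lorentz (\<lambda>s. \<phi> (a * (k * x s) - b * (l * (- y s)))) = ennreal Q" "Q + q * A \<le> a * A + b * B + q * D'"
  proof -
    have "0 \<le> x s * - y s" if "s \<in> space half_line - E" for s using that by (auto simp: E_def)
    then show ?thesis
      using bound[of "\<lambda>s. - y s" "space half_line - E" D'] LB E' D' cong that by auto
  qed
  \<comment> \<open>At this Amemiya parameter \<open>h * (x s - z s) / 2\<close> is exactly the
    convex combination \<open>a * (k * x s) - b * (l * z s)\<close>, and
    \<open>2 * a / h = 1 / k\<close>, \<open>2 * b / h = 1 / l\<close>.\<close>
  define h where "h = 2 * (k * l / (k + l))"
  have h: "0 < h" using k l by (simp add: h_def)
  have norm_le: "orlicz_norm \<phi> \<omega> (\<lambda>s. (x s - z s) / 2) \<le> (1 + R) / h"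
    if z: "z \<in> borel_measurable half_line" and R: "0 \<le> R" "lorentz (\<lambda>s. \<phi> (a * (k * x s) - b * (l * z s))) = ennreal R" for z R
  proof -
    note [measurable] = z
    have eq: "h * ((x s - z s) / 2) = a * (k * x s) - b * (l * z s)" for s
      using k l by (simp add: h_def a_def b_def divide_simps) (simp add: algebra_simps)
    have "sup_norm (\<lambda>s. (x s - z s) / 2) \<le> ennreal (1 / h) * (1 + modular \<phi> \<omega> (\<lambda>s. h * ((x s - z s) / 2)))"
      using h by (intro amemiya_le) measurable
    also have "modular \<phi> \<omega> (\<lambda>s. h * ((x s - z s) / 2)) = ennreal R"
      unfolding eq using R by (subst modular_eq_lorentz) auto
    also have "ennreal (1 / h) * (1 + ennreal R) = ennreal ((1 + R) / h)"
      using h R by (simp add: ennreal_mult'[symmetric] ennreal_plus[symmetric] ennreal_1[symmetric] del: ennreal_plus ennreal_1)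
    finally show ?thesis unfolding orlicz_norm_eq using h R by (intro enn2real_leI) auto
  qed
  have "orlicz_norm \<phi> \<omega> (\<lambda>s. (x s - y s) / 2) + orlicz_norm \<phi> \<omega> (\<lambda>s. (x s + y s) / 2) \<le> (1 + P) / h + (1 + Q) / h"
    using norm_le[OF y P(1,2)] norm_le[of "\<lambda>s. - y s", OF _ Q(1,2)] by simp
  also have "\<dots> = (2 + (P + Q)) / h" by (simp add: add_divide_distrib)
  also have "\<dots> \<le> (2 * a * (1 + A) + 2 * b * (1 + B) - q * g) / h"
  proof (rule divide_right_mono)
    have "q * (D' + D + g) \<le> q * (2 * A)" using gap q by (rule mult_left_mono)
    then have "P + Q \<le> 2 * (a * A) + 2 * (b * B) - q * g" using P(3) Q(3) by (simp add: algebra_simps)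
    moreover have "2 * a * (1 + A) + 2 * b * (1 + B) = 2 * (a + b) + 2 * (a * A) + 2 * (b * B)" by (simp add: algebra_simps)
    ultimately show "2 + (P + Q) \<le> 2 * a * (1 + A) + 2 * b * (1 + B) - q * g" using ab by simp
  qed (use h in simp)
  also have "\<dots> = (2 * a / h) * (1 + A) + (2 * b / h) * (1 + B) - (q / h) * g"
    by (simp add: add_divide_distrib diff_divide_distrib)
  also have "2 * a / h = 1 / k" using k l by (simp add: a_def h_def)
  also have "2 * b / h = 1 / l" using k l by (simp add: b_def h_def)
  also have "q / h = \<kappa> / (2 * (k + l))" using k l by (simp add: q_def a_def b_def h_def)
  finally show ?thesis by simp
qed

text \<open>Used to compare Amemiya values at \<open>k\<close> and at \<open>k / c\<close>: dividing
  the parameter by \<open>c\<close> multiplies \<open>1 / k\<close> by \<open>c\<close> but divides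
  the modular by at least \<open>2 * c\<close>, so the modular part of the value is at least
  halved.\<close>

lemma nabla2_modular:
  assumes x: "x \<in> borel_measurable half_line" and c: "1 < c" "\<And>u. 2 * c * \<phi> (u / c) \<le> \<phi> u"
    and k: "modular \<phi> \<omega> (\<lambda>s. k * x s) = ennreal A" "0 \<le> A"
  shows "\<exists>B\<ge>0. modular \<phi> \<omega> (\<lambda>s. k / c * x s) = ennreal B \<and> 2 * c * B \<le> A"
proof -
  note [measurable] = x
  have "modular \<phi> \<omega> (\<lambda>s. k / c * x s) = lorentz (\<lambda>s. \<phi> (k / c * x s))" by (intro modular_eq_lorentz) measurable
  also have "\<dots> \<le> lorentz (\<lambda>s. 1 / (2 * c) * \<phi> (k * x s))"
    using c(1) c(2)[of "k * x s" for s] by (intro lorentz_mono) (auto simp: field_simps)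
  also have "\<dots> = ennreal (1 / (2 * c)) * modular \<phi> \<omega> (\<lambda>s. k * x s)"
    using c(1) by (subst lorentz_cmult) (auto simp: modular_eq_lorentz)
  also have "\<dots> = ennreal (A / (2 * c))" using k c by (simp add: ennreal_mult'[symmetric])
  finally have *: "modular \<phi> \<omega> (\<lambda>s. k / c * x s) \<le> ennreal (A / (2 * c))" .
  then obtain B where B: "0 \<le> B" "modular \<phi> \<omega> (\<lambda>s. k / c * x s) = ennreal B"
    by (cases "modular \<phi> \<omega> (\<lambda>s. k / c * x s)") (auto simp: top_unique)
  then have "B \<le> A / (2 * c)" using * k c by (simp add: ennreal_le_iff)
  then show ?thesis using B c by (intro exI[of _ B]) (auto simp: field_simps)
qed

lemma positive_distribution:
  assumes x: "x \<in> borel_measurable half_line" and norm: "0 < sup_norm x"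
  shows "\<exists>\<alpha>>0. 0 < distribution_function x \<alpha>"
proof (rule ccontr)
  assume "\<not> ?thesis"
  then have d0: "distribution_function x \<alpha> = 0" if "0 < \<alpha>" for \<alpha>
    using that by (auto simp: zero_less_iff_neq_zero)
  have "rearrangement x t \<le> 0 + ennreal e" if "0 < e" for t e
    using less_rearrangement_iff[OF x, of e t] d0[OF that] that by (simp add: not_less[symmetric])
  then have "rearrangement x t \<le> 0" for t by (intro ennreal_le_epsilon[of 0 "rearrangement x t"])
  then have "rearrangement x t = 0" for t by simp
  then have "sup_norm x \<le> 0" unfolding sup_norm_def by (intro SUP_least) simp
  then show False using norm by simp
qed

lemma locally_uniformly_non_square_if:
  assumes D2: "Delta2 \<psi>" and top: "cumulative top = top"
  shows "locally_uniformly_non_square (orlicz_lorentz_space \<phi> \<omega>) (orlicz_norm \<phi> \<omega>)"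
  unfolding locally_uniformly_non_square_def
proof (intro ballI impI)
  fix x assume x: "x \<in> orlicz_lorentz_space \<phi> \<omega>" "orlicz_norm \<phi> \<omega> x = 1"
  note xm = space_measurable[OF x(1)]
  have sx: "sup_norm x = 1" using ennreal_orlicz_norm[OF x(1)] x(2) by simp
  obtain c where c: "1 < c" "\<And>u. 2 * c * \<phi> (u / c) \<le> \<phi> u" using nabla2[OF D2] by blast
  define \<kappa> where \<kappa>: "\<kappa> = min (1/2) (1 / (2 * (c - 1)))"
  have \<kappa>0: "0 < \<kappa>" using c by (simp add: \<kappa>)
  obtain \<alpha> where \<alpha>: "0 < \<alpha>" "0 < distribution_function x \<alpha>"
    using positive_distribution[OF xm] sx by auto
  obtain g where g: "0 < g" "\<And>k E. 1/2 \<le> k \<Longrightarrow> E \<in> sets half_line \<Longrightarrow>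
      lorentz (\<lambda>s. \<phi> (k * x s) * indicator E s) + lorentz (\<lambda>s. \<phi> (k * x s) * (1 - indicator E s)) + ennreal g
      \<le> 2 * lorentz (\<lambda>s. \<phi> (k * x s))"
    using splitting_gap[OF top x(1) \<alpha>] by blast
  \<comment> \<open>With \<open>k \<le> 4 * c\<close> and \<open>l \<le> 8 * c\<close> one has
    \<open>2 * (k + l) \<le> 24 * c\<close>, so the gain is at least \<open>4 * \<eta>\<close>. The
    two approximation errors cost at most \<open>2 * e \<le> 2 * \<eta>\<close>, leaving
    \<open>2 * \<eta>\<close> in the sum of the norms and \<open>\<eta>\<close> in the
    minimum.\<close>
  define \<eta> where "\<eta> = \<kappa> * g / (96 * c)"
  have \<eta>: "0 < \<eta>" using \<kappa>0 g c by (simp add: \<eta>_def)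
  define e where "e = min (1/16) \<eta>"
  have e: "0 < e" "e \<le> 1/16" "e \<le> \<eta>" using \<eta> by (auto simp: e_def)
  have approx: "\<exists>k A. 0 < k \<and> 0 \<le> A \<and> modular \<phi> \<omega> (\<lambda>s. k * z s) = ennreal A \<and> 1 + A \<le> k * (1 + e)"
    if z: "z \<in> orlicz_lorentz_space \<phi> \<omega>" "sup_norm z \<le> 1" for z
  proof -
    obtain k where k: "0 < k" "1 + modular \<phi> \<omega> (\<lambda>s. k * z s) \<le> ennreal (k * (1 + e))"
      using amemiya_approx[OF top z e(1)] by blast
    obtain A where A: "0 \<le> A" "modular \<phi> \<omega> (\<lambda>s. k * z s) = ennreal A"
      using k(2) by (cases "modular \<phi> \<omega> (\<lambda>s. k * z s)") (auto simp: top_unique)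
    have "ennreal (1 + A) \<le> ennreal (k * (1 + e))" using k(2) A by (simp add: ennreal_plus)
    then have "1 + A \<le> k * (1 + e)" using k e by (subst (asm) ennreal_le_iff) auto
    then show ?thesis using k A by blast
  qed
  obtain k A where k: "0 < k" "0 \<le> A" "modular \<phi> \<omega> (\<lambda>s. k * x s) = ennreal A" "1 + A \<le> k * (1 + e)"
    using approx[OF x(1)] sx by auto
  have k_half: "1/2 \<le> k"
  proof -
    have "k * (1 + e) \<le> k * 2" using k e by (intro mult_left_mono) auto
    then show ?thesis using k by linarith
  qed
  \<comment> \<open>Since the norm of \<open>x\<close> is not below \<open>1\<close>, the Amemiya
    value at \<open>k / c\<close> is at least \<open>1\<close>. Its modular part is at most about
    one half, so \<open>c / k\<close> cannot be small.\<close>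
  have k_le: "k \<le> 4 * c"
  proof -
    obtain A' where A': "0 \<le> A'" "modular \<phi> \<omega> (\<lambda>s. k / c * x s) = ennreal A'" "2 * c * A' \<le> A"
      using nabla2_modular[OF xm c k(3,2)] by blast
    have "ennreal 1 \<le> ennreal (1 / (k / c)) * (1 + ennreal A')"
      using amemiya_le[OF xm, of "k / c"] sx A' k c by simp
    also have "\<dots> = ennreal (c / k * (1 + A'))"
      using k c A' by (simp add: ennreal_mult'[symmetric] ennreal_plus[symmetric] ennreal_1[symmetric] del: ennreal_plus ennreal_1)
    finally have "1 \<le> c / k * (1 + A')" using k c A' by (subst (asm) ennreal_le_iff) auto
    then have "k \<le> c * (1 + A')" using k by (simp add: field_simps)
    then have "2 * k \<le> 2 * c + A" using A'(3) by (simp add: algebra_simps)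
    then have "2 * k \<le> 2 * c + k * (1 + e)" using k by linarith
    also have "k * (1 + e) \<le> k * (3/2)" using k e by (intro mult_left_mono) auto
    finally show ?thesis by simp
  qed
  have kA: "(1 + A) / k \<le> 1 + e" using k by (simp add: field_simps)
  define \<delta> where "\<delta> = min (1/8) \<eta>"
  have \<delta>: "\<delta> \<in> {0<..<1}" using \<eta> by (auto simp: \<delta>_def)
  have "min (orlicz_norm \<phi> \<omega> (\<lambda>s. (x s - y s) / 2)) (orlicz_norm \<phi> \<omega> (\<lambda>s. (x s + y s) / 2)) \<le> 1 - \<delta>"
    if y: "y \<in> orlicz_lorentz_space \<phi> \<omega>" "orlicz_norm \<phi> \<omega> y \<le> 1" for y
  proof -
    note ym = space_measurable[OF y(1)]
    have "sup_norm y \<le> 1" using ennreal_orlicz_norm[OF y(1)] y(2) ennreal_leI[OF y(2)] by simp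
    then obtain l B where l: "0 < l" "0 \<le> B" "modular \<phi> \<omega> (\<lambda>s. l * y s) = ennreal B" "1 + B \<le> l * (1 + e)"
      using approx[OF y(1)] by blast
    show ?thesis
    proof (cases "l \<le> 8 * c")
      case True
      have sum_le: "orlicz_norm \<phi> \<omega> (\<lambda>s. (x s - y s) / 2) + orlicz_norm \<phi> \<omega> (\<lambda>s. (x s + y s) / 2)
          \<le> (1 + A) / k + (1 + B) / l - \<kappa> * g / (2 * (k + l))"
        by (rule half_sum_bound[OF xm ym k(1) l(1) k(2,3) l(2,3) c \<kappa> less_imp_le[OF g(1)]])
           (rule g(2)[OF k_half])
      have lB: "(1 + B) / l \<le> 1 + e" using l by (simp add: field_simps)
      have "\<kappa> * g / (24 * c) \<le> \<kappa> * g / (2 * (k + l))"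
        using \<kappa>0 g k l k_le True by (intro divide_left_mono mult_pos_pos) auto
      then have "4 * \<eta> \<le> \<kappa> * g / (2 * (k + l))" by (simp add: \<eta>_def)
      moreover have "S \<le> 2 - 2 * \<eta>"
        if "S \<le> p + r - G" "p \<le> 1 + e" "r \<le> 1 + e" "4 * \<eta> \<le> G" for S p r G
        using that e by linarith
      ultimately have "orlicz_norm \<phi> \<omega> (\<lambda>s. (x s - y s) / 2) + orlicz_norm \<phi> \<omega> (\<lambda>s. (x s + y s) / 2)
          \<le> 2 - 2 * \<eta>"
        using sum_le kA lB by blast
      then show ?thesis by (auto simp: \<delta>_def min_def)
    next
      \<comment> \<open>The norm of \<open>y\<close> has no lower bound, so \<open>l\<close> may be
        arbitrarily large. Then the parameter \<open>l / c\<close> already gives \<open>y\<close> an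
        Amemiya value near \<open>5/8\<close>; the gain is discarded, the sum is at most
        \<open>7/4\<close>, and the minimum at most \<open>7/8\<close>, whence the
        \<open>1/8\<close> in \<open>\<delta>\<close>.\<close>
      case False
      obtain B' where B': "0 \<le> B'" "modular \<phi> \<omega> (\<lambda>s. l / c * y s) = ennreal B'" "2 * c * B' \<le> B"
        using nabla2_modular[OF ym c l(3,2)] by blast
      have lc: "0 < l / c" using l c by simp
      have "(1 + B') / (l / c) = (c + c * B') / l" by (simp add: distrib_left distrib_right mult.commute)
      also have "\<dots> \<le> (l / 8 + l * (1 + e) / 2) / l"
        using False B'(3) l by (intro divide_right_mono) auto
      also have "\<dots> = 1/8 + (1 + e) / 2" using l by (simp add: add_divide_distrib)
      finally have lB: "(1 + B') / (l / c) \<le> 1/8 + (1 + e) / 2" .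
      have sum_le: "orlicz_norm \<phi> \<omega> (\<lambda>s. (x s - y s) / 2) + orlicz_norm \<phi> \<omega> (\<lambda>s. (x s + y s) / 2)
          \<le> (1 + A) / k + (1 + B') / (l / c) - \<kappa> * g / (2 * (k + l / c))"
        by (rule half_sum_bound[OF xm ym k(1) lc k(2,3) B'(1,2) c \<kappa> less_imp_le[OF g(1)]])
           (rule g(2)[OF k_half])
      have "0 \<le> \<kappa> * g / (2 * (k + l / c))" using \<kappa>0 g k lc by auto
      moreover have "S \<le> 7/4"
        if "S \<le> p + r - G" "p \<le> 1 + e" "r \<le> 1/8 + (1 + e) / 2" "0 \<le> G" for S p r G
        using that e by (simp add: add_divide_distrib)
      ultimately have "orlicz_norm \<phi> \<omega> (\<lambda>s. (x s - y s) / 2) + orlicz_norm \<phi> \<omega> (\<lambda>s. (x s + y s) / 2)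
          \<le> 7/4"
        using sum_le kA lB by blast
      then show ?thesis by (auto simp: \<delta>_def min_def)
    qed
  qed
  then show "\<exists>\<delta>\<in>{0<..<1}. \<forall>y\<in>orlicz_lorentz_space \<phi> \<omega>. orlicz_norm \<phi> \<omega> y \<le> 1 \<longrightarrow>
      min (orlicz_norm \<phi> \<omega> (\<lambda>s. (x s - y s) / 2)) (orlicz_norm \<phi> \<omega> (\<lambda>s. (x s + y s) / 2)) \<le> 1 - \<delta>"
    using \<delta> by blast
qed

end

subsection \<open>Necessity\<close>

lemma emeasure_half_line_top: "emeasure lebesgue {0::real..} = top"
  using emeasure_initial_interval(2)[of top] by (simp add: atLeast_def)

lemma emeasure_alternate_intervals:
  "emeasure lebesgue (\<Union>n. {2 * real n + r ..< 2 * real n + r + 1}) = top"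
proof -
  let ?A = "\<lambda>n. {2 * real n + r ..< 2 * real n + r + 1}"
  have "disjoint_family ?A"
    unfolding disjoint_family_on_def
  proof (intro ballI impI)
    fix m n :: nat assume "m \<noteq> n"
    then have "2 * real m + 2 \<le> 2 * real n \<or> 2 * real n + 2 \<le> 2 * real m" by linarith
    then show "?A m \<inter> ?A n = {}" by auto
  qed
  then have "emeasure lebesgue (\<Union>n. ?A n) = (\<Sum>n. emeasure lebesgue (?A n))"
    by (intro suminf_emeasure[symmetric]) auto
  also have "\<dots> = (\<Sum>n::nat. 1 :: ennreal)" by simp
  also have "\<dots> = top" by (simp add: suminf_eq_SUP ennreal_SUP_of_nat_eq_top)
  finally show ?thesis .
qed

section \<open>Values of the primitive and integrals of two-level functions\<close>

context weight
begin

lemma emeasure_weight_measure_UNIV: "emeasure weight_measure UNIV = cumulative top"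
  unfolding cumulative_def using AE_weight_measure_pos by (intro emeasure_eq_AE) auto

lemma cumulative_small:
  assumes "0 < e" shows "\<exists>d>0. cumulative (ennreal d) < ennreal e"
proof -
  let ?A = "\<lambda>n::nat. {t. 0 < t \<and> ennreal t < ennreal (1 / Suc n)}"
  have "(\<lambda>n. emeasure weight_measure (?A n)) \<longlonglongrightarrow> emeasure weight_measure (\<Inter>n. ?A n)"
  proof (rule Lim_emeasure_decseq)
    show "decseq ?A"
    proof (rule decseq_SucI)
      fix n have "ennreal (1 / real (Suc (Suc n))) \<le> ennreal (1 / real (Suc n))"
        by (intro ennreal_leI) (simp add: field_simps)
      then show "?A (Suc n) \<subseteq> ?A n" by (auto intro: less_le_trans)
    qed
    show "emeasure weight_measure (?A n) \<noteq> \<infinity>" for n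
      using cumulative_finite[of "ennreal (1 / Suc n)"] unfolding cumulative_def by simp
  qed auto
  moreover have "(\<Inter>n. ?A n) = {}"
  proof -
    have "\<exists>n. \<not> ennreal t < ennreal (1 / Suc n)" if "0 < t" for t
      using reals_Archimedean[OF that] that
      by (auto simp: ennreal_less_iff inverse_eq_divide not_less intro: less_imp_le)
    then show ?thesis by blast
  qed
  ultimately have "(\<lambda>n. cumulative (ennreal (1 / Suc n))) \<longlonglongrightarrow> 0"
    unfolding cumulative_def by simp
  moreover have "(0::ennreal) < ennreal e" using assms by simp
  ultimately have "eventually (\<lambda>n. cumulative (ennreal (1 / Suc n)) < ennreal e) sequentially"
    by (rule order_tendstoD(2))
  then obtain n where "cumulative (ennreal (1 / Suc n)) < ennreal e"
    by (auto simp: eventually_sequentially)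
  then show ?thesis by (intro exI[of _ "1 / Suc n"]) auto
qed

text \<open>Subadditivity together with smallness near \<open>0\<close> makes the primitive
  continuous, infinite total weight makes it unbounded, and the intermediate value theorem
  applies.\<close>

lemma cumulative_surj:
  assumes top: "cumulative top = top" and w: "0 < w"
  shows "\<exists>d>0. cumulative (ennreal d) = ennreal w"
proof -
  define W where "W d = enn2real (cumulative (ennreal d))" for d
  have W: "cumulative (ennreal d) = ennreal (W d)" for d
    using cumulative_finite[of "ennreal d"] by (simp add: W_def)
  have W0: "0 \<le> W d" for d by (simp add: W_def)
  have W_mono: "W d \<le> W d'" if "d \<le> d'" for d d'
    using cumulative_mono[of "ennreal d" "ennreal d'"] that W0 by (simp add: W ennreal_leI ennreal_le_iff)
  have W_add: "W (d + h) \<le> W d + W h" if "0 \<le> d" "0 \<le> h" for d h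
    using cumulative_add_le[of "ennreal d" "ennreal h"] that W0
    by (simp add: W ennreal_plus[symmetric] ennreal_le_iff del: ennreal_plus)
  have "continuous_on {0..} W"
    unfolding continuous_on_iff
  proof (intro ballI allI impI)
    fix a e :: real assume a: "a \<in> {0..}" and e: "0 < e"
    obtain h where h: "0 < h" "W h < e"
      using cumulative_small[OF e] by (auto simp: W ennreal_less_iff W0)
    have "dist (W x) (W a) < e" if x: "x \<in> {0..}" "dist x a < h" for x
    proof (cases "x \<le> a")
      case True
      have "W a \<le> W (x + h)" using x True by (intro W_mono) (auto simp: dist_real_def)
      also have "\<dots> \<le> W x + W h" using x h by (intro W_add) auto
      finally show ?thesis using h W_mono[OF True] by (simp add: dist_real_def)
    next
      case False
      have "W x \<le> W (a + h)" using x False by (intro W_mono) (auto simp: dist_real_def)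
      also have "\<dots> \<le> W a + W h" using a h by (intro W_add) auto
      finally show ?thesis using h W_mono[of a x] False by (simp add: dist_real_def)
    qed
    then show "\<exists>d>0. \<forall>x\<in>{0..}. dist x a < d \<longrightarrow> dist (W x) (W a) < e" using h by blast
  qed
  moreover have "\<exists>n::nat. w \<le> W (real n)"
  proof (rule ccontr)
    assume "\<not> ?thesis"
    then have bound: "cumulative (ennreal (real n)) \<le> ennreal w" for n :: nat
      by (simp add: W ennreal_leI less_imp_le not_le)
    let ?A = "\<lambda>n::nat. {t. 0 < t \<and> ennreal t < ennreal (real n)}"
    have "(SUP n. emeasure weight_measure (?A n)) = emeasure weight_measure (\<Union>n. ?A n)"
    proof (rule SUP_emeasure_incseq)
      show "incseq ?A"
      proof (rule incseq_SucI)
        fix n have "ennreal (real n) \<le> ennreal (real (Suc n))" by (intro ennreal_leI) simp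
        then show "?A n \<subseteq> ?A (Suc n)" by (auto intro: less_le_trans)
      qed
    qed auto
    also have "(\<Union>n. ?A n) = {t. 0 < t \<and> ennreal t < top}"
      using reals_Archimedean2 by (auto simp: ennreal_less_iff)
    finally have *: "(SUP n. cumulative (ennreal (real n))) = top"
      using top unfolding cumulative_def by simp
    have "(SUP n. cumulative (ennreal (real n))) \<le> ennreal w" using bound by (intro SUP_least)
    then show False unfolding * by (simp add: top_unique)
  qed
  then obtain n :: nat where "w \<le> W (real n)" by blast
  moreover have "W 0 = 0" by (simp add: W_def)
  ultimately obtain d where d: "0 \<le> d" "W d = w"
    using IVT'[of W 0 w "real n"] w continuous_on_subset[of "{0..}" W "{0..real n}"] by auto
  then have "d \<noteq> 0" using w \<open>W 0 = 0\<close> by auto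
  then show ?thesis using d W by (intro exI[of _ d]) auto
qed

text \<open>\<open>D\<close> is the weight of the second step, from \<open>d1\<close> to
  \<open>d1 + d2\<close>. Finiteness of \<open>d1\<close> allows \<open>cumulative d1\<close> to be
  cancelled in the subadditivity estimate, which gives the bound on \<open>D\<close>.\<close>

lemma two_level_integral:
  assumes "d1 < top"
  obtains D where "cumulative d1 + D = cumulative (d1 + d2)" "D \<le> cumulative d2"
    "\<And>g1 g2. (\<integral>\<^sup>+t. (if ennreal t < d1 then g1 else if ennreal t < d1 + d2 then g2 else 0) \<partial>weight_measure)
      = g1 * cumulative d1 + g2 * D"
proof -
  let ?A = "{t. 0 < t \<and> ennreal t < d1}" and ?B = "{t. 0 < t \<and> d1 \<le> ennreal t \<and> ennreal t < d1 + d2}"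
  let ?D = "emeasure weight_measure ?B"
  have "cumulative d1 + ?D = emeasure weight_measure (?A \<union> ?B)"
    unfolding cumulative_def by (intro plus_emeasure) auto
  also have "?A \<union> ?B = {t. 0 < t \<and> ennreal t < d1 + d2}"
    using order.strict_trans2[of _ d1 "d1 + d2"] by (auto simp: not_less)
  finally have eq: "cumulative d1 + ?D = cumulative (d1 + d2)" by (simp add: cumulative_def)
  moreover have "?D \<le> cumulative d2"
    using cumulative_add_le[of d1 d2] cumulative_finite[OF assms] unfolding eq[symmetric]
    by (simp add: ennreal_add_left_cancel_le less_top[symmetric])
  moreover have "(\<integral>\<^sup>+t. (if ennreal t < d1 then g1 else if ennreal t < d1 + d2 then g2 else 0) \<partial>weight_measure)
      = g1 * cumulative d1 + g2 * ?D" for g1 g2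
  proof -
    have "(\<integral>\<^sup>+t. (if ennreal t < d1 then g1 else if ennreal t < d1 + d2 then g2 else 0) \<partial>weight_measure)
        = (\<integral>\<^sup>+t. g1 * indicator ?A t + g2 * indicator ?B t \<partial>weight_measure)"
      using AE_weight_measure_pos
      by (intro nn_integral_cong_AE) (auto elim!: eventually_mono split: split_indicator)
    also have "\<dots> = g1 * cumulative d1 + g2 * ?D"
      unfolding cumulative_def by (subst nn_integral_add) (auto simp: nn_integral_cmult_indicator)
    finally show ?thesis .
  qed
  ultimately show ?thesis by (rule that)
qed

end

context orlicz_lorentz
begin

lemma sup_norm_cmult:
  assumes x: "x \<in> borel_measurable half_line" and a: "0 < a"
  shows "sup_norm (\<lambda>s. a * x s) = ennreal a * sup_norm x"
proof -
  have ax: "(\<lambda>s. a * x s) \<in> borel_measurable half_line" using x by measurable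
  let ?Y = "{y \<in> borel_measurable half_line. modular \<psi> \<omega> y \<le> 1}"
  have "sup_norm (\<lambda>s. a * x s) = (SUP y\<in>?Y. ennreal a * (\<integral>\<^sup>+t. rearrangement x t * rearrangement y t \<partial>weight_measure))"
    unfolding sup_norm_def
  proof (intro SUP_cong refl)
    fix y assume "y \<in> ?Y"
    then have y: "y \<in> borel_measurable half_line" by simp
    note [measurable] = x[THEN rearrangement_measurable] y[THEN rearrangement_measurable]
    show "(\<integral>\<^sup>+t\<in>{0..}. (rearrangement (\<lambda>s. a * x s) t * rearrangement y t * ennreal (\<omega> t)) \<partial>lebesgue)
        = ennreal a * (\<integral>\<^sup>+t. rearrangement x t * rearrangement y t \<partial>weight_measure)"
      unfolding pairing_eq[OF ax y] unfolding rearrangement_cmult[OF x a] mult.assoc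
      by (rule nn_integral_cmult) measurable
  qed
  also have "\<dots> = ennreal a * (SUP y\<in>?Y. \<integral>\<^sup>+t. rearrangement x t * rearrangement y t \<partial>weight_measure)"
    by (rule SUP_mult_left_ennreal[symmetric])
  also have "(SUP y\<in>?Y. \<integral>\<^sup>+t. rearrangement x t * rearrangement y t \<partial>weight_measure) = sup_norm x"
    unfolding sup_norm_def by (intro SUP_cong refl) (simp add: pairing_eq[OF x])
  finally show ?thesis .
qed

text \<open>A rearrangement does not see where, or on how large a complement, a function vanishes as
  long as its modulus is \<open>c\<close> on a set of infinite measure: it is the constant
  \<open>c\<close>. Finite total weight admits such functions to the space, and all of them share
  one norm.\<close>

lemma not_locally_uniformly_non_square_finite:
  assumes fin: "cumulative top < top" and pos: "0 < cumulative top"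
  shows "\<not> locally_uniformly_non_square (orlicz_lorentz_space \<phi> \<omega>) (orlicz_norm \<phi> \<omega>)"
proof -
  obtain C where C: "0 < C" "cumulative top = ennreal C"
    using fin pos by (cases "cumulative top") (auto simp: ennreal_less_zero_iff)
  define const where "const x c \<longleftrightarrow> x \<in> borel_measurable half_line \<and> 0 \<le> c \<and>
    (\<exists>A\<in>sets lebesgue. A \<subseteq> {0..} \<and> emeasure lebesgue A = top \<and> (\<forall>s\<ge>0. \<bar>x s\<bar> = (if s \<in> A then c else 0)))"
    for x :: "real \<Rightarrow> real" and c :: real
  have const_rearr: "rearrangement x t = ennreal c" if xc: "const x c" for x c t
  proof -
    obtain A where A: "A \<in> sets lebesgue" "A \<subseteq> {0..}" "emeasure lebesgue A = top" "\<And>s. 0 \<le> s \<Longrightarrow> \<bar>x s\<bar> = (if s \<in> A then c else 0)"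
      using xc unfolding const_def by blast
    show ?thesis
      using xc A(4) rearrangement_two_levels[OF _ A(1-3) _ _ refl, of x "{}" 0 c t] by (auto simp: const_def)
  qed
  have const_modular: "modular \<Phi> \<omega> x = ennreal (\<Phi> c) * ennreal C"
    if "const x c" and \<Phi>: "\<Phi> \<in> borel_measurable borel" for x c \<Phi>
    using that(1) unfolding modular_eq_weight_measure[OF _ \<Phi>, of x, unfolded const_rearr[OF that(1)]]
    by (subst modular_eq_weight_measure)
       (auto simp: const_rearr[OF that(1)] const_def \<Phi> extend_top_def emeasure_weight_measure_UNIV C)
  have const_norm: "sup_norm x = sup_norm y" if "const x c" "const y c" for x y c
    unfolding sup_norm_def const_rearr[OF that(1)] const_rearr[OF that(2)] ..
  have const_space: "x \<in> orlicz_lorentz_space \<phi> \<omega>" if "const x c" for x c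
    using const_modular[OF that measurable] that
    by (auto simp: orlicz_lorentz_space_def const_def ennreal_mult_less_top intro!: exI[of _ 1])
  have one: "const (\<lambda>s. c) c" if "0 \<le> c" for c
    unfolding const_def using that emeasure_half_line_top by (intro conjI bexI[of _ "{0..}"]) auto
  \<comment> \<open>The constant \<open>r\<close> has \<open>\<psi>\<close>-modular exactly
    \<open>1\<close>, so it is a test function showing that the norm of the constant
    \<open>1\<close> is positive and can be normalised.\<close>
  obtain r where r: "0 \<le> r" "\<psi> r = 1 / C" using complementary_surj[of "1 / C"] C by auto
  have r0: "0 < r" using r C by (cases "r = 0") auto
  have "modular \<psi> \<omega> (\<lambda>s. r) \<le> 1"
    using const_modular[OF one[OF r(1)] complementary_measurable] r C by (simp add: ennreal_mult'[symmetric])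
  then have "(\<integral>\<^sup>+t. rearrangement (\<lambda>s. 1) t * rearrangement (\<lambda>s. r) t \<partial>weight_measure) \<le> sup_norm (\<lambda>s. 1)"
    by (intro sup_norm_ge) auto
  also have "(\<integral>\<^sup>+t. rearrangement (\<lambda>s. 1) t * rearrangement (\<lambda>s. r) t \<partial>weight_measure) = ennreal r * ennreal C"
    using const_rearr[OF one[OF zero_le_one]] const_rearr[OF one[OF r(1)]]
    by (simp add: emeasure_weight_measure_UNIV C)
  finally have "ennreal (r * C) \<le> sup_norm (\<lambda>s. 1)" using r C by (simp add: ennreal_mult')
  moreover have "0 < ennreal (r * C)" using r0 C by simp
  moreover have "sup_norm (\<lambda>s. 1) < top" using sup_norm_finite const_space[OF one] by simp
  ultimately obtain S where S: "0 < S" "sup_norm (\<lambda>s. 1) = ennreal S"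
    by (cases "sup_norm (\<lambda>s. 1)") (auto simp: ennreal_less_zero_iff)
  define c where "c = 1 / S"
  have c: "0 \<le> c" using S by (simp add: c_def)
  have "sup_norm (\<lambda>s. c * 1) = 1"
    using S by (subst sup_norm_cmult) (auto simp: c_def ennreal_mult'[symmetric])
  then have norm1: "orlicz_norm \<phi> \<omega> x = 1" if "const x c" for x
    using const_norm[OF that one[OF c]] by (simp add: orlicz_norm_eq)
  \<comment> \<open>Alternate unit intervals: \<open>A\<close> and its complement in the half-line
    both have infinite measure, and the half sum lives on the former, the half difference on the
    latter.\<close>
  define A where "A = (\<Union>n. {2 * real n + 0 ..< 2 * real n + 0 + 1})"
  have A [measurable]: "A \<in> sets borel" unfolding A_def by auto
  have A_sub: "A \<subseteq> {0..}" by (auto simp: A_def)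
  have A_top: "emeasure lebesgue A = top" unfolding A_def by (rule emeasure_alternate_intervals)
  have "emeasure lebesgue (\<Union>n. {2 * real n + 1 ..< 2 * real n + 1 + 1}) \<le> emeasure lebesgue ({0..} - A)"
  proof (rule emeasure_mono)
    have False if "2 * real n + 1 \<le> s" "s < 2 * real n + 1 + 1" "2 * real m \<le> s" "s < 2 * real m + 1" for m n s
    proof -
      have "real m < real (n + 1)" "real n < real m" using that by auto
      then show False unfolding of_nat_less_iff by simp
    qed
    then show "(\<Union>n. {2 * real n + 1 ..< 2 * real n + 1 + 1}) \<subseteq> {0..} - A" by (auto simp: A_def)
    show "{0..} - A \<in> sets lebesgue" using A by auto
  qed
  then have B_top: "emeasure lebesgue ({0..} - A) = top"
    unfolding emeasure_alternate_intervals by (simp add: top_unique)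
  define y where "y s = (if s \<in> A then c else - c)" for s
  have y_meas: "y \<in> borel_measurable half_line"
    unfolding y_def by (intro measurable_restrict_space1 measurable_completion) measurable
  have y: "const y c"
    unfolding const_def using c y_meas emeasure_half_line_top
    by (intro conjI bexI[of _ "{0..}"]) (auto simp: y_def)
  have "const (\<lambda>s. (c - y s) / 2) c" "const (\<lambda>s. (c + y s) / 2) c"
  proof -
    have m: "(\<lambda>s. (c - y s) / 2) \<in> borel_measurable half_line" "(\<lambda>s. (c + y s) / 2) \<in> borel_measurable half_line"
      using y_meas by measurable
    show "const (\<lambda>s. (c - y s) / 2) c"
      unfolding const_def using c m(1) B_top A by (intro conjI bexI[of _ "{0..} - A"]) (auto simp: y_def)
    show "const (\<lambda>s. (c + y s) / 2) c"
      unfolding const_def using c m(2) A_top A A_sub by (intro conjI bexI[of _ A]) (auto simp: y_def)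
  qed
  then have "min (orlicz_norm \<phi> \<omega> (\<lambda>s. (c - y s) / 2)) (orlicz_norm \<phi> \<omega> (\<lambda>s. (c + y s) / 2)) = 1"
    using norm1 by simp
  then show ?thesis
    unfolding locally_uniformly_non_square_def
    using const_space[OF one[OF c]] norm1[OF one[OF c]] const_space[OF y] norm1[OF y] by force
qed

section \<open>Normalised indicators and the failure of the \<open>Delta2\<close> condition\<close>

lemma complementary_quotient_mono: "0 < s \<Longrightarrow> s \<le> r \<Longrightarrow> \<psi> s / s \<le> \<psi> r / r"
  using complementary_scale_le[of "s / r" r] by (simp add: field_simps)

text \<open>The weight is tuned so that \<open>r\<close> times the indicator of \<open>A\<close> has
  \<open>\<psi>\<close>-modular \<open>1\<close>; the indicator scaled by
  \<open>\<psi> r / r\<close> then turns out to have norm \<open>1\<close>.\<close>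

definition bump :: "real \<Rightarrow> real set \<Rightarrow> bool" where
  "bump r A \<longleftrightarrow> 0 < r \<and> A \<in> sets lebesgue \<and> A \<subseteq> {0..} \<and> emeasure lebesgue A < top \<and>
    cumulative (emeasure lebesgue A) = ennreal (1 / \<psi> r)"

lemma indicator_measurable_half_line:
  "A \<in> sets lebesgue \<Longrightarrow> A \<subseteq> {0..} \<Longrightarrow> (\<lambda>s. c * indicator A s :: real) \<in> borel_measurable half_line"
  by (intro borel_measurable_times borel_measurable_const borel_measurable_indicator)
     (auto simp: sets_restrict_space_iff)

definition two_step :: "real set \<Rightarrow> real set \<Rightarrow> real \<Rightarrow> real \<Rightarrow> (real \<Rightarrow> real) \<Rightarrow> bool" where
  "two_step A B a b x \<longleftrightarrow> x \<in> borel_measurable half_line \<and> 0 \<le> b \<and> b \<le> a \<and>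
    (\<forall>s\<ge>0. \<bar>x s\<bar> = (if s \<in> A then a else if s \<in> B then b else 0))"

text \<open>The weight \<open>D\<close> of the lower step depends on the two sets only, so the same
  number serves for the element of the space, for the test function and for their pairing.\<close>

lemma two_step_integrals:
  assumes A: "bump r A" and B: "bump q B" and disj: "A \<inter> B = {}"
  shows "\<exists>D\<le>ennreal (1 / \<psi> q).
    ennreal (1 / \<psi> r) + D = cumulative (emeasure lebesgue A + emeasure lebesgue B) \<and>
    (\<forall>x \<Phi> a b. two_step A B a b x \<longrightarrow> \<Phi> \<in> borel_measurable borel \<longrightarrow> \<Phi> 0 = 0 \<longrightarrow>
      modular \<Phi> \<omega> x = ennreal (\<Phi> a) * ennreal (1 / \<psi> r) + ennreal (\<Phi> b) * D) \<and>
    (\<forall>x y a b c d. two_step A B a b x \<longrightarrow> two_step A B c d y \<longrightarrow>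
      (\<integral>\<^sup>+t. rearrangement x t * rearrangement y t \<partial>weight_measure) =
        ennreal (a * c) * ennreal (1 / \<psi> r) + ennreal (b * d) * D)"
proof -
  let ?d1 = "emeasure lebesgue A" and ?d2 = "emeasure lebesgue B"
  have d: "?d1 < top" "cumulative ?d1 = ennreal (1 / \<psi> r)" "cumulative ?d2 = ennreal (1 / \<psi> q)"
    using A B unfolding bump_def by blast+
  have sets: "A \<in> sets lebesgue" "A \<subseteq> {0..}" "B \<in> sets lebesgue" "B \<subseteq> {0..}"
    using A B unfolding bump_def by blast+
  obtain D where D: "cumulative ?d1 + D = cumulative (?d1 + ?d2)" "D \<le> cumulative ?d2"
    "\<And>g1 g2. (\<integral>\<^sup>+t. (if ennreal t < ?d1 then g1 else if ennreal t < ?d1 + ?d2 then g2 else 0) \<partial>weight_measure)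
      = g1 * cumulative ?d1 + g2 * D"
    by (rule two_level_integral[OF d(1), of ?d2]) (rule that)
  have rearr: "rearrangement x t = ennreal (if ennreal t < ?d1 then a else if ennreal t < ?d1 + ?d2 then b else 0)"
    if x: "two_step A B a b x" for x a b t
  proof (rule rearrangement_two_levels[OF _ sets(1,2) refl sets(3,4) refl disj])
    show "\<bar>x s\<bar> = (if s \<in> A then a else if s \<in> B then b else 0)" if "0 \<le> s" for s
      using x that unfolding two_step_def by blast
  qed (use x in \<open>simp_all add: two_step_def\<close>)
  have "modular \<Phi> \<omega> x = ennreal (\<Phi> a) * ennreal (1 / \<psi> r) + ennreal (\<Phi> b) * D"
    if x: "two_step A B a b x" and \<Phi>: "\<Phi> \<in> borel_measurable borel" "\<Phi> 0 = 0" for x \<Phi> a b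
  proof -
    have xm: "x \<in> borel_measurable half_line" and ab: "0 \<le> b" "b \<le> a"
      using x by (simp_all add: two_step_def)
    have "modular \<Phi> \<omega> x = (\<integral>\<^sup>+t. (if ennreal t < ?d1 then ennreal (\<Phi> a) else if ennreal t < ?d1 + ?d2 then ennreal (\<Phi> b) else 0) \<partial>weight_measure)"
      unfolding modular_eq_weight_measure[OF xm \<Phi>(1)] rearr[OF x]
      using ab \<Phi>(2) by (intro nn_integral_cong) (simp add: extend_top_def)
    then show ?thesis unfolding D(3) d(2) .
  qed
  moreover have "(\<integral>\<^sup>+t. rearrangement x t * rearrangement y t \<partial>weight_measure) =
      ennreal (a * c) * ennreal (1 / \<psi> r) + ennreal (b * d) * D"
    if x: "two_step A B a b x" and y: "two_step A B c d y" for x y a b c d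
  proof -
    have ab: "0 \<le> b" "b \<le> a" "0 \<le> d" "d \<le> c" using x y by (simp_all add: two_step_def)
    have "(\<integral>\<^sup>+t. rearrangement x t * rearrangement y t \<partial>weight_measure)
      = (\<integral>\<^sup>+t. (if ennreal t < ?d1 then ennreal (a * c) else if ennreal t < ?d1 + ?d2 then ennreal (b * d) else 0) \<partial>weight_measure)"
      unfolding rearr[OF x] rearr[OF y]
      using ab by (intro nn_integral_cong) (simp add: ennreal_mult)
    then show ?thesis unfolding D(3) d(2) .
  qed
  ultimately show ?thesis using D(1,2) unfolding d by blast
qed

text \<open>From below, \<open>r\<close> times the indicator is a test function and the pairing is
  \<open>1\<close>. From above, the Amemiya value at a \<open>u\<close> almost attaining the
  supremum that defines \<open>\<psi> r\<close> is \<open>(\<psi> r + \<phi> u) / (u * r)\<close>,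
  which is close to \<open>1\<close>.\<close>

lemma bump_norm:
  assumes A: "bump r A"
  shows "(\<lambda>s. \<psi> r / r * indicator A s) \<in> orlicz_lorentz_space \<phi> \<omega>"
    and "orlicz_norm \<phi> \<omega> (\<lambda>s. \<psi> r / r * indicator A s) = 1"
proof -
  have r: "0 < r" and sets: "A \<in> sets lebesgue" "A \<subseteq> {0..}" and fin: "emeasure lebesgue A < top"
    and cum: "cumulative (emeasure lebesgue A) = ennreal (1 / \<psi> r)"
    using A by (auto simp: bump_def)
  have \<psi>r: "0 < \<psi> r" using complementary_pos[of r] r by simp
  have rearr: "rearrangement (\<lambda>s. c * indicator A s) t = (if ennreal t < emeasure lebesgue A then ennreal c else 0)" if "0 \<le> c" for c t
    using rearrangement_two_levels[OF indicator_measurable_half_line[OF sets] sets refl, of "{}" 0 0 c c t] that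
    by auto
  obtain D where D: "\<And>g1 g2. (\<integral>\<^sup>+t. (if ennreal t < emeasure lebesgue A then g1 else if ennreal t < emeasure lebesgue A + 0 then g2 else 0) \<partial>weight_measure)
      = g1 * cumulative (emeasure lebesgue A) + g2 * D"
    by (rule two_level_integral[OF fin, of 0]) (rule that)
  have step: "(\<integral>\<^sup>+t. (if ennreal t < emeasure lebesgue A then g else 0) \<partial>weight_measure) = g * ennreal (1 / \<psi> r)" for g
  proof -
    have "(if b then g else if c then 0 else 0) = (if b then g else 0)" for b c :: bool by simp
    then show ?thesis using D[of g 0] unfolding cum by (simp only: mult_zero_left add_0_right)
  qed
  have mod: "modular \<Phi> \<omega> (\<lambda>s. c * indicator A s) = ennreal (\<Phi> c) * ennreal (1 / \<psi> r)"
    if "\<Phi> \<in> borel_measurable borel" "\<Phi> 0 = 0" "0 \<le> c" for \<Phi> c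
    unfolding modular_eq_weight_measure[OF indicator_measurable_half_line[OF sets] that(1)] rearr[OF that(3)] step[symmetric]
    using that by (intro nn_integral_cong) (auto simp: extend_top_def)
  define b where "b = \<psi> r / r"
  have b: "0 < b" "b * r = \<psi> r" using r \<psi>r by (auto simp: b_def)
  let ?x = "\<lambda>s. b * indicator A s"
  have xm: "?x \<in> borel_measurable half_line" by (rule indicator_measurable_half_line[OF sets])
  have space: "?x \<in> orlicz_lorentz_space \<phi> \<omega>"
    using mod[OF measurable zero, of b] b xm
    by (auto simp: orlicz_lorentz_space_def ennreal_mult_less_top intro!: exI[of _ 1])
  have "modular \<psi> \<omega> (\<lambda>s. r * indicator A s) \<le> 1"
    using mod[OF complementary_measurable complementary_zero, of r] r \<psi>r by (simp add: ennreal_mult'[symmetric])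
  then have "(\<integral>\<^sup>+t. rearrangement ?x t * rearrangement (\<lambda>s. r * indicator A s) t \<partial>weight_measure) \<le> sup_norm ?x"
    by (intro sup_norm_ge xm indicator_measurable_half_line[OF sets])
  also have "(\<integral>\<^sup>+t. rearrangement ?x t * rearrangement (\<lambda>s. r * indicator A s) t \<partial>weight_measure)
      = (\<integral>\<^sup>+t. (if ennreal t < emeasure lebesgue A then ennreal (b * r) else 0) \<partial>weight_measure)"
    using b(1) r by (intro nn_integral_cong) (auto simp: rearr ennreal_mult)
  also have "\<dots> = 1" unfolding step b(2) using \<psi>r by (simp add: ennreal_mult'[symmetric])
  finally have ge: "1 \<le> sup_norm ?x" .
  have "sup_norm ?x \<le> 1"
  proof (rule ennreal_le_epsilon)
    fix e :: real assume e: "0 < e"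
    \<comment> \<open>The bound \<open>1/2\<close> keeps \<open>\<psi> r \<le> 2 * (u * r)\<close>,
      which converts the error \<open>\<eta> * \<psi> r\<close> into at most
      \<open>e * (u * r)\<close>.\<close>
    define \<eta> where "\<eta> = min (1/2) (e / 2)"
    have \<eta>: "0 < \<eta>" "\<eta> \<le> 1/2" "2 * \<eta> \<le> e" using e by (auto simp: \<eta>_def)
    have "(1 - \<eta>) * \<psi> r < \<psi> r" using \<eta> \<psi>r by simp
    then have "\<exists>u\<in>{0<..}. (1 - \<eta>) * \<psi> r < \<bar>u * r\<bar> - \<phi> u"
      unfolding complementary_def[of \<phi> r] by (subst (asm) less_cSUP_iff) (auto simp: complementary_bdd)
    then obtain u where u: "0 < u" "(1 - \<eta>) * \<psi> r < u * r - \<phi> u" using r by auto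
    have "sup_norm ?x \<le> ennreal (1 / (u / b)) * (1 + modular \<phi> \<omega> (\<lambda>s. u / b * ?x s))"
      using u b by (intro amemiya_le xm) auto
    also have "(\<lambda>s. u / b * ?x s) = (\<lambda>s. u * indicator A s)" using b by auto
    also have "modular \<phi> \<omega> (\<lambda>s. u * indicator A s) = ennreal (\<phi> u / \<psi> r)"
      using mod[OF measurable zero, of u] u \<psi>r by (simp add: ennreal_mult'[symmetric])
    also have "ennreal (1 / (u / b)) * (1 + ennreal (\<phi> u / \<psi> r)) = ennreal (b / u * (1 + \<phi> u / \<psi> r))"
      using b u \<psi>r by (simp add: ennreal_mult'[symmetric] ennreal_plus[symmetric] ennreal_1[symmetric] del: ennreal_plus ennreal_1)
    also have "b / u * (1 + \<phi> u / \<psi> r) = (\<psi> r + \<phi> u) / (u * r)"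
      using u r \<psi>r by (simp add: b_def field_simps)
    also have "\<dots> \<le> 1 + e"
    proof -
      have "1/2 * \<psi> r \<le> (1 - \<eta>) * \<psi> r" using \<eta> \<psi>r by (intro mult_right_mono) auto
      then have "\<psi> r \<le> 2 * (u * r)" using u(2) nonneg[of u] by linarith
      then have "\<eta> * \<psi> r \<le> \<eta> * (2 * (u * r))" using \<eta> by (intro mult_left_mono) auto
      also have "\<dots> \<le> e * (u * r)" using mult_right_mono[OF \<eta>(3), of "u * r"] u r by simp
      finally have "\<psi> r + \<phi> u \<le> u * r + e * (u * r)" using u(2) by (simp add: algebra_simps)
      then show ?thesis using u r by (simp add: divide_le_eq distrib_right)
    qed
    finally show "sup_norm ?x \<le> 1 + ennreal e" using e by (simp add: ennreal_leI)
  qed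
  then have "sup_norm ?x = 1" using ge by order
  then show "(\<lambda>s. \<psi> r / r * indicator A s) \<in> orlicz_lorentz_space \<phi> \<omega>"
    and "orlicz_norm \<phi> \<omega> (\<lambda>s. \<psi> r / r * indicator A s) = 1"
    using space by (auto simp: orlicz_norm_eq b_def)
qed

text \<open>The test function takes the values \<open>r1 / (1 + e)\<close> and
  \<open>r2 / (1 + e)\<close>; \<open>mod\<close> makes it admissible. The order
  \<open>r2 \<le> r1\<close> puts the second set on the lower step of both functions. There its
  weight falls short of \<open>1 / \<psi> r2\<close> by at most \<open>1 / \<psi> r1\<close>, which
  is the loss \<open>\<psi> r2 / \<psi> r1\<close>.\<close>

lemma bump_sum_norm:
  assumes A1: "bump r1 A1" and A2: "bump r2 A2" and disj: "A1 \<inter> A2 = {}"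
    and r: "r2 \<le> r1" and e: "0 < e"
    and mod: "\<psi> (r1 / (1 + e)) / \<psi> r1 + \<psi> (r2 / (1 + e)) / \<psi> r2 \<le> 1"
    and x: "x \<in> borel_measurable half_line"
      "\<And>s. 0 \<le> s \<Longrightarrow> \<bar>x s\<bar> = (if s \<in> A1 then \<psi> r1 / r1 else if s \<in> A2 then \<psi> r2 / r2 else 0)"
  shows "(2 - \<psi> r2 / \<psi> r1) / (1 + e) / 2 \<le> orlicz_norm \<phi> \<omega> (\<lambda>s. x s / 2)"
proof -
  have rpos: "0 < r1" "0 < r2" using A1 A2 by (auto simp: bump_def)
  have \<psi>: "0 < \<psi> r1" "0 < \<psi> r2" using rpos complementary_pos by auto
  have sets: "A1 \<in> sets lebesgue" "A1 \<subseteq> {0..}" "A2 \<in> sets lebesgue" "A2 \<subseteq> {0..}"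
    using A1 A2 by (auto simp: bump_def)
  obtain D where D: "D \<le> ennreal (1 / \<psi> r2)"
      "ennreal (1 / \<psi> r1) + D = cumulative (emeasure lebesgue A1 + emeasure lebesgue A2)"
    and D_modular: "\<forall>x \<Phi> a b. two_step A1 A2 a b x \<longrightarrow> \<Phi> \<in> borel_measurable borel \<longrightarrow> \<Phi> 0 = 0 \<longrightarrow>
      modular \<Phi> \<omega> x = ennreal (\<Phi> a) * ennreal (1 / \<psi> r1) + ennreal (\<Phi> b) * D"
    and D_pairing: "\<forall>x y a b c d. two_step A1 A2 a b x \<longrightarrow> two_step A1 A2 c d y \<longrightarrow>
      (\<integral>\<^sup>+t. rearrangement x t * rearrangement y t \<partial>weight_measure) =
        ennreal (a * c) * ennreal (1 / \<psi> r1) + ennreal (b * d) * D"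
    using two_step_integrals[OF A1 A2 disj] by (elim exE conjE)
  obtain d where d: "0 \<le> d" "D = ennreal d" using D(1) by (cases D) (auto simp: top_unique)
  have d_le: "d \<le> 1 / \<psi> r2" using D(1) d \<psi> by (simp add: ennreal_le_iff)
  have "ennreal (1 / \<psi> r2) \<le> cumulative (emeasure lebesgue A1 + emeasure lebesgue A2)"
  proof -
    have "ennreal (1 / \<psi> r2) = cumulative (emeasure lebesgue A2)" using A2 unfolding bump_def by metis
    also have "\<dots> \<le> cumulative (emeasure lebesgue A1 + emeasure lebesgue A2)" by (rule cumulative_mono) simp
    finally show ?thesis .
  qed
  then have "ennreal (1 / \<psi> r2) \<le> ennreal (1 / \<psi> r1 + d)"
    unfolding D(2)[symmetric] using d \<psi> by (simp add: ennreal_plus)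
  then have d_ge: "1 / \<psi> r2 \<le> 1 / \<psi> r1 + d" using d \<psi> by (subst (asm) ennreal_le_iff) auto
  have b: "0 \<le> \<psi> r2 / r2" "\<psi> r2 / r2 \<le> \<psi> r1 / r1"
    using complementary_quotient_mono[OF rpos(2) r] rpos by auto
  have two_x: "two_step A1 A2 (\<psi> r1 / r1) (\<psi> r2 / r2) x"
    unfolding two_step_def using x b by blast
  have "modular \<phi> \<omega> x < top"
    unfolding D_modular[rule_format, OF two_x measurable zero] d by (simp add: ennreal_mult_less_top)
  then have x_space: "x \<in> orlicz_lorentz_space \<phi> \<omega>"
    using x by (auto simp: orlicz_lorentz_space_def intro!: exI[of _ 1])
  obtain N where N: "0 \<le> N" "sup_norm x = ennreal N"
    using sup_norm_finite[OF x_space] by (cases "sup_norm x") auto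
  define s1 s2 where "s1 = r1 / (1 + e)" and "s2 = r2 / (1 + e)"
  have s: "0 \<le> s2" "s2 \<le> s1" using rpos r e by (auto simp: s1_def s2_def divide_right_mono)
  define z where "z t = s1 * indicator A1 t + s2 * indicator A2 t" for t
  have z_meas: "z \<in> borel_measurable half_line"
    unfolding z_def[abs_def] using sets by (intro borel_measurable_add indicator_measurable_half_line)
  have z: "\<bar>z t\<bar> = (if t \<in> A1 then s1 else if t \<in> A2 then s2 else 0)" for t
    using disj s by (auto simp: z_def)
  have two_z: "two_step A1 A2 s1 s2 z"
    unfolding two_step_def using z_meas s z by blast
  have "\<psi> s2 * d \<le> \<psi> s2 * (1 / \<psi> r2)" using d_le by (intro mult_left_mono) auto
  then have "\<psi> s1 * (1 / \<psi> r1) + \<psi> s2 * d \<le> 1" using mod by (simp add: s1_def s2_def)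
  then have "ennreal (\<psi> s1 * (1 / \<psi> r1) + \<psi> s2 * d) \<le> 1" by simp
  then have "modular \<psi> \<omega> z \<le> 1"
    unfolding D_modular[rule_format, OF two_z complementary_measurable complementary_zero] d
    using d \<psi> by (simp add: ennreal_mult'[symmetric] ennreal_plus[symmetric] del: ennreal_plus)
  then have "(\<integral>\<^sup>+t. rearrangement x t * rearrangement z t \<partial>weight_measure) \<le> sup_norm x"
    by (intro sup_norm_ge x(1) z_meas)
  then have "ennreal (\<psi> r1 / r1 * s1) * ennreal (1 / \<psi> r1) + ennreal (\<psi> r2 / r2 * s2) * ennreal d \<le> ennreal N"
    unfolding D_pairing[rule_format, OF two_x two_z] N d .
  then have "\<psi> r1 / r1 * s1 * (1 / \<psi> r1) + \<psi> r2 / r2 * s2 * d \<le> N"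
  proof -
    have nn: "0 \<le> \<psi> r1 / r1 * s1" "0 \<le> \<psi> r2 / r2 * s2" "0 \<le> 1 / \<psi> r1"
      using \<psi> s b rpos by simp_all
    have "p * u + q * v \<le> N"
      if "ennreal p * ennreal u + ennreal q * ennreal v \<le> ennreal N" "0 \<le> p" "0 \<le> u" "0 \<le> q" "0 \<le> v" for p q u v
      using that N(1) by (simp add: ennreal_mult'[symmetric] ennreal_plus[symmetric] ennreal_le_iff del: ennreal_plus)
    then show ?thesis
      using \<open>ennreal (\<psi> r1 / r1 * s1) * ennreal (1 / \<psi> r1) + ennreal (\<psi> r2 / r2 * s2) * ennreal d \<le> ennreal N\<close>
        nn d(1) by blast
  qed
  moreover have "\<psi> r1 / r1 * s1 * (1 / \<psi> r1) = 1 / (1 + e)" using rpos \<psi> by (simp add: s1_def)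
  moreover have "\<psi> r2 / r2 * s2 * d = \<psi> r2 * d / (1 + e)" using rpos by (simp add: s2_def)
  moreover have "1 - \<psi> r2 / \<psi> r1 \<le> \<psi> r2 * d"
    using mult_left_mono[OF d_ge, of "\<psi> r2"] \<psi> by (simp add: distrib_left)
  then have "(2 - \<psi> r2 / \<psi> r1) / (1 + e) \<le> (1 + \<psi> r2 * d) / (1 + e)"
    using e by (intro divide_right_mono) auto
  ultimately have le: "(2 - \<psi> r2 / \<psi> r1) / (1 + e) \<le> N" by (simp add: add_divide_distrib)
  have eq: "orlicz_norm \<phi> \<omega> (\<lambda>s. x s / 2) = N / 2"
  proof -
    have "sup_norm (\<lambda>s. 1 / 2 * x s) = ennreal (1 / 2) * sup_norm x" by (rule sup_norm_cmult[OF x(1)]) simp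
    also have "\<dots> = ennreal (1 / 2 * N)" unfolding N(2) by (rule ennreal_mult[symmetric]) (use N in auto)
    finally show ?thesis using N(1) by (simp add: orlicz_norm_eq)
  qed
  show ?thesis unfolding eq using le by (rule divide_right_mono) simp
qed

lemma not_locally_uniformly_non_square_not_Delta2:
  assumes top: "cumulative top = top" and D2: "\<not> Delta2 \<psi>"
  shows "\<not> locally_uniformly_non_square (orlicz_lorentz_space \<phi> \<omega>) (orlicz_norm \<phi> \<omega>)"
proof
  assume luns: "locally_uniformly_non_square (orlicz_lorentz_space \<phi> \<omega>) (orlicz_norm \<phi> \<omega>)"
  have \<psi>1: "0 < \<psi> 1" by (rule complementary_pos) simp
  have bump_exists: "\<exists>d>0. \<forall>a\<ge>0. bump r {a..<a + d}" if "0 < r" for r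
  proof -
    have "0 < 1 / \<psi> r" using complementary_pos[of r] that by simp
    then obtain d where "0 < d" "cumulative (ennreal d) = ennreal (1 / \<psi> r)"
      using cumulative_surj[OF top] by blast
    then show ?thesis using that by (intro exI[of _ d]) (auto simp: bump_def)
  qed
  obtain d0 where d0: "0 < d0" "bump 1 {0..<0 + d0}" using bump_exists[of 1] by auto
  define A where "A = {0..<0 + d0}"
  define x where "x = (\<lambda>s. \<psi> 1 / 1 * indicator A s :: real)"
  have x: "x \<in> orlicz_lorentz_space \<phi> \<omega>" "orlicz_norm \<phi> \<omega> x = 1"
    using bump_norm[OF d0(2)] by (auto simp: x_def A_def)
  have "\<exists>\<delta>\<in>{0<..<1}. \<forall>y\<in>orlicz_lorentz_space \<phi> \<omega>. orlicz_norm \<phi> \<omega> y \<le> 1 \<longrightarrow>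
      min (orlicz_norm \<phi> \<omega> (\<lambda>s. (x s - y s) / 2)) (orlicz_norm \<phi> \<omega> (\<lambda>s. (x s + y s) / 2)) \<le> 1 - \<delta>"
    using luns x unfolding locally_uniformly_non_square_def by blast
  then obtain \<delta> where \<delta>01: "\<delta> \<in> {0<..<1}" and min_le: "\<forall>y\<in>orlicz_lorentz_space \<phi> \<omega>. orlicz_norm \<phi> \<omega> y \<le> 1 \<longrightarrow>
      min (orlicz_norm \<phi> \<omega> (\<lambda>s. (x s - y s) / 2)) (orlicz_norm \<phi> \<omega> (\<lambda>s. (x s + y s) / 2)) \<le> 1 - \<delta>"
    by (elim bexE)
  have \<delta>: "0 < \<delta>" "\<delta> < 1" using \<delta>01 by auto
  \<comment> \<open>The lower bound reached below is \<open>(2 - e) / (1 + e) / 2\<close>, which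
    exceeds \<open>1 - 2 * e = 1 - \<delta>\<close>.\<close>
  define e where "e = \<delta> / 2"
  have e: "0 < e" "e < 1" using \<delta> by (auto simp: e_def)
  define m where "m = \<psi> (e / (1 + e))"
  have m: "0 < m" unfolding m_def using e by (intro complementary_pos) auto
  \<comment> \<open>The first entry forces
    \<open>\<psi> (r / (1 + e)) / \<psi> r \<le> e / (1 + e)\<close>, exactly the room left beside
    the bound \<open>1 / (1 + e)\<close> that convexity gives for the fixed bump. The second entry
    forces the dichotomy.\<close>
  define K where "K = max ((1 + e) / e) (\<psi> 1 / (e * m))"
  have K: "0 < K" "(1 + e) / e \<le> K" "\<psi> 1 / (e * m) \<le> K" using e by (auto simp: K_def less_max_iff_disj)
  obtain v where v: "0 < v" "K * \<psi> v < \<psi> ((1 + e) * v)" using not_Delta2[OF D2, of "1 + e" K] e by auto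
  define r where "r = (1 + e) * v"
  have r: "0 < r" "r / (1 + e) = v" using v e by (auto simp: r_def)
  have \<psi>r: "0 < \<psi> r" using complementary_pos[of r] r by simp
  have mod_r: "\<psi> (r / (1 + e)) / \<psi> r \<le> e / (1 + e)"
  proof -
    have "(1 + e) / e * \<psi> v \<le> K * \<psi> v" using K by (intro mult_right_mono) auto
    then have "(1 + e) / e * \<psi> v \<le> \<psi> r" using v by (simp add: r_def)
    then show ?thesis using e \<psi>r by (simp add: r(2) field_simps)
  qed
  have mod_1: "\<psi> (1 / (1 + e)) / \<psi> 1 \<le> 1 / (1 + e)"
    using complementary_scale_le[of "1 / (1 + e)" 1] e \<psi>1 by (simp add: divide_le_eq)
  have mod: "\<psi> (r / (1 + e)) / \<psi> r + \<psi> (1 / (1 + e)) / \<psi> 1 \<le> 1"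
  proof -
    have "e / (1 + e) + 1 / (1 + e) = 1" using e by (simp add: add_divide_distrib[symmetric])
    then show ?thesis using mod_r mod_1 by linarith
  qed
  \<comment> \<open>If \<open>r \<le> e\<close>, convexity makes \<open>\<psi> r\<close> at most
    \<open>e * \<psi> 1\<close>. Otherwise \<open>v\<close> is at least \<open>e / (1 + e)\<close>,
    so \<open>\<psi> v \<ge> m\<close>, and the choice of \<open>K\<close> lifts
    \<open>\<psi> r\<close> above \<open>\<psi> 1 / e\<close>.\<close>
  have dichotomy: "\<psi> r \<le> e * \<psi> 1 \<or> \<psi> 1 \<le> e * \<psi> r"
  proof (rule ccontr)
    assume "\<not> ?thesis"
    then have n: "e * \<psi> 1 < \<psi> r" "e * \<psi> r < \<psi> 1" by auto
    have "e \<le> r"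
    proof (rule ccontr)
      assume "\<not> e \<le> r"
      then have "\<psi> r \<le> \<psi> (e * 1)" using r by (intro complementary_mono) auto
      also have "\<dots> \<le> e * \<psi> 1" using e by (intro complementary_scale_le) auto
      finally show False using n by simp
    qed
    then have "e / (1 + e) \<le> v" using e r by (auto simp: field_simps)
    then have "m \<le> \<psi> v" unfolding m_def using e by (intro complementary_mono) auto
    then have "K * m \<le> K * \<psi> v" using K by (intro mult_left_mono) auto
    then have "K * m < \<psi> r" using v by (simp add: r_def)
    moreover have "\<psi> 1 \<le> e * (K * m)" using K(3) e m by (simp add: field_simps)
    ultimately have "\<psi> 1 < e * \<psi> r" using mult_strict_left_mono[of "K * m" "\<psi> r" e] e by linarith
    then show False using n by simp
  qed
  obtain d where d: "0 < d" "bump r {d0..<d0 + d}" using bump_exists[OF r(1)] d0 by auto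
  define B where "B = {d0..<d0 + d}"
  define y where "y = (\<lambda>s. \<psi> r / r * indicator B s :: real)"
  have y: "y \<in> orlicz_lorentz_space \<phi> \<omega>" "orlicz_norm \<phi> \<omega> y = 1"
    using bump_norm[OF d(2)] by (auto simp: y_def B_def)
  have AB: "bump 1 A" "bump r B" "A \<inter> B = {}" "B \<inter> A = {}" using d d0 by (auto simp: A_def B_def)
  \<comment> \<open>Both signs of \<open>y\<close> give the same modulus, so one bound serves the
    half sum and the half difference. The dichotomy decides which of the two bumps is the upper
    step.\<close>
  have lower: "1 - \<delta> < orlicz_norm \<phi> \<omega> (\<lambda>s. w s / 2)"
    if w: "w \<in> borel_measurable half_line"
      "\<And>s. \<bar>w s\<bar> = (if s \<in> A then \<psi> 1 / 1 else if s \<in> B then \<psi> r / r else 0)" for w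
  proof -
    have "(2 - e) / (1 + e) / 2 \<le> orlicz_norm \<phi> \<omega> (\<lambda>s. w s / 2)"
      using dichotomy
    proof
      assume *: "\<psi> r \<le> e * \<psi> 1"
      have "r \<le> 1"
      proof (rule ccontr)
        assume "\<not> r \<le> 1"
        then have "\<psi> 1 < \<psi> r" by (intro complementary_strict_mono) auto
        moreover have "e * \<psi> 1 \<le> 1 * \<psi> 1" using e by (intro mult_right_mono) auto
        ultimately show False using * by simp
      qed
      then have "(2 - \<psi> r / \<psi> 1) / (1 + e) / 2 \<le> orlicz_norm \<phi> \<omega> (\<lambda>s. w s / 2)"
        using mod w by (intro bump_sum_norm[OF AB(1,2,3) _ e(1)]) (auto simp: add.commute)
      moreover have "(2 - e) / (1 + e) / 2 \<le> (2 - \<psi> r / \<psi> 1) / (1 + e) / 2"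
        using * \<psi>1 e by (intro divide_right_mono diff_left_mono) (auto simp: divide_le_eq)
      ultimately show ?thesis by linarith
    next
      assume *: "\<psi> 1 \<le> e * \<psi> r"
      have "1 \<le> r"
      proof (rule ccontr)
        assume "\<not> 1 \<le> r"
        then have "\<psi> r < \<psi> 1" using r by (intro complementary_strict_mono) auto
        moreover have "e * \<psi> r \<le> 1 * \<psi> r" using e by (intro mult_right_mono) auto
        ultimately show False using * by simp
      qed
      then have "(2 - \<psi> 1 / \<psi> r) / (1 + e) / 2 \<le> orlicz_norm \<phi> \<omega> (\<lambda>s. w s / 2)"
        using mod w AB(3) by (intro bump_sum_norm[OF AB(2,1,4) _ e(1)]) auto
      moreover have "(2 - e) / (1 + e) / 2 \<le> (2 - \<psi> 1 / \<psi> r) / (1 + e) / 2"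
        using * \<psi>r e by (intro divide_right_mono diff_left_mono) (auto simp: divide_le_eq)
      ultimately show ?thesis by linarith
    qed
    moreover have "1 - \<delta> < (2 - e) / (1 + e) / 2"
    proof -
      have "(1 - 2 * e) * (2 * (1 + e)) < 2 - e"
      proof -
        have "0 < e + e * (e * 4)" using e by (intro add_pos_pos mult_pos_pos) auto
        then show ?thesis by (simp add: algebra_simps)
      qed
      then show ?thesis using e by (simp add: e_def[symmetric] less_divide_eq) (simp add: e_def algebra_simps)
    qed
    ultimately show ?thesis by linarith
  qed
  have sgn: "\<bar>x s - y s\<bar> = (if s \<in> A then \<psi> 1 / 1 else if s \<in> B then \<psi> r / r else 0)"
    "\<bar>x s + y s\<bar> = (if s \<in> A then \<psi> 1 / 1 else if s \<in> B then \<psi> r / r else 0)" for s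
    using AB(3) r \<psi>1 \<psi>r by (auto simp: x_def y_def)
  note [measurable] = x(1)[THEN space_measurable] y(1)[THEN space_measurable]
  have "1 - \<delta> < orlicz_norm \<phi> \<omega> (\<lambda>s. (x s - y s) / 2)" by (rule lower[OF _ sgn(1)]) measurable
  moreover have "1 - \<delta> < orlicz_norm \<phi> \<omega> (\<lambda>s. (x s + y s) / 2)" by (rule lower[OF _ sgn(2)]) measurable
  ultimately show False using min_le y by force
qed

end

theorem theorem4p1:
  fixes \<phi> \<omega> :: "real \<Rightarrow> real"
  assumes "orlicz_function \<phi>"
    and "weight_function \<omega>"
    and "\<exists>t>0. \<omega> t \<noteq> 0"
  shows "locally_uniformly_non_square (orlicz_lorentz_space \<phi> \<omega>) (orlicz_norm \<phi> \<omega>) \<longleftrightarrow>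
    Delta2 (complementary \<phi>) \<and> (\<integral>\<^sup>+t\<in>{0..}. ennreal (\<omega> t) \<partial>lebesgue) = top"
proof -
  interpret orlicz_lorentz \<phi> \<omega> using assms by unfold_locales
  obtain t where t: "0 < t" "\<omega> t \<noteq> 0" using assms(3) by blast
  then have "0 < ennreal ((t - 0) * \<omega> t)" using weight_nonneg[of t] by simp
  also have "\<dots> \<le> cumulative (ennreal t)" using cumulative_gap[of 0 t] t by simp
  also have "\<dots> \<le> cumulative top" by (rule cumulative_mono) simp
  finally have "0 < cumulative top" .
  then show ?thesis
    unfolding cumulative_top[symmetric]
    using locally_uniformly_non_square_if not_locally_uniformly_non_square_finite
      not_locally_uniformly_non_square_not_Delta2 less_top[of "cumulative top"]
    by blast
qed

end
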